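(* Realize the Leech lattice as $\Lambda_{24}=\{x/\sqrt8\}$ where $x$ ranges over the integer vectors described in the context, and let $w=\tfrac1{\sqrt8}(5,1^{23})$, $v=\tfrac1{\sqrt8}(4,4,0^{22})$, $u=\tfrac1{\sqrt8}(1,1,-3,1^{21})$. Let $C_{275}=\{x\in\Lambda(2): x\cdot w=3,\ x\cdot v=1\}$, $C_{162}=\{x\in C_{275}:x\cdot u=2\}$, $C_{112}=\{x\in C_{275}: x\cdot u=1\}$, $C_{162}'=w-C_{162}$, $C_{112}'=w-C_{112}$, $C_{162}''=\{g\in\Lambda_{24}: |g|=2,\ |g-(u-v)|=2,\ |g+v|=\sqrt6,\ |g-(w-v)|=2\}$, $C_{162}'''=(u-v)-C_{162}''$, and $C=C_{112}\cup\big(\tfrac{w-u-v}{2}+C_{112}'\big)$, $D=C_{162}\cup\big(\tfrac{u-v}{3}+C_{162}'\big)\cup\big(-\tfrac{u-v}{3}+\tfrac{w}{3}+C_{162}''\big)\cup\big(-\tfrac{u-v}{3}+\tfrac{2w}{3}+C_{162}'''\big)$ (here $a-X=\{a-x:x\in X\}$ and $a+X=\{a+x:x\in X\}$). With $W=\mathrm{span}\{u,v,w\}$ let $\widehat C=N_W(C)$ ($224$ points) and $\widehat D=N_W(D)$ ($648$ points), codes on $\mathbb S^{20}$. Then: (a) for every potential $h$ with $h^{(4)}(t)>0$ on $(-1,1)$, $m^h(\widehat C)=112h(-1/\sqrt{21})+112h(1/\sqrt{21})$ and $m^h(\widehat D)=324h(-1/\sqrt{21})+324h(1/\sqrt{21})$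 (the lower bounds are attained), and $m^h(\widehat C)/224=m^h(\widehat D)/648=m^h(N_W(C_{112}))/112=m^h(N_W(C_{162}))/162$; (b) for every strictly absolutely monotone $h$, the set of minimizers on $\mathbb S^{20}$ of $U_h(\cdot,\widehat C)$ is exactly $\widehat D$ and the set of minimizers of $U_h(\cdot,\widehat D)$ is exactly $\widehat C$ (a universal polar dual pair). (Thus $(\widehat C,\widehat D)$ is a maximal PULB-optimal pair.)
   Context: Let $\mathcal G\subset\mathbb F_2^{24}$ be the extended binary Golay code. The Leech lattice (scaled so its minimal vectors have squared length $4$) is $\Lambda_{24}=\{x/\sqrt8\}$, where $x=(x_1,\dots,x_{24})\in\mathbb Z^{24}$ satisfies, for some $m\in\{0,1\}$: $x_i\equiv m\pmod 2$ for all $i$, the vector $((x_i-m)/2 \bmod 2)_i$ lies in $\mathcal G$, and $\sum_ix_i\equiv4m\pmod 8$. $\Lambda(k)=\{x\in\Lambda_{24}:|x|^2=2k\}$; $a^\ell$ inside a vector denotes the entry $a$ repeated $\ell$ times. $N_W(x)=(x-P_Wx)/|x-P_Wx|$ for $x\notin W$, $P_W$ the orthogonal projection onto $W$, a point of the unit sphere of $W^\perp$ identified with $\mathbb S^{20}$ by a linear isometry; $N_W(X)=\{N_W(x):x\in X\}$. A potential is $h:[-1,1]\to(-\infty,+\infty]$ continuous in the extended sense and finite on $[-1,1)$; $U_h(x,Z)=\sum_{y\in Z}h(x\cdot y)$, $m^h(Z)=\min_{x\in\mathbb S^{20}}U_h(x,Z)$. $h$ is strictly absolutely monotone if $h^{(j)}>0$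 on $(-1,1)$ for all $j\ge0$. *)

theory Defs
  imports "HOL-Analysis.Analysis" "HOL-Library.Z2" "HOL-Number_Theory.Cong"
begin

section \<open>The extended binary Golay code and the Leech lattice\<close>

definition hamming_weight :: "bit ^ 24 \<Rightarrow> nat" where
  "hamming_weight c = card {i. c $ i \<noteq> 0}"

text \<open>
  The extended binary Golay code is the linear [24, 12, 8] code over the field with two elements.
  These parameters determine it up to a permutation of the coordinates, so the predicate
  covers every labelling of the coordinates.
\<close>

definition extended_golay_code :: "(bit ^ 24) set \<Rightarrow> bool" where
  "extended_golay_code G \<longleftrightarrow>
     vec.subspace G \<and> vec.dim G = 12 \<and>
     (\<forall>c\<in>G. c \<noteq> 0 \<longrightarrow> 8 \<le> hamming_weight c) \<and> (\<exists>c\<in>G. hamming_weight c = 8)"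

definition leech :: "(bit ^ 24) set \<Rightarrow> (real ^ 24) set" where
  "leech G = {(1 / sqrt 8) *\<^sub>R (\<chi> i. real_of_int (x $ i)) | x :: int ^ 24.
     \<exists>m\<in>{0, 1}. (\<forall>i. [x $ i = m] (mod 2)) \<and>
       (\<chi> i. of_int ((x $ i - m) div 2)) \<in> G \<and>
       [(\<Sum>i\<in>UNIV. x $ i) = 4 * m] (mod 8)}"

definition leech_shell :: "(bit ^ 24) set \<Rightarrow> nat \<Rightarrow> (real ^ 24) set" where
  "leech_shell G k = {x \<in> leech G. (norm x)\<^sup>2 = 2 * real k}"

text \<open>
  The index type \<^typ>\<open>24\<close> consists of the residues modulo 24; its elements 1, 2, 3 are the first
  three coordinates, and the last coordinate 24 is the element 0.
\<close>

definition vec_w :: "real ^ 24" where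
  "vec_w = (1 / sqrt 8) *\<^sub>R (\<chi> i. if i = 1 then 5 else 1)"

definition vec_v :: "real ^ 24" where
  "vec_v = (1 / sqrt 8) *\<^sub>R (\<chi> i. if i = 1 \<or> i = 2 then 4 else 0)"

definition vec_u :: "real ^ 24" where
  "vec_u = (1 / sqrt 8) *\<^sub>R (\<chi> i. if i = 3 then -3 else 1)"

definition W_uvw :: "(real ^ 24) set" where
  "W_uvw = span {vec_u, vec_v, vec_w}"

definition C275 :: "(bit ^ 24) set \<Rightarrow> (real ^ 24) set" where
  "C275 G = {x \<in> leech_shell G 2. x \<bullet> vec_w = 3 \<and> x \<bullet> vec_v = 1}"

definition C162 :: "(bit ^ 24) set \<Rightarrow> (real ^ 24) set" where
  "C162 G = {x \<in> C275 G. x \<bullet> vec_u = 2}"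

definition C112 :: "(bit ^ 24) set \<Rightarrow> (real ^ 24) set" where
  "C112 G = {x \<in> C275 G. x \<bullet> vec_u = 1}"

definition C162' :: "(bit ^ 24) set \<Rightarrow> (real ^ 24) set" where
  "C162' G = (\<lambda>x. vec_w - x) ` C162 G"

definition C112' :: "(bit ^ 24) set \<Rightarrow> (real ^ 24) set" where
  "C112' G = (\<lambda>x. vec_w - x) ` C112 G"

definition C162'' :: "(bit ^ 24) set \<Rightarrow> (real ^ 24) set" where
  "C162'' G = {g \<in> leech G. norm g = 2 \<and> norm (g - (vec_u - vec_v)) = 2 \<and>
     norm (g + vec_v) = sqrt 6 \<and> norm (g - (vec_w - vec_v)) = 2}"

definition C162''' :: "(bit ^ 24) set \<Rightarrow> (real ^ 24) set" where
  "C162''' G = (\<lambda>x. (vec_u - vec_v) - x) ` C162'' G"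

definition code_C :: "(bit ^ 24) set \<Rightarrow> (real ^ 24) set" where
  "code_C G = C112 G \<union> (\<lambda>x. (1 / 2) *\<^sub>R (vec_w - vec_u - vec_v) + x) ` C112' G"

definition code_D :: "(bit ^ 24) set \<Rightarrow> (real ^ 24) set" where
  "code_D G = C162 G
     \<union> (\<lambda>x. (1 / 3) *\<^sub>R (vec_u - vec_v) + x) ` C162' G
     \<union> (\<lambda>x. - ((1 / 3) *\<^sub>R (vec_u - vec_v)) + (1 / 3) *\<^sub>R vec_w + x) ` C162'' G
     \<union> (\<lambda>x. - ((1 / 3) *\<^sub>R (vec_u - vec_v)) + (2 / 3) *\<^sub>R vec_w + x) ` C162''' G"

section \<open>Normalized projections\<close>

definition orth_proj :: "'a::euclidean_space set \<Rightarrow> 'a \<Rightarrow> 'a" where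
  "orth_proj W x = (THE p. p \<in> W \<and> x - p \<in> orthogonal_comp W)"

definition N_proj :: "'a::euclidean_space set \<Rightarrow> 'a \<Rightarrow> 'a" where
  "N_proj W x = (x - orth_proj W x) /\<^sub>R norm (x - orth_proj W x)"

text \<open>
  The unit sphere of the orthogonal complement of \<open>W\<close>. For \<^const>\<open>W_uvw\<close> this complement has
  dimension 21, so the sphere is a copy of the 20-dimensional sphere.
\<close>

definition perp_sphere :: "'a::euclidean_space set \<Rightarrow> 'a set" where
  "perp_sphere W = {x \<in> orthogonal_comp W. norm x = 1}"

definition C_hat :: "(bit ^ 24) set \<Rightarrow> (real ^ 24) set" where
  "C_hat G = N_proj W_uvw ` code_C G"

definition D_hat :: "(bit ^ 24) set \<Rightarrow> (real ^ 24) set" where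
  "D_hat G = N_proj W_uvw ` code_D G"

section \<open>Potentials and polarization\<close>

text \<open>Only the values of a potential on the interval from -1 to 1 are relevant.\<close>

definition potential :: "(real \<Rightarrow> ereal) \<Rightarrow> bool" where
  "potential h \<longleftrightarrow>
     continuous_on {-1..1} h \<and> (\<forall>t\<in>{-1..1}. h t \<noteq> -\<infinity>) \<and> (\<forall>t\<in>{-1..<1}. h t \<noteq> \<infinity>)"

text \<open>
  The \<open>n\<close>-th derivative exists and is positive on the open interval. The existence of all
  derivatives up to order \<open>n\<close> has to be required, since \<^const>\<open>deriv\<close> is a total function.
\<close>

definition pos_nth_deriv :: "nat \<Rightarrow> (real \<Rightarrow> ereal) \<Rightarrow> bool" where
  "pos_nth_deriv n h \<longleftrightarrow>
     (\<forall>j<n. \<forall>t\<in>{-1<..<1}.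
        (deriv ^^ j) (\<lambda>s. real_of_ereal (h s)) field_differentiable at t) \<and>
     (\<forall>t\<in>{-1<..<1}. (deriv ^^ n) (\<lambda>s. real_of_ereal (h s)) t > 0)"

definition strictly_absolutely_monotone :: "(real \<Rightarrow> ereal) \<Rightarrow> bool" where
  "strictly_absolutely_monotone h \<longleftrightarrow> potential h \<and> (\<forall>j. pos_nth_deriv j h)"

definition U_pot :: "(real \<Rightarrow> ereal) \<Rightarrow> 'a::euclidean_space \<Rightarrow> 'a set \<Rightarrow> ereal" where
  "U_pot h x Z = (\<Sum>y\<in>Z. h (x \<bullet> y))"

definition minimizers :: "(real \<Rightarrow> ereal) \<Rightarrow> 'a::euclidean_space set \<Rightarrow> 'a set \<Rightarrow> 'a set" where
  "minimizers h W Z = {x \<in> perp_sphere W. \<forall>y\<in>perp_sphere W. U_pot h x Z \<le> U_pot h y Z}"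

text \<open>
  The infimum is a minimum exactly if the set of minimizers is nonempty.
\<close>

definition polarization :: "(real \<Rightarrow> ereal) \<Rightarrow> 'a::euclidean_space set \<Rightarrow> 'a set \<Rightarrow> ereal" where
  "polarization h W Z = (INF x\<in>perp_sphere W. U_pot h x Z)"

end

theory Submission
  imports Defs
begin

text \<open>
  Modulo the span of \<open>u\<close>, \<open>v\<close>, \<open>w\<close> the second half of \<open>C\<close> is the negative of the first, and \<open>D\<close>
  consists of the projections of \<open>C162\<close> and \<open>C162''\<close> together with their negatives. Counting octads
  through given points shows that \<open>C112\<close> and \<open>C162\<close> project to spherical 3-designs and that the
  second moment of \<open>C162''\<close> is that of a design. Hence the cubic that interpolates a potential doubly
  at \<open>\<plusminus>1/sqrt 21\<close> has a constant sum over each code; it lies below the potential, with equality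
  only at the two nodes. The minimizers are therefore exactly the points of the sphere whose inner
  products with the code are all \<open>\<plusminus>1/sqrt 21\<close>. The minimum norm 4 of the Leech lattice forces these
  two values between \<open>C\<close> and \<open>D\<close>. Conversely, a vector with these two inner products is, up to sign
  and a shift by a vector of the span, congruent to an integer vector that is orthogonal modulo 8 to
  a generating set, so it lies in the lattice by self-duality of the Golay code.
\<close>

section \<open>The Golay code as a family of sets\<close>

text \<open>The two nodes have two origins. In dimension 21 a 2-design of N unit vectors has second
  moment N/21, and \<plusminus>1/sqrt 21 with equal weights is the two-point distribution with this
  second moment and vanishing odd moments. In the lattice, the components orthogonal to
  \<open>W_uvw\<close> have norms 3/2 and sqrt(7/3); inner products across the two codes are an
  integer minus 3/2 or 1/2, and the minimum norm leaves only \<plusminus>1/2, which is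
  \<plusminus>1/sqrt 21 after normalization. The Golay code is known only by its parameters. The
  Steiner system, the weights and self-duality are therefore all drawn from one tight count of
  cosets. The number of octads through six points is not constant; these unknown counts enter the
  third moments with opposite signs and cancel. In the converse direction the vector is real,
  without any integrality. A combination of four octads isolates the difference of two coordinates
  and shows that it is an even integer; the norm then restricts the remaining residue modulo
  3.\<close>

definition sdiff :: "'a set \<Rightarrow> 'a set \<Rightarrow> 'a set" (infixl "\<triangle>" 65) where
  "A \<triangle> B = (A - B) \<union> (B - A)"

lemma mem_sdiff [simp]: "x \<in> A \<triangle> B \<longleftrightarrow> (x \<in> A) \<noteq> (x \<in> B)"
  by (auto simp: sdiff_def)

lemma sdiff_assoc: "(A \<triangle> B) \<triangle> C = A \<triangle> (B \<triangle> C)" by auto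

lemma sdiff_self [simp]: "A \<triangle> A = {}" and sdiff_empty [simp]: "A \<triangle> {} = A" "{} \<triangle> A = A"
  and sdiff_cancel [simp]: "A \<triangle> (A \<triangle> B) = B"
  by auto

lemma sdiff_eq_empty_iff [simp]: "A \<triangle> B = {} \<longleftrightarrow> A = B" by auto

lemma card_sdiff:
  fixes A B :: "'a::finite set"
  shows "card (A \<triangle> B) + 2 * card (A \<inter> B) = card A + card B"
proof -
  have "card (A \<triangle> B) = card (A - B) + card (B - A)"
    unfolding sdiff_def by (rule card_Un_disjoint) auto
  moreover have "card A = card (A - B) + card (A \<inter> B)"
    by (subst card_Un_disjoint [symmetric]) (auto intro: arg_cong [where f = card])
  moreover have "card B = card (B - A) + card (A \<inter> B)"
    by (subst card_Un_disjoint [symmetric]) (auto intro: arg_cong [where f = card])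
  ultimately show ?thesis by simp
qed

lemma card_sdiff_le:
  fixes A B :: "'a::finite set"
  shows "card (A \<triangle> B) \<le> card A + card B"
  using card_sdiff [of A B] by linarith

lemma sdiff_Int_distrib: "(A \<triangle> B) \<inter> C = (A \<inter> C) \<triangle> (B \<inter> C)" by auto

lemma even_card_sdiff_iff:
  fixes A B :: "'a::finite set"
  shows "even (card (A \<triangle> B)) \<longleftrightarrow> (even (card A) \<longleftrightarrow> even (card B))"
  using card_sdiff [of A B] by presburger

lemma even_card_sdiff_Int_iff:
  fixes A B C :: "'a::finite set"
  shows "even (card ((A \<triangle> B) \<inter> C)) \<longleftrightarrow> (even (card (A \<inter> C)) \<longleftrightarrow> even (card (B \<inter> C)))"
  by (simp add: sdiff_Int_distrib even_card_sdiff_iff)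

text \<open>A choice of one point of A in each member is injective. This shows later that four
  points cannot block five disjoint tetrads.\<close>

lemma card_disjoint_family_le:
  fixes P :: "'a::finite set set"
  assumes "disjoint P" "\<And>T. T \<in> P \<Longrightarrow> T \<inter> A \<noteq> {}"
  shows "card P \<le> card A"
proof -
  have "\<forall>T\<in>P. \<exists>x. x \<in> T \<inter> A" using assms(2) by blast
  then obtain f where f: "\<And>T. T \<in> P \<Longrightarrow> f T \<in> T \<inter> A"
    using bchoice [of P "\<lambda>T x. x \<in> T \<inter> A"] by auto
  have "inj_on f P"
  proof (rule inj_onI, rule ccontr)
    fix S T assume "S \<in> P" "T \<in> P" "f S = f T" "S \<noteq> T"
    then show False using f [of S] f [of T] disjointD [OF assms(1), of S T] by auto
  qed
  then show ?thesis
    using f by (intro card_inj_on_le [where f = f]) auto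
qed

text \<open>Codewords are represented by their supports, with \<open>\<triangle>\<close> as
  addition. The assumptions are linearity, size 2^12 and minimum weight 8; all else is
  derived.\<close>

locale golay =
  fixes \<G> :: "'n::finite set set"
  assumes sdiff_closed: "A \<in> \<G> \<Longrightarrow> B \<in> \<G> \<Longrightarrow> A \<triangle> B \<in> \<G>"
    and card_G: "card \<G> = 4096"
    and min_weight: "A \<in> \<G> \<Longrightarrow> A \<noteq> {} \<Longrightarrow> 8 \<le> card A"
    and card_points: "CARD('n) = 24"
begin

section \<open>Cosets, tetrads and sextets\<close>

definition octads :: "'n set set" where
  "octads = {A \<in> \<G>. card A = 8}"

text \<open>The members of weight 4 in the coset of X. If X has four points, they form the sextet of
  X.\<close>

definition tetrads :: "'n set \<Rightarrow> 'n set set" where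
  "tetrads X = {T. card T = 4 \<and> T \<triangle> X \<in> \<G>}"

lemma empty_in_G: "{} \<in> \<G>"
proof -
  obtain A where "A \<in> \<G>" using card_G by (metis card.empty ex_in_conv zero_neq_numeral)
  then show ?thesis using sdiff_closed [of A A] by simp
qed

text \<open>Unique decoding: distinct members of a coset differ by a nonzero codeword, which has
  weight at least 8.\<close>

lemma eq_if_close: "A \<triangle> B \<in> \<G> \<Longrightarrow> card A + card B < 8 \<Longrightarrow> A = B"
  using min_weight [of "A \<triangle> B"] card_sdiff_le [of A B] by fastforce

text \<open>The difference of two tetrads of one coset is a codeword of weight 8 - 2 |S \<inter> T|,
  so a common point would contradict the minimum weight.\<close>

lemma tetrads_disjoint: "disjoint (tetrads X)"
proof (rule disjointI)
  fix S T assume ST: "S \<in> tetrads X" "T \<in> tetrads X" "S \<noteq> T"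
  then have "S \<triangle> X \<triangle> (T \<triangle> X) \<in> \<G>"
    by (auto simp: tetrads_def intro: sdiff_closed)
  also have "S \<triangle> X \<triangle> (T \<triangle> X) = S \<triangle> T" by auto
  finally have "8 \<le> card (S \<triangle> T)" using ST(3) min_weight by simp
  moreover have "card S = 4" "card T = 4" using ST by (auto simp: tetrads_def)
  ultimately have "card (S \<inter> T) = 0" using card_sdiff [of S T] by linarith
  then show "S \<inter> T = {}" by simp
qed

lemma card_Union_tetrads: "card (\<Union>(tetrads X)) = 4 * card (tetrads X)"
proof -
  have "card (\<Union>(tetrads X)) = (\<Sum>T\<in>tetrads X. card T)"
    by (rule card_Union_disjoint [OF tetrads_disjoint]) simp
  also have "\<dots> = (\<Sum>T\<in>tetrads X. 4)"
    by (rule sum.cong) (auto simp: tetrads_def)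
  finally show ?thesis by simp
qed

lemma card_tetrads_le: "card (tetrads X) \<le> 6"
proof -
  have "card (\<Union>(tetrads X)) \<le> 24"
    using card_mono [of UNIV "\<Union>(tetrads X)"] card_points by simp
  then show ?thesis using card_Union_tetrads [of X] by simp
qed

lemma card_coset: "card {X. T \<triangle> X \<in> \<G>} = 4096"
proof -
  have "{X. T \<triangle> X \<in> \<G>} = (\<lambda>g. T \<triangle> g) ` \<G>"
    by (auto intro!: image_eqI [of _ _ "T \<triangle> _"])
  moreover have "inj_on (\<lambda>g. T \<triangle> g) \<G>"
    by (rule inj_on_inverseI [of _ "\<lambda>g. T \<triangle> g"]) simp
  ultimately show ?thesis by (simp add: card_image card_G)
qed

lemma card_small_sets: "card {S :: 'n set. card S \<le> 3} = 2325"
proof -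
  have "{S :: 'n set. card S \<le> 3} = (\<Union>k\<in>{..3}. {S. S \<subseteq> UNIV \<and> card S = k})" by auto
  moreover have "card \<dots> = (\<Sum>k\<in>{..3}. card {S. S \<subseteq> (UNIV :: 'n set) \<and> card S = k})"
    by (rule card_UN_disjoint) auto
  moreover have "\<dots> = (\<Sum>k\<in>{..3}. 24 choose k)"
    using n_subsets [of "UNIV :: 'n set"] by (intro sum.cong) (auto simp: card_points)
  \<comment> \<open>1 + 24 + 276 + 2024.\<close>
  moreover have "\<dots> = 2325"
    by (simp add: numeral_eq_Suc atMost_Suc)
  ultimately show ?thesis by presburger
qed

lemma card_four_sets: "card {T :: 'n set. card T = 4} = 10626"
proof -
  have "card {T. T \<subseteq> (UNIV :: 'n set) \<and> card T = 4} = 24 choose 4"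
    using n_subsets [of "UNIV :: 'n set"] card_points by simp
  also have "\<dots> = 10626" by (simp add: numeral_eq_Suc)
  finally show ?thesis by simp
qed

text \<open>The 4096 cosets split into 2325 with a leader of weight at most 3 and 1771 others. The
  10626 four-sets all lie in the latter, at most six in each, and 6 * 1771 = 10626.\<close>

lemma coset_leader_cases:
  "(\<exists>S. card S \<le> 3 \<and> S \<triangle> X \<in> \<G>) \<or> card (tetrads X) = 6"
proof -
  define N where "N = {X. \<not> (\<exists>S. card S \<le> 3 \<and> S \<triangle> X \<in> \<G>)}"
  let ?C = "\<Union>S\<in>{S. card S \<le> 3}. {X. S \<triangle> X \<in> \<G>}"
  have "card ?C = (\<Sum>S\<in>{S :: 'n set. card S \<le> 3}. card {X. S \<triangle> X \<in> \<G>})"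
  proof (rule card_UN_disjoint)
    show "\<forall>S\<in>{S. card S \<le> 3}. \<forall>T\<in>{S. card S \<le> 3}. S \<noteq> T \<longrightarrow>
        {X. S \<triangle> X \<in> \<G>} \<inter> {X. T \<triangle> X \<in> \<G>} = {}"
    proof (intro ballI impI, rule ccontr)
      fix S T :: "'n set"
      assume ST: "S \<in> {S. card S \<le> 3}" "T \<in> {S. card S \<le> 3}" "S \<noteq> T"
        and "{X. S \<triangle> X \<in> \<G>} \<inter> {X. T \<triangle> X \<in> \<G>} \<noteq> {}"
      then obtain X where "S \<triangle> X \<in> \<G>" "T \<triangle> X \<in> \<G>" by auto
      then have "S \<triangle> X \<triangle> (T \<triangle> X) \<in> \<G>" by (rule sdiff_closed)
      also have "S \<triangle> X \<triangle> (T \<triangle> X) = S \<triangle> T" by auto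
      finally show False using ST eq_if_close [of S T] by simp
    qed
  qed auto
  also have "\<dots> = 2325 * 4096" by (simp add: card_coset card_small_sets)
  finally have "card ?C = 2325 * 4096" .
  moreover have "N = UNIV - ?C" by (auto simp: N_def)
  moreover have "card (UNIV :: 'n set set) = 2 ^ 24"
    using card_Pow [of "UNIV :: 'n set"] card_points by (simp flip: Pow_UNIV)
  \<comment> \<open>1771 = 4096 - 2325. \<open>N\<close> collects sets instead of cosets, hence the
    factor 4096 on both sides of the double count below.\<close>
  ultimately have card_N: "card N = 1771 * 4096" by (simp add: card_Diff_subset)
  have sub: "X \<in> N" if T: "card T = 4" "T \<triangle> X \<in> \<G>" for T X
  proof (rule ccontr)
    assume "X \<notin> N"
    then obtain S where S: "card S \<le> 3" "S \<triangle> X \<in> \<G>" by (auto simp: N_def)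
    have "S \<triangle> X \<triangle> (T \<triangle> X) \<in> \<G>" using S(2) T(2) by (rule sdiff_closed)
    also have "S \<triangle> X \<triangle> (T \<triangle> X) = S \<triangle> T" by auto
    finally have "S = T" using S T eq_if_close [of S T] by simp
    then show False using S T by simp
  qed
  \<comment> \<open>Double count of the pairs of a set X in \<open>N\<close> and a tetrad T in its
    coset; by \<open>sub\<close>, all 4096 sets in the coset of a four-set T lie in
    \<open>N\<close>.\<close>
  have "(\<Sum>X\<in>N. card (tetrads X)) = (\<Sum>X\<in>N. \<Sum>T\<in>{T. card T = 4}. if T \<triangle> X \<in> \<G> then 1 else 0)"
    by (intro sum.cong refl) (simp add: tetrads_def Int_def flip: sum.inter_filter)
  also have "\<dots> = (\<Sum>T\<in>{T. card T = 4}. \<Sum>X\<in>N. if T \<triangle> X \<in> \<G> then 1 else 0)"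
    by (rule sum.swap)
  also have "\<dots> = (\<Sum>T\<in>{T::'n set. card T = 4}. 4096)"
  proof (rule sum.cong [OF refl])
    fix T :: "'n set" assume T: "T \<in> {T. card T = 4}"
    have "(\<Sum>X\<in>N. if T \<triangle> X \<in> \<G> then 1 else 0) = card {X \<in> N. T \<triangle> X \<in> \<G>}"
      by (simp flip: sum.inter_filter)
    also have "{X \<in> N. T \<triangle> X \<in> \<G>} = {X. T \<triangle> X \<in> \<G>}" using sub T by auto
    finally show "(\<Sum>X\<in>N. if T \<triangle> X \<in> \<G> then 1 else 0) = (4096::nat)" by (simp add: card_coset)
  qed
  also have "\<dots> = (\<Sum>X\<in>N. 6)" by (simp add: card_four_sets card_N)
  finally have eq: "(\<Sum>X\<in>N. card (tetrads X)) = (\<Sum>X\<in>N. 6)" .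
  \<comment> \<open>The sum attains its termwise upper bound, so every term is 6.\<close>
  have "card (tetrads X) = 6" if "X \<in> N"
    by (rule sum_mono_inv [OF eq]) (use that card_tetrads_le in auto)
  then show ?thesis by (auto simp: N_def)
qed

lemma Union_tetrads: "card (tetrads X) = 6 \<Longrightarrow> \<Union>(tetrads X) = UNIV"
  using card_Union_tetrads [of X] card_points by (intro card_subset_eq) auto

text \<open>A leader of weight at most 3 would differ from T by a nonzero codeword of weight at most
  7, so the coset of T is of the second kind.\<close>

lemma sextet:
  assumes "card T = 4"
  shows "card (tetrads T) = 6" "T \<in> tetrads T"
proof -
  show "T \<in> tetrads T" using assms empty_in_G by (simp add: tetrads_def)
  have "\<not> (\<exists>S. card S \<le> 3 \<and> S \<triangle> T \<in> \<G>)"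
  proof
    assume "\<exists>S. card S \<le> 3 \<and> S \<triangle> T \<in> \<G>"
    then obtain S where "card S \<le> 3" "S \<triangle> T \<in> \<G>" by blast
    with assms eq_if_close [of S T] show False by auto
  qed
  then show "card (tetrads T) = 6" using coset_leader_cases by blast
qed

lemma octad_of_tetrads:
  assumes "card T = 4" "T' \<in> tetrads T" "T' \<noteq> T"
  shows "T \<union> T' \<in> octads" "T \<inter> T' = {}"
proof -
  show dis: "T \<inter> T' = {}"
    using disjointD [OF tetrads_disjoint sextet(2) [OF assms(1)] assms(2)] assms by auto
  then have "T \<union> T' = T' \<triangle> T" by auto
  moreover have "card (T \<union> T') = 8"
    using assms dis by (simp add: card_Un_disjoint tetrads_def)
  ultimately show "T \<union> T' \<in> octads" using assms by (auto simp: octads_def tetrads_def)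
qed

section \<open>Octads as the blocks of a Steiner system S(5,8,24)\<close>

lemma octad_card: "O' \<in> octads \<Longrightarrow> card O' = 8" and octad_in_G: "O' \<in> octads \<Longrightarrow> O' \<in> \<G>"
  by (auto simp: octads_def)

lemma octads_eqI:
  assumes "P \<in> octads" "Q \<in> octads" "5 \<le> card (P \<inter> Q)"
  shows "P = Q"
proof (rule ccontr)
  assume "P \<noteq> Q"
  then have "8 \<le> card (P \<triangle> Q)"
    using assms by (intro min_weight sdiff_closed) (auto simp: octads_def)
  then show False using card_sdiff [of P Q] assms by (simp add: octads_def)
qed

text \<open>The sextet of four of the points covers all coordinates, so one of its other tetrads
  contains the fifth point.\<close>

lemma octad_through_five:
  assumes "card F = 5"
  shows "\<exists>Q\<in>octads. F \<subseteq> Q"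
proof -
  have "card F = Suc 4" using assms by simp
  then obtain x T where F: "F = insert x T" "x \<notin> T" "card T = 4"
    unfolding card_Suc_eq by blast
  have "x \<in> \<Union>(tetrads T)" using Union_tetrads [OF sextet(1) [OF F(3)]] by simp
  then obtain T' where T': "x \<in> T'" "T' \<in> tetrads T" by blast
  then have "T' \<noteq> T" using F by blast
  then have "T \<union> T' \<in> octads" using octad_of_tetrads F T' by blast
  then show ?thesis using F T' by blast
qed

text \<open>Extend S to a four-set T outside A. The five other tetrads of T give five octads that
  are disjoint outside T, and the at most four points of A cannot meet all of them.\<close>

lemma octad_separating:
  assumes "card S \<le> 4" "card A \<le> 4" "S \<inter> A = {}"
  shows "\<exists>Q\<in>octads. S \<subseteq> Q \<and> Q \<inter> A = {}"
proof -
  have "4 - card S \<le> card (- (S \<union> A))"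
    using assms card_points by (simp add: Compl_eq_Diff_UNIV card_Diff_subset card_Un_disjoint)
  then obtain B where B: "B \<subseteq> - (S \<union> A)" "card B = 4 - card S"
    by (meson obtain_subset_with_card_n)
  define T where "T = S \<union> B"
  have "S \<inter> B = {}" using B by auto
  then have T: "card T = 4" "S \<subseteq> T" "T \<inter> A = {}"
    using assms B by (auto simp: T_def card_Un_disjoint)
  have "\<exists>T'\<in>tetrads T - {T}. T' \<inter> A = {}"
  proof (rule ccontr)
    assume "\<not> ?thesis"
    then have "card (tetrads T - {T}) \<le> card A"
      by (intro card_disjoint_family_le) (auto intro: pairwise_subset [OF tetrads_disjoint])
    moreover have "card (tetrads T - {T}) = 5" using sextet T(1) by simp
    ultimately show False using assms by simp
  qed
  then obtain T' where "T' \<in> tetrads T" "T' \<noteq> T" "T' \<inter> A = {}" by auto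
  then have "T \<union> T' \<in> octads" "S \<subseteq> T \<union> T'" "(T \<union> T') \<inter> A = {}"
    using octad_of_tetrads(1) [OF T(1)] T by auto
  then show ?thesis by blast
qed

section \<open>Weights and self-orthogonality\<close>

lemma four_set_exists: "\<exists>T :: 'n set. card T = 4"
  using obtain_subset_with_card_n [of 4 "UNIV :: 'n set"] card_points by auto

text \<open>The full set is the union of the six tetrads of a sextet, and two tetrads of one coset
  add up to a codeword.\<close>

lemma UNIV_in_G: "UNIV \<in> \<G>"
proof -
  obtain T :: "'n set" where T: "card T = 4" using four_set_exists by blast
  have even_union: "A \<in> \<G>" if "Q \<subseteq> tetrads T" "A = \<Union>Q" "card Q = 2 * k" for k Q A
    using that
  proof (induction k arbitrary: Q A)
    case 0
    then show ?case using empty_in_G by (simp add: finite_subset)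
  next
    case (Suc k)
    then obtain S Q1 where Q1: "Q = insert S Q1" "S \<notin> Q1" "card Q1 = Suc (2 * k)"
      by (metis card_Suc_eq mult_Suc_right add_2_eq_Suc)
    then obtain S' Q2 where Q2: "Q1 = insert S' Q2" "S' \<notin> Q2" "card Q2 = 2 * k"
      by (metis card_Suc_eq)
    have mem: "S \<in> tetrads T" "S' \<in> tetrads T" "Q2 \<subseteq> tetrads T" "S \<noteq> S'"
      using Suc.prems Q1 Q2 by auto
    have dis: "B \<inter> B' = {}" if "B \<in> tetrads T" "B' \<in> tetrads T" "B \<noteq> B'" for B B'
      using disjointD [OF tetrads_disjoint] that by blast
    have "S \<inter> B = {}" "S' \<inter> B = {}" if "B \<in> Q2" for B
      using dis [of S B] dis [of S' B] mem that Q1 Q2 by auto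
    then have dis: "S \<inter> S' = {}" "S \<inter> \<Union>Q2 = {}" "S' \<inter> \<Union>Q2 = {}"
      using dis [of S S'] mem by auto
    have "S \<triangle> T \<in> \<G>" "S' \<triangle> T \<in> \<G>" using mem by (auto simp: tetrads_def)
    then have "(S \<triangle> T) \<triangle> (S' \<triangle> T) \<in> \<G>" by (rule sdiff_closed)
    moreover have "\<Union>Q2 \<in> \<G>" using Suc.IH [of Q2] mem Q2 by blast
    ultimately have "((S \<triangle> T) \<triangle> (S' \<triangle> T)) \<triangle> \<Union>Q2 \<in> \<G>" by (rule sdiff_closed)
    also have "((S \<triangle> T) \<triangle> (S' \<triangle> T)) \<triangle> \<Union>Q2 = S \<union> (S' \<union> \<Union>Q2)"
      using dis unfolding set_eq_iff Int_iff empty_iff mem_sdiff Un_iff by metis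
    also have "\<dots> = A"
      using Suc.prems(2) by (simp only: Q1(1) Q2(1) Union_insert)
    finally show ?case .
  qed
  show ?thesis
  proof (rule even_union)
    show "UNIV = \<Union>(tetrads T)" by (rule Union_tetrads [OF sextet(1) [OF T], symmetric])
    show "card (tetrads T) = 2 * 3" using sextet(1) [OF T] by linarith
  qed (rule subset_refl)
qed

text \<open>Four points of A determine a sextet. The other six points lie in five tetrads, so one
  tetrad holds two of them; the resulting octad meets A in at least 6 points and differs from it in
  at most 6, below the minimum weight.\<close>

lemma no_weight_10:
  assumes "A \<in> \<G>" shows "card A \<noteq> 10"
proof
  assume A: "card A = 10"
  obtain T where T: "T \<subseteq> A" "card T = 4"
    using obtain_subset_with_card_n [of 4 A] A by auto
  have "\<exists>T'\<in>tetrads T - {T}. 2 \<le> card (T' \<inter> A)"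
  proof (rule ccontr)
    assume "\<not> ?thesis"
    then have "card (T' \<inter> A) \<le> 1" if "T' \<in> tetrads T - {T}" for T'
      using that by (metis not_less_eq_eq numeral_2_eq_2 One_nat_def)
    then have "(\<Sum>T'\<in>tetrads T - {T}. card (T' \<inter> A)) \<le> (\<Sum>T'\<in>tetrads T - {T}. 1)"
      by (rule sum_mono)
    also have "\<dots> = 5" using sextet T(2) by simp
    finally have "(\<Sum>T'\<in>tetrads T. card (T' \<inter> A)) \<le> 9"
      using sextet [OF T(2)] T by (simp add: sum.remove [of _ T] Int_absorb2)
    moreover have "(\<Sum>T'\<in>tetrads T. card (T' \<inter> A)) = card (\<Union>T'\<in>tetrads T. T' \<inter> A)"
      using tetrads_disjoint [of T] unfolding disjoint_def
      by (intro card_UN_disjoint [symmetric]) auto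
    moreover have "(\<Union>T'\<in>tetrads T. T' \<inter> A) = A"
      using Union_tetrads sextet(1) [OF T(2)] by auto
    ultimately show False using A by simp
  qed
  then obtain T' where T': "T' \<in> tetrads T" "T' \<noteq> T" "2 \<le> card (T' \<inter> A)" by auto
  have Q: "T \<union> T' \<in> octads" "T \<inter> T' = {}" using octad_of_tetrads T T' by auto
  have "A \<inter> (T \<union> T') = T \<union> (T' \<inter> A)" using T by auto
  then have "6 \<le> card (A \<inter> (T \<union> T'))"
    using T T' Q(2) by (simp add: card_Un_disjoint Int_assoc [symmetric])
  then have "card (A \<triangle> (T \<union> T')) < 8"
    using card_sdiff [of A "T \<union> T'"] A Q(1) by (simp add: octads_def)
  then have "A = T \<union> T'"
    using min_weight [of "A \<triangle> (T \<union> T')"] sdiff_closed assms Q(1) by (fastforce simp: octads_def)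
  then show False using A Q(1) by (simp add: octads_def)
qed

text \<open>An intersection of 3 points would give a sum of weight 10. An intersection of 1 point
  would give weight 14, whose complement has weight 10.\<close>

lemma even_octad_Int:
  assumes "P \<in> octads" "Q \<in> octads"
  shows "even (card (P \<inter> Q))"
proof (cases "P = Q")
  case True then show ?thesis using assms by (simp add: octads_def)
next
  case False
  have PQ: "P \<triangle> Q \<in> \<G>" "card P = 8" "card Q = 8"
    using assms sdiff_closed by (auto simp: octads_def)
  have "card (P \<inter> Q) < 5" using False octads_eqI assms by force
  moreover have "card (P \<triangle> Q) \<noteq> 10" using no_weight_10 PQ by blast
  moreover have "card (P \<triangle> Q) \<noteq> 14"
  proof
    assume "card (P \<triangle> Q) = 14"
    then have "card (UNIV \<triangle> (P \<triangle> Q)) = 10"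
      using card_sdiff [of UNIV "P \<triangle> Q"] card_points by simp
    then show False using no_weight_10 sdiff_closed UNIV_in_G PQ by blast
  qed
  ultimately have "card (P \<inter> Q) \<noteq> 3" "card (P \<inter> Q) \<noteq> 1" "card (P \<inter> Q) < 5"
    using card_sdiff [of P Q] PQ by auto
  then have "card (P \<inter> Q) = 0 \<or> card (P \<inter> Q) = 2 \<or> card (P \<inter> Q) = 4" by arith
  then show ?thesis by auto
qed

text \<open>The octads span the code: adding an octad through five points of A lowers the weight by
  at least 2.\<close>

lemma octad_span_induct [consumes 1, case_names empty step]:
  assumes "A \<in> \<G>" "P {}" "\<And>A Q. A \<in> \<G> \<Longrightarrow> Q \<in> octads \<Longrightarrow> P A \<Longrightarrow> P (A \<triangle> Q)"
  shows "P A"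
  using assms(1)
proof (induction "card A" arbitrary: A rule: less_induct)
  case less
  show ?case
  proof (cases "A = {}")
    case False
    then obtain F where F: "F \<subseteq> A" "card F = 5"
      using obtain_subset_with_card_n [of 5 A] min_weight [OF less.prems] by auto
    obtain Q where Q: "Q \<in> octads" "F \<subseteq> Q" using octad_through_five F(2) by blast
    have "5 \<le> card (A \<inter> Q)" using card_mono [of "A \<inter> Q" F] F Q by auto
    then have "card (A \<triangle> Q) < card A" using card_sdiff [of A Q] octad_card Q by fastforce
    moreover have AQ: "A \<triangle> Q \<in> \<G>" using less.prems Q octad_in_G sdiff_closed by blast
    ultimately have "P ((A \<triangle> Q) \<triangle> Q)" using less.hyps Q assms(3) by blast
    then show ?thesis by (simp add: sdiff_assoc)
  qed (use assms in simp)
qed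

lemma even_card_Int:
  assumes "A \<in> \<G>" "B \<in> \<G>"
  shows "even (card (A \<inter> B))"
proof -
  have 1: "even (card (A \<inter> Q))" if "A \<in> \<G>" "Q \<in> octads" for A Q
    using that(1) by (rule octad_span_induct) (use that in \<open>auto simp: even_card_sdiff_Int_iff even_octad_Int\<close>)
  have 2: "even (card (Q \<inter> A))" if "Q \<in> octads" for Q
    using 1 [OF assms(1) that] by (simp add: Int_commute)
  have "even (card (B \<inter> A))"
    using assms(2) by (rule octad_span_induct) (auto simp: even_card_sdiff_Int_iff 2)
  then show ?thesis by (simp add: Int_commute)
qed

text \<open>Adding an octad changes the weight by 8 - 2 |A \<inter> Q|, a multiple of 4 since the
  intersection is even.\<close>

lemma four_dvd_card: "A \<in> \<G> \<Longrightarrow> 4 dvd card A"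
proof (induction rule: octad_span_induct)
  case (step A Q)
  then have "even (card (A \<inter> Q))" using even_card_Int octad_in_G by blast
  then obtain k where "card (A \<inter> Q) = 2 * k" by blast
  moreover obtain l where "card A = 4 * l" using step by (auto elim: dvdE)
  ultimately have "card (A \<triangle> Q) = 4 * (l + 2 - k)" using card_sdiff [of A Q] octad_card step by auto
  then show ?case by simp
qed auto

text \<open>If the leaders have weight 4, there are six of them covering all coordinates, so one
  passes through p. This choice shortens the case analyses below.\<close>

lemma short_coset_leader:
  "\<exists>T. T \<triangle> X \<in> \<G> \<and> card T \<le> 4 \<and> (card T = 4 \<longrightarrow> p \<in> T)"
proof (cases "card (tetrads X) = 6")
  case True
  then have "p \<in> \<Union>(tetrads X)" using Union_tetrads [OF True] by simp
  then obtain T where "p \<in> T" "T \<in> tetrads X" by blast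
  then show ?thesis by (auto simp: tetrads_def)
next
  case False
  then obtain S where "card S \<le> 3" "S \<triangle> X \<in> \<G>" using coset_leader_cases by blast
  then show ?thesis by (intro exI [of _ S]) auto
qed

subsection \<open>Numbers of octads through given points\<close>

definition octad_count :: "'n set \<Rightarrow> nat" where
  "octad_count S = card {Q \<in> octads. S \<subseteq> Q}"

text \<open>Count the pairs of an octad containing S and one of its points outside S.\<close>

lemma octad_count_step:
  "(\<Sum>x\<in>-S. octad_count (insert x S)) = (8 - card S) * octad_count S"
proof -
  have "(\<Sum>x\<in>-S. octad_count (insert x S))
      = (\<Sum>x\<in>-S. \<Sum>Q\<in>{Q \<in> octads. S \<subseteq> Q}. if x \<in> Q then 1 else 0)"
    by (intro sum.cong refl) (auto simp: octad_count_def Int_def simp flip: sum.inter_filter intro!: arg_cong [where f = card])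
  also have "\<dots> = (\<Sum>Q\<in>{Q \<in> octads. S \<subseteq> Q}. \<Sum>x\<in>-S. if x \<in> Q then 1 else 0)"
    by (rule sum.swap)
  also have "\<dots> = (\<Sum>Q\<in>{Q \<in> octads. S \<subseteq> Q}. 8 - card S)"
  proof (rule sum.cong [OF refl])
    fix Q assume Q: "Q \<in> {Q \<in> octads. S \<subseteq> Q}"
    have "(\<Sum>x\<in>-S. if x \<in> Q then 1 else 0) = card (Q - S)"
      by (auto simp flip: sum.inter_filter intro!: arg_cong [where f = card])
    also have "\<dots> = 8 - card S" using Q octad_card by (simp add: card_Diff_subset)
    finally show "(\<Sum>x\<in>-S. if x \<in> Q then 1 else 0) = 8 - card S" .
  qed
  finally show ?thesis by (simp add: octad_count_def mult.commute)
qed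

lemma octad_count_5:
  assumes "card S = 5" shows "octad_count S = 1"
proof -
  obtain Q where Q: "Q \<in> octads" "S \<subseteq> Q" using octad_through_five assms by blast
  have "P = Q" if "P \<in> octads" "S \<subseteq> P" for P
  proof (rule octads_eqI [OF that(1) Q(1)])
    show "5 \<le> card (P \<inter> Q)" using card_mono [of "P \<inter> Q" S] that Q assms by auto
  qed
  then have "{Q \<in> octads. S \<subseteq> Q} = {Q}" using Q by blast
  then show ?thesis by (simp add: octad_count_def)
qed

text \<open>Downward recursion from five points; it produces the numbers 1, 5, 21, 77, 253 of the
  Steiner system.\<close>

lemma octad_count_rec:
  assumes "\<And>S. card S = k' \<Longrightarrow> octad_count S = l" "card S = k" "k' = Suc k"
  shows "(24 - k) * l = (8 - k) * octad_count S"
proof -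
  have "(\<Sum>x\<in>-S. octad_count (insert x S)) = (\<Sum>x\<in>-S. l)"
    using assms by (intro sum.cong) auto
  then show ?thesis using octad_count_step [of S] assms card_points by (simp add: Compl_eq_Diff_UNIV card_Diff_subset)
qed

lemma octad_count_4: "card S = 4 \<Longrightarrow> octad_count S = 5"
  using octad_count_rec [OF octad_count_5, where S = S and k = 4] by simp

lemma octad_count_3: "card S = 3 \<Longrightarrow> octad_count S = 21"
  using octad_count_rec [OF octad_count_4, where S = S and k = 3] by simp

lemma octad_count_2: "card S = 2 \<Longrightarrow> octad_count S = 77"
  using octad_count_rec [OF octad_count_3, where S = S and k = 2] by simp

lemma octad_count_1: "card S = 1 \<Longrightarrow> octad_count S = 253"
  using octad_count_rec [OF octad_count_2, where S = S and k = 1] by simp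

end

subsection \<open>Octads relative to three fixed points\<close>

text \<open>In the application a, b, c are the coordinates 1, 2, 3: w is exceptional at a, v is
  supported on a and b, u is exceptional at c. Octads are sorted by their trace on these
  points.\<close>

locale pointed_golay = golay \<G> for \<G> :: "'n::finite set set" +
  fixes a b c :: 'n
  assumes distinct: "a \<noteq> b" "a \<noteq> c" "b \<noteq> c"
begin

lemmas distinct' [simp] = distinct distinct [symmetric]

definition R :: "'n set" where
  "R = - {a, b, c}"

definition fam :: "'n set \<Rightarrow> 'n set set" where
  "fam P = {Q \<in> octads. Q \<inter> {a, b, c} = P}"

lemma card_R: "card R = 21"
  by (simp add: R_def Compl_eq_Diff_UNIV card_Diff_subset card_points)

lemma not_in_R [simp]: "a \<notin> R" "b \<notin> R" "c \<notin> R"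
  by (auto simp: R_def)

lemma UNIV_R: "UNIV = insert a (insert b (insert c R))"
  by (auto simp: R_def)

lemma famD: "Q \<in> fam P \<Longrightarrow> Q \<in> octads" "Q \<in> fam P \<Longrightarrow> card Q = 8"
  by (auto simp: fam_def octads_def)

lemma card_fam_abc:
  "card {Q \<in> fam {a, b, c}. T \<subseteq> Q} = octad_count ({a, b, c} \<union> T)"
  unfolding octad_count_def by (rule arg_cong [where f = card]) (auto simp: fam_def)

lemma card_fam_pair:
  assumes "P \<in> {{a, b}, {a, c}, {b, c}}"
  shows "card {Q \<in> fam P. T \<subseteq> Q} + card {Q \<in> fam {a, b, c}. T \<subseteq> Q} = octad_count (P \<union> T)"
proof -
  have "P \<noteq> {a, b, c}" using assms distinct by (metis insert_iff empty_iff)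
  moreover have "{Q \<in> octads. P \<union> T \<subseteq> Q} = {Q \<in> fam P. T \<subseteq> Q} \<union> {Q \<in> fam {a, b, c}. T \<subseteq> Q}"
    using assms distinct by (auto simp: fam_def)
  ultimately show ?thesis
    unfolding octad_count_def by (subst card_Un_disjoint [symmetric]) (auto simp: fam_def)
qed

lemma card_fam_a:
  "card {Q \<in> fam {a}. T \<subseteq> Q} + card {Q \<in> fam {a, b}. T \<subseteq> Q} + card {Q \<in> fam {a, c}. T \<subseteq> Q}
     + card {Q \<in> fam {a, b, c}. T \<subseteq> Q} = octad_count ({a} \<union> T)"
proof -
  have ne: "{a} \<noteq> {a, b}" "{a} \<noteq> {a, c}" "{a, b} \<noteq> {a, c}" "{a} \<noteq> {a, b, c}"
    "{a, b} \<noteq> {a, b, c}" "{a, c} \<noteq> {a, b, c}"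
    using distinct by (metis insert_iff empty_iff)+
  have "{Q \<in> octads. {a} \<union> T \<subseteq> Q} = {Q \<in> fam {a}. T \<subseteq> Q} \<union> ({Q \<in> fam {a, b}. T \<subseteq> Q} \<union>
      ({Q \<in> fam {a, c}. T \<subseteq> Q} \<union> {Q \<in> fam {a, b, c}. T \<subseteq> Q}))"
    by (auto simp: fam_def)
  then show ?thesis
    unfolding octad_count_def using ne by (simp add: card_Un_disjoint fam_def disjoint_iff)
qed

definition cnt :: "'n set \<Rightarrow> 'n set \<Rightarrow> real" where
  "cnt P T = real (card {Q \<in> fam P. T \<subseteq> Q})"

lemma card_Un_R:
  assumes "T \<subseteq> R" "P \<subseteq> {a, b, c}"
  shows "card (P \<union> T) = card P + card T"
  using assms by (intro card_Un_disjoint) (auto simp: R_def)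

lemma cnt_abc:
  assumes "T \<subseteq> R"
  shows "card T = 0 \<Longrightarrow> cnt {a, b, c} T = 21" "card T = 1 \<Longrightarrow> cnt {a, b, c} T = 5"
    "card T = 2 \<Longrightarrow> cnt {a, b, c} T = 1"
  using card_Un_R [OF assms, of "{a, b, c}"]
  by (simp_all only: cnt_def card_fam_abc)
    (auto simp: octad_count_3 octad_count_4 octad_count_5)

text \<open>For three points T the count depends on T. It is kept as an expression in the count for
  \<open>{a, b, c}\<close>, which cancels in the third moments.\<close>

lemma cnt_pair:
  assumes "T \<subseteq> R" "P \<in> {{a, b}, {a, c}, {b, c}}"
  shows "card T = 0 \<Longrightarrow> cnt P T = 56" "card T = 1 \<Longrightarrow> cnt P T = 16" "card T = 2 \<Longrightarrow> cnt P T = 4"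
    "card T = 3 \<Longrightarrow> cnt P T = 1 - cnt {a, b, c} T"
proof -
  have "card (P \<union> T) = 2 + card T" using card_Un_R [OF assms(1), of P] assms(2) by auto
  moreover have "cnt P T = real (octad_count (P \<union> T)) - cnt {a, b, c} T"
    using card_fam_pair [OF assms(2), of T] by (simp add: cnt_def)
  ultimately show "card T = 0 \<Longrightarrow> cnt P T = 56" "card T = 1 \<Longrightarrow> cnt P T = 16"
    "card T = 2 \<Longrightarrow> cnt P T = 4" "card T = 3 \<Longrightarrow> cnt P T = 1 - cnt {a, b, c} T"
    using cnt_abc [OF assms(1)]
    by (simp_all add: octad_count_2 octad_count_3 octad_count_4 octad_count_5)
qed

lemma cnt_a:
  assumes "T \<subseteq> R"
  shows "card T = 0 \<Longrightarrow> cnt {a} T = 120" "card T = 1 \<Longrightarrow> cnt {a} T = 40"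
    "card T = 2 \<Longrightarrow> cnt {a} T = 12" "card T = 3 \<Longrightarrow> cnt {a} T = 3 + cnt {a, b, c} T"
proof -
  have "card ({a} \<union> T) = 1 + card T" using card_Un_R [OF assms, of "{a}"] by auto
  moreover have "cnt {a} T = real (octad_count ({a} \<union> T)) - cnt {a, b} T - cnt {a, c} T - cnt {a, b, c} T"
    using card_fam_a [of T] by (simp add: cnt_def)
  ultimately show "card T = 0 \<Longrightarrow> cnt {a} T = 120" "card T = 1 \<Longrightarrow> cnt {a} T = 40"
    "card T = 2 \<Longrightarrow> cnt {a} T = 12" "card T = 3 \<Longrightarrow> cnt {a} T = 3 + cnt {a, b, c} T"
    using cnt_abc [OF assms] cnt_pair [OF assms, of "{a, b}"] cnt_pair [OF assms, of "{a, c}"]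
    by (simp_all add: octad_count_1 octad_count_2 octad_count_3 octad_count_4)
qed

section \<open>Parity tests for membership in the code\<close>

text \<open>An octad through S that avoids A cuts out of T exactly T \<inter> S. Since S and A
  together contain a, b, c, its type is prescribed too.\<close>

lemma fam_odd_witness:
  assumes "card S \<le> 4" "card A \<le> 4" "S \<inter> A = {}" "P \<subseteq> S" "{a, b, c} - P \<subseteq> A" "P \<subseteq> {a, b, c}"
    and "T \<subseteq> S \<union> A" "odd (card (T \<inter> S))"
  shows "\<exists>Q\<in>fam P. odd (card (T \<inter> Q))"
proof -
  obtain Q where Q: "Q \<in> octads" "S \<subseteq> Q" "Q \<inter> A = {}" using octad_separating assms(1-3) by blast
  have "T \<inter> Q = T \<inter> S" using Q assms by auto
  moreover have "Q \<inter> {a, b, c} = P" using Q assms by auto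
  ultimately show ?thesis using Q assms by (auto simp: fam_def)
qed

text \<open>X and its leader differ by a codeword, which meets every octad evenly. Parity tests on X
  can thus be made on at most four points.\<close>

lemma even_short_leader:
  assumes "even (card X)"
  obtains T where "T \<triangle> X \<in> \<G>" "card T \<le> 4" "card T = 4 \<Longrightarrow> a \<in> T" "even (card T)"
    "\<And>Q. Q \<in> octads \<Longrightarrow> even (card (T \<inter> Q)) \<longleftrightarrow> even (card (X \<inter> Q))"
proof -
  obtain T where T: "T \<triangle> X \<in> \<G>" "card T \<le> 4" "card T = 4 \<longrightarrow> a \<in> T"
    using short_coset_leader by blast
  have "even (card (T \<triangle> X))" using even_card_Int [OF T(1) T(1)] by simp
  then have "even (card T)" using assms even_card_sdiff_iff [of T X] by simp
  moreover have "even (card (T \<inter> Q)) \<longleftrightarrow> even (card (X \<inter> Q))" if "Q \<in> octads" for Q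
    using even_card_Int [OF T(1) octad_in_G [OF that]] even_card_sdiff_Int_iff [of T X Q] by simp
  ultimately show thesis using T that by blast
qed

lemma card_insert_remove_le:
  fixes x y :: 'n
  assumes "y \<in> T" shows "card (insert x T - {y}) \<le> card T"
proof -
  have "card (insert x T - {y}) = card (insert x T) - 1" using assms by (simp add: card_Diff_singleton)
  then show ?thesis by (simp add: card_insert_if)
qed

text \<open>A sharp form of self-duality with octads of two types only. A nonzero even leader has
  two or four points; for each position relative to a, b, c some octad of these types meets it
  oddly.\<close>

lemma mem_G_if_even_pairs:
  assumes ev: "even (card X)"
    and fam: "\<And>Q. Q \<in> fam {a, b} \<union> fam {a, c} \<Longrightarrow> even (card (X \<inter> Q))"
  shows "X \<in> \<G>"
proof -
  obtain T where T: "T \<triangle> X \<in> \<G>" "card T \<le> 4" "card T = 4 \<Longrightarrow> a \<in> T" "even (card T)"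
    "\<And>Q. Q \<in> octads \<Longrightarrow> even (card (T \<inter> Q)) \<longleftrightarrow> even (card (X \<inter> Q))"
    using even_short_leader [OF ev] by blast
  have ev_T: "even (card (T \<inter> Q))" if "Q \<in> fam {a, b} \<union> fam {a, c}" for Q
    using T(5) fam that by (auto simp: fam_def)
  then have no: "\<not> (\<exists>Q\<in>fam {a, b}. odd (card (T \<inter> Q)))" "\<not> (\<exists>Q\<in>fam {a, c}. odd (card (T \<inter> Q)))"
    by auto
  have "T = {}"
  proof (rule ccontr)
    assume ne: "T \<noteq> {}"
    then have "card T \<noteq> 0" by simp
    with T(2,4) have card_T: "card T = 2 \<or> card T = 4" by presburger
    show False
    proof (cases "a \<in> T")
      case a: True
      consider "b \<in> T" "c \<in> T" | "b \<notin> T" | "c \<notin> T" by blast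
      then show False
      proof cases
        case 1
        \<comment> \<open>T contains all three special points. Without c it has three points, an odd
          number, and the octad is made to avoid c.\<close>
        have "3 \<le> card T" using card_mono [of T "{a, b, c}"] a 1 by simp
        then have "card T = 4" using card_T by simp
        then have "card (T - {c}) = 3" using 1 by simp
        moreover have "T \<inter> (T - {c}) = T - {c}" by auto
        ultimately have "\<exists>Q\<in>fam {a, b}. odd (card (T \<inter> Q))"
          using a 1 by (intro fam_odd_witness [of "T - {c}" "{c}"]) auto
        then show False using no by simp
      next
        case 2
        \<comment> \<open>One point of T is covered; the rest of T and c are avoided. Replacing a by
          c keeps the avoided set within four points.\<close>
        have "T \<inter> {a, b} = {a}" using a 2 by auto
        then have "\<exists>Q\<in>fam {a, b}. odd (card (T \<inter> Q))"
          using a 2 T(2) card_insert_remove_le [OF a, of c]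
          by (intro fam_odd_witness [of "{a, b}" "insert c T - {a}"]) auto
        then show False using no by simp
      next
        case 3
        have "T \<inter> {a, c} = {a}" using a 3 by auto
        then have "\<exists>Q\<in>fam {a, c}. odd (card (T \<inter> Q))"
          using a 3 T(2) card_insert_remove_le [OF a, of b]
          by (intro fam_odd_witness [of "{a, c}" "insert b T - {a}"]) auto
        then show False using no by simp
      qed
    next
      case a: False
      then have T2: "card T = 2" using card_T T(3) by blast
      consider "b \<in> T" | "c \<in> T" | "b \<notin> T" "c \<notin> T" by blast
      then show False
      proof cases
        case 1
        have "T \<inter> {a, b} = {b}" using a 1 by auto
        then have "\<exists>Q\<in>fam {a, b}. odd (card (T \<inter> Q))"
          using a 1 T(2) card_insert_remove_le [OF 1, of c]
          by (intro fam_odd_witness [of "{a, b}" "insert c T - {b}"]) auto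
        then show False using no by simp
      next
        case 2
        have "T \<inter> {a, c} = {c}" using a 2 by auto
        then have "\<exists>Q\<in>fam {a, c}. odd (card (T \<inter> Q))"
          using a 2 T(2) card_insert_remove_le [OF 2, of b]
          by (intro fam_odd_witness [of "{a, c}" "insert b T - {c}"]) auto
        then show False using no by simp
      next
        case 3
        obtain d e where de: "T = {d, e}" "d \<noteq> e" using T2 by (auto simp: card_2_iff)
        have "T \<inter> {a, b, d} = {d}" using a 3 de by auto
        then have "\<exists>Q\<in>fam {a, b}. odd (card (T \<inter> Q))"
          using a 3 de by (intro fam_odd_witness [of "{a, b, d}" "{c, e}"]) (auto simp: card_insert_if)
        then show False using no by simp
      qed
    qed
  qed
  then show ?thesis using T(1) by simp
qed

text \<open>Octads of these types meet {b, c} in two points or none, so the test cannot separate X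
  from X \<triangle> {b, c}. This ambiguity is later the choice between the two halves of the shell
  of 112 vectors.\<close>

lemma mem_G_if_even_others:
  assumes ev: "even (card X)"
    and fam: "\<And>Q. Q \<in> fam {a, b, c} \<union> fam {a} \<union> fam {b, c} \<Longrightarrow> even (card (X \<inter> Q))"
  shows "X \<in> \<G> \<or> {b, c} \<triangle> X \<in> \<G>"
proof -
  obtain T where T: "T \<triangle> X \<in> \<G>" "card T \<le> 4" "card T = 4 \<Longrightarrow> a \<in> T" "even (card T)"
    "\<And>Q. Q \<in> octads \<Longrightarrow> even (card (T \<inter> Q)) \<longleftrightarrow> even (card (X \<inter> Q))"
    using even_short_leader [OF ev] by blast
  have ev_T: "even (card (T \<inter> Q))" if "Q \<in> fam {a, b, c} \<union> fam {a} \<union> fam {b, c}" for Q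
    using T(5) fam that by (auto simp: fam_def)
  then have no: "\<not> (\<exists>Q\<in>fam {a, b, c}. odd (card (T \<inter> Q)))" "\<not> (\<exists>Q\<in>fam {a}. odd (card (T \<inter> Q)))"
      "\<not> (\<exists>Q\<in>fam {b, c}. odd (card (T \<inter> Q)))"
    by auto
  have "T = {} \<or> T = {b, c}"
  proof (rule ccontr)
    assume ne: "\<not> (T = {} \<or> T = {b, c})"
    then have "card T \<noteq> 0" by simp
    with T(2,4) have card_T: "card T = 2 \<or> card T = 4" by presburger
    show False
    proof (cases "a \<in> T")
      case a: True
      consider "b \<in> T" | "c \<in> T" | "b \<notin> T" "c \<notin> T" by blast
      then show False
      proof cases
        case 1
        have "T \<inter> {a} = {a}" using a by auto
        then have "\<exists>Q\<in>fam {a}. odd (card (T \<inter> Q))"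
          using a 1 T(2) card_insert_remove_le [OF a, of c]
          by (intro fam_odd_witness [of "{a}" "insert c T - {a}"]) auto
        then show False using no by simp
      next
        case 2
        have "T \<inter> {a} = {a}" using a by auto
        then have "\<exists>Q\<in>fam {a}. odd (card (T \<inter> Q))"
          using a 2 T(2) card_insert_remove_le [OF a, of b]
          by (intro fam_odd_witness [of "{a}" "insert b T - {a}"]) auto
        then show False using no by simp
      next
        case 3
        have "T \<inter> {a, b, c} = {a}" using a 3 by auto
        then have "\<exists>Q\<in>fam {a, b, c}. odd (card (T \<inter> Q))"
          using a 3 T(2) by (intro fam_odd_witness [of "{a, b, c}" "T - {a}"]) auto
        then show False using no by simp
      qed
    next
      case a: False
      then have T2: "card T = 2" using card_T T(3) by blast
      then obtain d e where de: "T = {d, e}" "d \<noteq> e" by (auto simp: card_2_iff)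
      have "{b, c} = T" if "b \<in> T" "c \<in> T"
        using that T2 by (intro card_subset_eq) auto
      then consider "b \<in> T" "c \<notin> T" | "c \<in> T" "b \<notin> T" | "b \<notin> T" "c \<notin> T" using ne by blast
      then show False
      proof cases
        case 1
        have "T \<inter> {b, c} = {b}" using 1 by auto
        then have "\<exists>Q\<in>fam {b, c}. odd (card (T \<inter> Q))"
          using a 1 T(2) card_insert_remove_le [OF 1(1), of a]
          by (intro fam_odd_witness [of "{b, c}" "insert a T - {b}"]) auto
        then show False using no by simp
      next
        case 2
        have "T \<inter> {b, c} = {c}" using 2 by auto
        then have "\<exists>Q\<in>fam {b, c}. odd (card (T \<inter> Q))"
          using a 2 T(2) card_insert_remove_le [OF 2(1), of a]
          by (intro fam_odd_witness [of "{b, c}" "insert a T - {c}"]) auto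
        then show False using no by simp
      next
        case 3
        have "T \<inter> {a, d} = {d}" using a 3 de by auto
        then have "\<exists>Q\<in>fam {a}. odd (card (T \<inter> Q))"
          using a 3 de by (intro fam_odd_witness [of "{a, d}" "{b, c, e}"]) (auto simp: card_insert_if)
        then show False using no by simp
      qed
    qed
  qed
  then show ?thesis using T(1) by auto
qed

text \<open>F contains b, c, i, j but not a. Adding it to an octad through a, c, i that misses b, j
  gives one through a, b, j that misses c, i. Two such octads with complementary traces on the rest
  of F make all other coordinates cancel.\<close>

lemma octad_quadruple:
  assumes ij: "i \<in> R" "j \<in> R" "i \<noteq> j"
  obtains O1 O2 O3 O4 where "O1 \<in> fam {a, c}" "O2 \<in> fam {a, c}" "O3 \<in> fam {a, b}" "O4 \<in> fam {a, b}"
    "\<And>\<xi> :: 'n \<Rightarrow> real. sum \<xi> (R \<inter> O1) + sum \<xi> (R \<inter> O2) - sum \<xi> (R \<inter> O3) - sum \<xi> (R \<inter> O4) = 2 * (\<xi> i - \<xi> j)"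
proof -
  have d [simp]: "i \<noteq> a" "i \<noteq> b" "i \<noteq> c" "j \<noteq> a" "j \<noteq> b" "j \<noteq> c" "a \<noteq> i" "b \<noteq> i" "c \<noteq> i" "a \<noteq> j" "b \<noteq> j" "c \<noteq> j" "i \<noteq> j" "j \<noteq> i"
    using ij by (auto simp: R_def)
  have "card {a, b, c, i, j} = 5" by simp
  then obtain Q where Q: "Q \<in> octads" "{a, b, c, i, j} \<subseteq> Q" using octad_through_five by blast
  have "card (Q - {a, b, c, i, j}) = 3" using Q octad_card by (simp add: card_Diff_subset)
  \<comment> \<open>k is a further point of the octad Q through a, b, c, i, j. Another octad through
    a, c, i, k has no fifth point in Q, so it avoids b and j.\<close>
  then obtain k where k: "k \<in> Q" "k \<notin> {a, b, c, i, j}"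
    by (metis Diff_iff card.empty ex_in_conv zero_neq_numeral)
  obtain F where F: "F \<in> octads" "{b, c, i, j} \<subseteq> F" "a \<notin> F"
    using octad_separating [of "{b, c, i, j}" "{a}"] by auto
  have le4: "card (P \<inter> P') \<le> 4" if "P \<in> octads" "P' \<in> octads" "P \<noteq> P'" for P P'
    using octads_eqI [of P P'] that by force
  have "F \<noteq> Q" using F Q by auto
  then have "card (F \<inter> Q) \<le> 4" using le4 F Q by blast
  then have FQ: "F \<inter> Q = {b, c, i, j}"
    using F Q by (intro card_seteq [symmetric]) auto
  define E where "E = F - {b, c, i, j}"
  have card_E: "card E = 4" using F octad_card by (simp add: E_def card_Diff_subset)
  have ex: "\<exists>P\<in>octads. {a, c, i, k, e} \<subseteq> P \<and> b \<notin> P \<and> j \<notin> P \<and> card (P \<inter> E) = 2"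
    if e: "e \<in> E" for e
  proof -
    have e': "e \<in> F" "e \<notin> Q" using e FQ by (auto simp: E_def)
    then have "card {a, c, i, k, e} = 5" using k Q F FQ by (auto simp: card_insert_if)
    then obtain P where P: "P \<in> octads" "{a, c, i, k, e} \<subseteq> P" using octad_through_five by blast
    have "P \<noteq> Q" using P e' by auto
    then have "card (P \<inter> Q) \<le> 4" using le4 P Q by blast
    moreover have "card {a, c, i, k} = 4" using k by (auto simp: card_insert_if)
    ultimately have PQ: "P \<inter> Q = {a, c, i, k}"
      using P Q k by (intro card_seteq [symmetric]) auto
    have "b \<notin> P \<inter> Q" "j \<notin> P \<inter> Q" unfolding PQ using k by auto
    then have bj: "b \<notin> P" "j \<notin> P" using Q by auto
    have "P \<noteq> F" using P F by auto
    then have le: "card (P \<inter> F) \<le> 4" using le4 P F by blast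
    \<comment> \<open>The intersection with F is even, has at most four points and contains c, i and
      e; this leaves exactly two points in E.\<close>
    have "P \<inter> F = {c, i} \<union> (P \<inter> E)" using P F bj by (auto simp: E_def)
    then have "card (P \<inter> F) = 2 + card (P \<inter> E)"
      by (simp add: card_Un_disjoint E_def)
    moreover have "even (card (P \<inter> F))" using even_octad_Int P F by blast
    moreover have "card (P \<inter> E) \<noteq> 0" using P e by auto
    ultimately have "card (P \<inter> E) = 2" using le by presburger
    then show ?thesis using P bj by blast
  qed
  obtain e where e: "e \<in> E" using card_E by fastforce
  obtain O1 where O1: "O1 \<in> octads" "{a, c, i, k, e} \<subseteq> O1" "b \<notin> O1" "j \<notin> O1" "card (O1 \<inter> E) = 2"
    using ex [OF e] by blast
  have "card (E - O1) = 2" using card_E O1 by (simp add: card_Diff_subset_Int Int_commute)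
  then obtain f where f: "f \<in> E" "f \<notin> O1"
    by (metis Diff_iff card.empty ex_in_conv zero_neq_numeral)
  obtain O2 where O2: "O2 \<in> octads" "{a, c, i, k, f} \<subseteq> O2" "b \<notin> O2" "j \<notin> O2" "card (O2 \<inter> E) = 2"
    using ex [OF f(1)] by blast
  \<comment> \<open>The octads are distinct by the choice of f and already share a, c, i, k, so they
    have no further common point.\<close>
  have dis: "O1 \<inter> O2 \<inter> E = {}"
  proof (rule ccontr)
    assume "O1 \<inter> O2 \<inter> E \<noteq> {}"
    then obtain x where x: "x \<in> O1" "x \<in> O2" "x \<in> E" by blast
    have "x \<notin> {a, c, i, k}" using x(3) F FQ k by (auto simp: E_def)
    then have "card {a, c, i, k, x} = 5" using k by (auto simp: card_insert_if)
    moreover have "card {a, c, i, k, x} \<le> card (O1 \<inter> O2)"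
      using O1 O2 x by (intro card_mono) auto
    ultimately have "O1 = O2" using octads_eqI O1 O2 by metis
    then show False using O2 f by auto
  qed
  have "card ((O1 \<inter> E) \<union> (O2 \<inter> E)) = 4"
    using dis O1 O2 by (subst card_Un_disjoint) auto
  then have cov: "(O1 \<inter> E) \<union> (O2 \<inter> E) = E"
    using card_E by (intro card_subset_eq) auto
  have flip: "P \<triangle> F \<in> fam {a, b} \<and> P \<in> fam {a, c}"
    if P: "P \<in> octads" "{a, c, i, k} \<subseteq> P" "b \<notin> P" "j \<notin> P" "card (P \<inter> E) = 2" for P
  proof -
    have "P \<inter> F = {c, i} \<union> (P \<inter> E)" using P F by (auto simp: E_def)
    then have "card (P \<inter> F) = 4" using P by (simp add: card_Un_disjoint E_def)
    then have "card (P \<triangle> F) = 8" using card_sdiff [of P F] octad_card P F by simp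
    then have "P \<triangle> F \<in> octads" using sdiff_closed P F by (auto simp: octads_def)
    then show ?thesis using P F by (auto simp: fam_def)
  qed
  have mem: "O1 \<in> fam {a, c}" "O2 \<in> fam {a, c}" "O1 \<triangle> F \<in> fam {a, b}" "O2 \<triangle> F \<in> fam {a, b}"
    using flip [of O1] flip [of O2] O1 O2 by auto
  have "sum \<xi> (R \<inter> O1) + sum \<xi> (R \<inter> O2) - sum \<xi> (R \<inter> (O1 \<triangle> F)) - sum \<xi> (R \<inter> (O2 \<triangle> F)) = 2 * (\<xi> i - \<xi> j)"
    for \<xi> :: "'n \<Rightarrow> real"
  proof -
    have s: "sum \<xi> (R \<inter> P) = (\<Sum>x\<in>R. if x \<in> P then \<xi> x else 0)" for P
      by (simp add: sum.inter_restrict)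
    have "sum \<xi> (R \<inter> O1) + sum \<xi> (R \<inter> O2) - sum \<xi> (R \<inter> (O1 \<triangle> F)) - sum \<xi> (R \<inter> (O2 \<triangle> F))
       = (\<Sum>x\<in>R. (if x \<in> O1 then \<xi> x else 0) + (if x \<in> O2 then \<xi> x else 0)
         - (if x \<in> O1 \<triangle> F then \<xi> x else 0) - (if x \<in> O2 \<triangle> F then \<xi> x else 0))"
      unfolding s by (simp add: sum.distrib sum_subtractf)
    also have "\<dots> = (\<Sum>x\<in>R. (if x = i then 2 * \<xi> i else 0) - (if x = j then 2 * \<xi> j else 0))"
    proof (rule sum.cong [OF refl])
      fix x assume x: "x \<in> R"
      consider "x = i" | "x = j" | "x \<notin> F" "x \<noteq> i" "x \<noteq> j" | "x \<in> E" "x \<noteq> i" "x \<noteq> j"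
        using x by (auto simp: E_def R_def)
      then show "(if x \<in> O1 then \<xi> x else 0) + (if x \<in> O2 then \<xi> x else 0)
         - (if x \<in> O1 \<triangle> F then \<xi> x else 0) - (if x \<in> O2 \<triangle> F then \<xi> x else 0)
        = (if x = i then 2 * \<xi> i else 0) - (if x = j then 2 * \<xi> j else 0)"
      proof cases
        case 1 then show ?thesis using O1 O2 F by simp
      next
        case 2 then show ?thesis using O1 O2 F by simp
      next
        case 3 then show ?thesis by simp
      next
        case 4
        then have "x \<in> F" "(x \<in> O1) \<noteq> (x \<in> O2)" using dis cov by (auto simp: E_def)
        then show ?thesis using 4 by auto
      qed
    qed
    also have "\<dots> = 2 * (\<xi> i - \<xi> j)"
      using ij by (simp add: sum_subtractf)
    finally show ?thesis .
  qed
  then show thesis using that mem by blast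
qed

end

section \<open>The Leech lattice in integer coordinates\<close>

context golay
begin

text \<open>The offset m may be any integer, so that addition is a digitwise computation with
  carries. As 4 divides card S, the parity of the sum of n encodes the condition on the coordinate
  sum modulo 8.\<close>

definition leechZ :: "('n \<Rightarrow> int) \<Rightarrow> bool" where
  "leechZ X \<longleftrightarrow> (\<exists>m S n. S \<in> \<G> \<and> (\<forall>i. X i = m + 2 * of_bool (i \<in> S) + 4 * n i) \<and> even (sum n UNIV - m))"

lemma leechZ_I:
  "S \<in> \<G> \<Longrightarrow> (\<And>i. X i = m + 2 * of_bool (i \<in> S) + 4 * n i) \<Longrightarrow> even (sum n UNIV - m) \<Longrightarrow> leechZ X"
  unfolding leechZ_def by blast

lemma sum_of_bool_mem: "(\<Sum>i\<in>UNIV. of_bool (i \<in> S)) = int (card S)" for S :: "'n set"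
  by (simp add: sum_of_bool_eq)

text \<open>Multiples of 4 in the offset go into n, whose sum changes by an even number. A surplus
  of 2 complements S, which stays in the code because the full set is a codeword.\<close>

lemma leechZ_reduced:
  assumes "leechZ X"
  obtains m S n where "m = 0 \<or> m = 1" "S \<in> \<G>" "\<And>i. X i = m + 2 * of_bool (i \<in> S) + 4 * n i"
    "even (sum n UNIV - m)"
proof -
  obtain m S n where *: "S \<in> \<G>" "\<And>i. X i = m + 2 * of_bool (i \<in> S) + 4 * n i" "even (sum n UNIV - m)"
    using assms unfolding leechZ_def by blast
  define k where "k = m div 2"
  have m: "m = m mod 2 + 2 * k" "m mod 2 = 0 \<or> m mod 2 = 1" by (auto simp: k_def)
  show thesis
  proof (cases "even k")
    case True
    then obtain l where l: "k = 2 * l" by blast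
    have "(\<Sum>i\<in>UNIV. n i + l) = sum n UNIV + 24 * l"
      by (simp add: sum.distrib card_points)
    then have "even (sum (\<lambda>i. n i + l) UNIV - m mod 2)" using *(3) by simp
    moreover have "X i = m mod 2 + 2 * of_bool (i \<in> S) + 4 * (n i + l)" for i
      using *(2) [of i] m l by auto
    ultimately show thesis using that [of "m mod 2" S "\<lambda>i. n i + l"] m(2) *(1) by blast
  next
    case False
    then obtain l where l: "k = 2 * l + 1" by (blast elim: oddE)
    have "sum (\<lambda>i. n i + l + of_bool (i \<in> S)) UNIV = sum n UNIV + 24 * l + int (card S)"
      by (simp add: sum.distrib card_points sum_of_bool_mem)
    moreover have "even (card S)" using even_card_Int [OF *(1) *(1)] by simp
    ultimately have "even (sum (\<lambda>i. n i + l + of_bool (i \<in> S)) UNIV - m mod 2)" using *(3) by simp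
    moreover have "X i = m mod 2 + 2 * of_bool (i \<in> UNIV \<triangle> S) + 4 * (n i + l + of_bool (i \<in> S))" for i
      using *(2) [of i] m l by auto
    moreover have "UNIV \<triangle> S \<in> \<G>" using UNIV_in_G *(1) sdiff_closed by blast
    ultimately show thesis
      using that [of "m mod 2" "UNIV \<triangle> S" "\<lambda>i. n i + l + of_bool (i \<in> S)"] m(2) by blast
  qed
qed

lemma sum_leech_rep:
  fixes X :: "'n \<Rightarrow> int"
  assumes "\<And>i. X i = m + 2 * of_bool (i \<in> S) + 4 * n i"
  shows "sum X UNIV = 24 * m + 2 * int (card S) + 4 * sum n UNIV"
proof -
  have "sum X UNIV = (\<Sum>i\<in>UNIV. m + 2 * of_bool (i \<in> S) + 4 * n i)" using assms by simp
  also have "\<dots> = 24 * m + 2 * (\<Sum>i\<in>UNIV. of_bool (i \<in> S)) + 4 * sum n UNIV"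
    by (simp only: sum.distrib sum_distrib_left [symmetric]) (simp add: card_points)
  finally show ?thesis by (simp add: sum_of_bool_mem)
qed

lemma leechZ_iff:
  "leechZ X \<longleftrightarrow> (\<exists>m\<in>{0, 1}. (\<forall>i. [X i = m] (mod 2)) \<and> {i. odd ((X i - m) div 2)} \<in> \<G> \<and>
     [sum X UNIV = 4 * m] (mod 8))"
proof
  assume "leechZ X"
  then obtain m S n where *: "m = 0 \<or> m = 1" "S \<in> \<G>" "\<And>i. X i = m + 2 * of_bool (i \<in> S) + 4 * n i"
    "even (sum n UNIV - m)" by (rule leechZ_reduced) blast
  have "[X i = m] (mod 2)" for i
    unfolding cong_iff_dvd_diff *(3) by simp
  moreover have "{i. odd ((X i - m) div 2)} = S"
  proof -
    have "(X i - m) div 2 = of_bool (i \<in> S) + 2 * n i" for i using *(3) [of i] by auto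
    then show ?thesis by auto
  qed
  moreover obtain k where k: "card S = 4 * k" using four_dvd_card [OF *(2)] by blast
  obtain p where "sum n UNIV - m = 2 * p" using *(4) by blast
  then have "sum X UNIV - 4 * m = 8 * (3 * m + int k + p)"
    unfolding sum_leech_rep [OF *(3)] k by simp
  then have "[sum X UNIV = 4 * m] (mod 8)" unfolding cong_iff_dvd_diff by simp
  ultimately show "\<exists>m\<in>{0, 1}. (\<forall>i. [X i = m] (mod 2)) \<and> {i. odd ((X i - m) div 2)} \<in> \<G> \<and>
     [sum X UNIV = 4 * m] (mod 8)" using * by (intro bexI [of _ m]) auto
next
  assume "\<exists>m\<in>{0, 1}. (\<forall>i. [X i = m] (mod 2)) \<and> {i. odd ((X i - m) div 2)} \<in> \<G> \<and>
     [sum X UNIV = 4 * m] (mod 8)"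
  then obtain m where m: "\<And>i. [X i = m] (mod 2)" "{i. odd ((X i - m) div 2)} \<in> \<G>"
     "[sum X UNIV = 4 * m] (mod 8)" by blast
  define S where "S = {i. odd ((X i - m) div 2)}"
  define n where "n i = (X i - m) div 2 div 2" for i
  have X: "X i = m + 2 * of_bool (i \<in> S) + 4 * n i" for i
  proof -
    obtain h where h: "X i - m = 2 * h" using m(1) [of i] unfolding cong_iff_dvd_diff by blast
    have "h = of_bool (odd h) + 2 * (h div 2)" by (cases "even h") (auto elim!: evenE oddE)
    then show ?thesis using h by (simp add: S_def n_def)
  qed
  obtain k where k: "card S = 4 * k" using four_dvd_card m(2) S_def by blast
  obtain q where "sum X UNIV - 4 * m = 8 * q" using m(3) unfolding cong_iff_dvd_diff by blast
  then have "sum n UNIV - m = 2 * (q - 3 * m - int k)"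
    unfolding sum_leech_rep [OF X] k by simp
  then have "even (sum n UNIV - m)" by (metis dvd_triv_left)
  then show "leechZ X" by (rule leechZ_I [OF m(2) [folded S_def] X])
qed

lemma leechZ_add:
  assumes "leechZ X" "leechZ Y"
  shows "leechZ (\<lambda>i. X i + Y i)"
proof -
  obtain m S n where X: "S \<in> \<G>" "\<And>i. X i = m + 2 * of_bool (i \<in> S) + 4 * n i" "even (sum n UNIV - m)"
    using assms(1) unfolding leechZ_def by blast
  obtain m' S' n' where Y: "S' \<in> \<G>" "\<And>i. Y i = m' + 2 * of_bool (i \<in> S') + 4 * n' i" "even (sum n' UNIV - m')"
    using assms(2) unfolding leechZ_def by blast
  \<comment> \<open>The carry of two binary digits is the indicator of S \<inter> S', whose total is
    even by self-orthogonality.\<close>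
  have "sum (\<lambda>i. n i + n' i + of_bool (i \<in> S \<inter> S')) UNIV = sum n UNIV + sum n' UNIV + int (card (S \<inter> S'))"
    by (simp only: sum.distrib sum_of_bool_mem)
  moreover have "even (card (S \<inter> S'))" using even_card_Int X Y by blast
  ultimately have "even (sum (\<lambda>i. n i + n' i + of_bool (i \<in> S \<inter> S')) UNIV - (m + m'))"
    using X(3) Y(3) by presburger
  moreover have XY: "X i + Y i = (m + m') + 2 * of_bool (i \<in> S \<triangle> S') + 4 * (n i + n' i + of_bool (i \<in> S \<inter> S'))" for i
    using X(2) [of i] Y(2) [of i] by auto
  ultimately show ?thesis by (intro leechZ_I [OF sdiff_closed [OF X(1) Y(1)] XY])
qed

lemma leechZ_uminus:
  assumes "leechZ X"
  shows "leechZ (\<lambda>i. - X i)"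
proof -
  obtain m S n where X: "S \<in> \<G>" "\<And>i. X i = m + 2 * of_bool (i \<in> S) + 4 * n i" "even (sum n UNIV - m)"
    using assms(1) unfolding leechZ_def by blast
  have "sum (\<lambda>i. - n i - of_bool (i \<in> S)) UNIV = - sum n UNIV - int (card S)"
    by (simp only: sum_subtractf sum_negf sum_of_bool_mem)
  moreover have "even (card S)" using even_card_Int [OF X(1) X(1)] by simp
  ultimately have "even (sum (\<lambda>i. - n i - of_bool (i \<in> S)) UNIV - (- m))"
    using X(3) by presburger
  moreover have mX: "- X i = - m + 2 * of_bool (i \<in> S) + 4 * (- n i - of_bool (i \<in> S))" for i
    using X(2) [of i] by auto
  ultimately show ?thesis by (intro leechZ_I [OF X(1) mX])
qed

lemma leechZ_diff: "leechZ X \<Longrightarrow> leechZ Y \<Longrightarrow> leechZ (\<lambda>i. X i - Y i)"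
  using leechZ_add [OF _ leechZ_uminus [of Y], of X] by simp

text \<open>This is integrality of the lattice. The two terms 4 m \<Sum> n' and 4 m' \<Sum> n need
  not be divisible by 8, but both are congruent to 4 m m' modulo 8, so their sum is.\<close>

lemma leechZ_inner:
  assumes "leechZ X" "leechZ Y"
  shows "8 dvd (\<Sum>i\<in>UNIV. X i * Y i)"
proof -
  obtain m S n where X: "S \<in> \<G>" "\<And>i. X i = m + 2 * of_bool (i \<in> S) + 4 * n i" "even (sum n UNIV - m)"
    using assms(1) unfolding leechZ_def by blast
  obtain m' S' n' where Y: "S' \<in> \<G>" "\<And>i. Y i = m' + 2 * of_bool (i \<in> S') + 4 * n' i" "even (sum n' UNIV - m')"
    using assms(2) unfolding leechZ_def by blast
  define s s' where "s = (\<lambda>i. of_bool (i \<in> S) :: int)" and "s' = (\<lambda>i. of_bool (i \<in> S') :: int)"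
  have "X i * Y i = m * m' + 2 * m * s' i + 4 * m * n' i + 2 * m' * s i + 4 * of_bool (i \<in> S \<inter> S')
      + 4 * m' * n i + 8 * (s i * n' i + n i * s' i + 2 * (n i * n' i))" for i
    unfolding X(2) Y(2) by (auto simp: s_def s'_def algebra_simps)
  then have "(\<Sum>i\<in>UNIV. X i * Y i) = 24 * m * m' + 2 * m * sum s' UNIV + 4 * m * sum n' UNIV
      + 2 * m' * sum s UNIV + 4 * (\<Sum>i\<in>UNIV. of_bool (i \<in> S \<inter> S')) + 4 * m' * sum n UNIV
      + 8 * (\<Sum>i\<in>UNIV. s i * n' i + n i * s' i + 2 * (n i * n' i))"
    by (simp only: sum.distrib sum_distrib_left [symmetric]) (simp add: card_points)
  also have "(\<Sum>i\<in>UNIV. of_bool (i \<in> S \<inter> S')) = int (card (S \<inter> S'))" by (rule sum_of_bool_mem)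
  also have "sum s UNIV = int (card S)" unfolding s_def by (rule sum_of_bool_mem)
  also have "sum s' UNIV = int (card S')" unfolding s'_def by (rule sum_of_bool_mem)
  finally have eq: "(\<Sum>i\<in>UNIV. X i * Y i) = 24 * m * m' + 2 * m * int (card S') + 4 * m * sum n' UNIV
      + 2 * m' * int (card S) + 4 * int (card (S \<inter> S')) + 4 * m' * sum n UNIV
      + 8 * (\<Sum>i\<in>UNIV. s i * n' i + n i * s' i + 2 * (n i * n' i))" .
  obtain k k' l where k: "card S = 4 * k" "card S' = 4 * k'" "card (S \<inter> S') = 2 * l"
    using four_dvd_card even_card_Int X Y by (metis dvdE)
  obtain p p' where "sum n UNIV - m = 2 * p" "sum n' UNIV - m' = 2 * p'" using X(3) Y(3) by (meson evenE)
  then have p: "sum n UNIV = m + 2 * p" "sum n' UNIV = m' + 2 * p'" by auto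
  have "(\<Sum>i\<in>UNIV. X i * Y i) = 8 * (4 * m * m' + m * int k' + m * p' + m' * int k + int l + m' * p
      + (\<Sum>i\<in>UNIV. s i * n' i + n i * s' i + 2 * (n i * n' i)))"
    unfolding eq p k by (simp add: algebra_simps)
  then show ?thesis by simp
qed

text \<open>This is evenness of the lattice: 16 becomes 2 after scaling by 1/8.\<close>

lemma leechZ_norm:
  assumes "leechZ X"
  shows "16 dvd (\<Sum>i\<in>UNIV. (X i)\<^sup>2)"
proof -
  obtain m S n where X: "S \<in> \<G>" "\<And>i. X i = m + 2 * of_bool (i \<in> S) + 4 * n i" "even (sum n UNIV - m)"
    using assms(1) unfolding leechZ_def by blast
  define s where "s = (\<lambda>i. of_bool (i \<in> S) :: int)"
  have "(X i)\<^sup>2 = m\<^sup>2 + 4 * (1 + m) * s i + 8 * m * n i + 16 * ((n i)\<^sup>2 + s i * n i)" for i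
    unfolding X(2) by (auto simp: s_def algebra_simps power2_eq_square)
  then have "(\<Sum>i\<in>UNIV. (X i)\<^sup>2) = 24 * m\<^sup>2 + 4 * (1 + m) * sum s UNIV + 8 * m * sum n UNIV
      + 16 * (\<Sum>i\<in>UNIV. (n i)\<^sup>2 + s i * n i)"
    by (simp only: sum.distrib sum_distrib_left [symmetric]) (simp add: card_points)
  also have "sum s UNIV = int (card S)" unfolding s_def by (rule sum_of_bool_mem)
  finally have eq: "(\<Sum>i\<in>UNIV. (X i)\<^sup>2) = 24 * m\<^sup>2 + 4 * (1 + m) * int (card S) + 8 * m * sum n UNIV
      + 16 * (\<Sum>i\<in>UNIV. (n i)\<^sup>2 + s i * n i)" .
  obtain k where k: "card S = 4 * k" using four_dvd_card X by blast
  obtain p where "sum n UNIV - m = 2 * p" using X(3) by blast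
  then have p: "sum n UNIV = m + 2 * p" by simp
  have "(\<Sum>i\<in>UNIV. (X i)\<^sup>2) = 16 * (2 * m\<^sup>2 + (1 + m) * int k + m * p + (\<Sum>i\<in>UNIV. (n i)\<^sup>2 + s i * n i))"
    unfolding eq p k by (simp add: algebra_simps power2_eq_square)
  then show ?thesis by simp
qed

text \<open>Odd coordinates give at least 24, raised to 32 by divisibility by 16. A nonempty S gives
  at least 8 entries of size 2. For empty S the vector is 4 n with n of even sum, so the sum of
  squares of n is even.\<close>

lemma leechZ_min_norm:
  assumes "leechZ X" "X \<noteq> (\<lambda>_. 0)"
  shows "32 \<le> (\<Sum>i\<in>UNIV. (X i)\<^sup>2)"
proof -
  let ?N = "\<Sum>i\<in>UNIV. (X i)\<^sup>2"
  obtain m S n where X: "m = 0 \<or> m = 1" "S \<in> \<G>" "\<And>i. X i = m + 2 * of_bool (i \<in> S) + 4 * n i"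
    "even (sum n UNIV - m)" using assms(1) by (rule leechZ_reduced) blast
  obtain j where "X j \<noteq> 0" using assms(2) by auto
  then have pos: "0 < ?N" by (intro sum_pos2 [of _ j]) auto
  consider "m = 1" | "m = 0" "S \<noteq> {}" | "m = 0" "S = {}" using X(1) by blast
  then show ?thesis
  proof cases
    case 1
    have "1 \<le> (X i)\<^sup>2" for i
    proof -
      have "X i \<noteq> 0" using X(3) [of i] 1 by presburger
      then show ?thesis by (simp add: zero_less_power2 int_one_le_iff_zero_less)
    qed
    then have "(\<Sum>i\<in>(UNIV :: 'n set). 1) \<le> ?N" by (intro sum_mono)
    then have "24 \<le> ?N" by (simp add: card_points)
    moreover obtain q where "?N = 16 * q" using leechZ_norm [OF assms(1)] by blast
    ultimately show ?thesis by presburger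
  next
    case 2
    have ge: "4 \<le> (X i)\<^sup>2" if "i \<in> S" for i
    proof -
      have "\<bar>X i\<bar> \<ge> 2" using X(3) [of i] 2 that by simp presburger
      then have "2\<^sup>2 \<le> \<bar>X i\<bar>\<^sup>2" by (intro power_mono) auto
      then show ?thesis by simp
    qed
    have "32 \<le> 4 * int (card S)" using min_weight [OF X(2) 2(2)] by simp
    also have "\<dots> = (\<Sum>i\<in>S. 4)" by simp
    also have "\<dots> \<le> (\<Sum>i\<in>S. (X i)\<^sup>2)" using ge by (intro sum_mono) auto
    also have "\<dots> \<le> ?N" by (intro sum_mono2) auto
    finally show ?thesis .
  next
    case 3
    have "?N = 16 * (\<Sum>i\<in>UNIV. (n i)\<^sup>2)"
      unfolding X(3) 3 by (simp add: power_mult_distrib sum_distrib_left)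
    moreover have "even (\<Sum>i\<in>UNIV. (n i)\<^sup>2)"
    proof -
      have "even (\<Sum>i\<in>UNIV. (n i)\<^sup>2 - n i)"
        by (intro dvd_sum) auto
      then show ?thesis using X(4) 3 by (simp add: sum_subtractf)
    qed
    ultimately show ?thesis using pos by presburger
  qed
qed

end

subsection \<open>The three shells of minimal vectors\<close>

lemma int_square_minus_self_nonneg: "0 \<le> (x::int)\<^sup>2 - x" and int_square_plus_self_nonneg: "0 \<le> (x::int)\<^sup>2 + x"
proof -
  have "0 \<le> x * (x - 1)" "0 \<le> x * (x + 1)" unfolding zero_le_mult_iff by linarith+
  then show "0 \<le> x\<^sup>2 - x" "0 \<le> x\<^sup>2 + x" by (simp_all add: power2_eq_square algebra_simps)
qed

lemma int_square_minus_self_eq_0: "(x::int)\<^sup>2 - x = 0 \<Longrightarrow> x = 0 \<or> x = 1"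
  by (simp add: power2_eq_square)

lemma int_square_plus_self_eq_0: "(x::int)\<^sup>2 + x = 0 \<Longrightarrow> x = 0 \<or> x = -1"
proof -
  assume "x\<^sup>2 + x = 0"
  then have "x * (x + 1) = 0" by (simp add: power2_eq_square algebra_simps)
  then show ?thesis by auto
qed

lemma int_square_plus_self_eq_2: "(x::int)\<^sup>2 + x = 2 \<Longrightarrow> x = 1 \<or> x = -2"
proof -
  assume "x\<^sup>2 + x = 2"
  then have "(x - 1) * (x + 2) = 0" by (simp add: power2_eq_square algebra_simps)
  then show ?thesis by auto
qed

lemma sum_even_eq_2:
  fixes f :: "'a \<Rightarrow> int"
  assumes "finite A" "\<And>i. i \<in> A \<Longrightarrow> 0 \<le> f i" "\<And>i. i \<in> A \<Longrightarrow> even (f i)" "sum f A = 2"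
  obtains j where "j \<in> A" "f j = 2" "\<And>i. i \<in> A - {j} \<Longrightarrow> f i = 0"
proof -
  obtain j where j: "j \<in> A" "f j \<noteq> 0" using assms(4) by (metis sum.neutral zero_neq_numeral)
  have "2 = f j + sum f (A - {j})" using assms j by (simp add: sum.remove)
  moreover have "0 \<le> sum f (A - {j})" using assms by (intro sum_nonneg) auto
  moreover have "2 \<le> f j"
  proof -
    obtain k where "f j = 2 * k" using assms(3) [OF j(1)] by blast
    then show ?thesis using assms(2) [OF j(1)] j(2) by auto
  qed
  ultimately have "f j = 2" "sum f (A - {j}) = 0" by auto
  moreover have "f i = 0" if "i \<in> A - {j}" for i
    using \<open>sum f (A - {j}) = 0\<close> assms(1,2) that by (subst (asm) sum_nonneg_eq_0_iff) auto
  ultimately show thesis using that j by blast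
qed

context pointed_golay
begin

lemma sum_UNIV_R: "sum f UNIV = f a + (f b + (f c + sum f R))" for f :: "'n \<Rightarrow> 'x::comm_monoid_add"
  by (subst UNIV_R) simp

text \<open>With the scaling by \<open>1 / sqrt 8\<close>, the inner products with \<open>w\<close>, \<open>v\<close>, \<open>u\<close> are
  \<open>p / 8\<close>, \<open>q / 2\<close>, \<open>r / 8\<close>.\<close>

definition shell :: "int \<Rightarrow> int \<Rightarrow> int \<Rightarrow> ('n \<Rightarrow> int) set" where
  "shell p q r = {X. leechZ X \<and> (\<Sum>i\<in>UNIV. (X i)\<^sup>2) = 32 \<and> sum X UNIV + 4 * X a = p \<and>
     X a + X b = q \<and> sum X UNIV - 4 * X c = r}"

text \<open>The four families have the shapes (2^8, 0^16), (2^6, (-2)^2, 0^16) with the minus signs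
  at b and c, \<plusminus>1 with one entry 3, and (-3, 1^23). The side condition b, c \<in> S,
  respectively j \<in> S, is imposed where they are used.\<close>

definition evenv :: "'n set \<Rightarrow> 'n \<Rightarrow> int" where
  "evenv S i = 2 * of_bool (i \<in> S)"

definition negv :: "'n set \<Rightarrow> 'n \<Rightarrow> int" where
  "negv S i = 2 * of_bool (i \<in> S) - 4 * of_bool (i = b) - 4 * of_bool (i = c)"

definition oddv :: "'n set \<Rightarrow> 'n \<Rightarrow> 'n \<Rightarrow> int" where
  "oddv S j i = 1 - 2 * of_bool (i \<in> S) + 4 * of_bool (i = j)"

definition minusv :: "'n \<Rightarrow> 'n \<Rightarrow> int" where
  "minusv j i = 1 - 4 * of_bool (i = j)"

lemma leechZ_cases:
  assumes "leechZ X"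
  obtains (even) H where "X = (\<lambda>i. 2 * H i)" "{i. odd (H i)} \<in> \<G>"
  | (odd) H where "X = (\<lambda>i. 1 + 2 * H i)" "{i. odd (H i)} \<in> \<G>"
proof -
  obtain m S n where X: "m = 0 \<or> m = 1" "S \<in> \<G>" "\<And>i. X i = m + 2 * of_bool (i \<in> S) + 4 * n i"
    using assms by (rule leechZ_reduced) blast
  define H where "H i = of_bool (i \<in> S) + 2 * n i" for i
  have "X = (\<lambda>i. m + 2 * H i)" using X(3) by (auto simp: H_def)
  moreover have "{i. odd (H i)} = S" by (auto simp: H_def)
  ultimately have "X = (\<lambda>i. m + 2 * H i)" "{i. odd (H i)} \<in> \<G>" using X(2) by auto
  then show thesis using X(1) that by (elim disjE) simp_all
qed

lemma card_odd:
  "int (card {i. odd (H i)}) = of_bool (odd (H a)) + of_bool (odd (H b)) + of_bool (odd (H c))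
     + (\<Sum>i\<in>R. of_bool (odd (H i)))" for H :: "'n \<Rightarrow> int"
  using sum_UNIV_R [of "\<lambda>i. of_bool (i \<in> {i. odd (H i)}) :: int"] sum_of_bool_mem [of "{i. odd (H i)}"]
  by simp

lemma not_weight_4: "S \<in> \<G> \<Longrightarrow> int (card S) \<noteq> 4"
  using min_weight [of S] by fastforce

lemma octad_if_weight_8: "S \<in> \<G> \<Longrightarrow> int (card S) = 8 \<Longrightarrow> S \<in> octads"
  by (simp add: octads_def)

lemma shell_even:
  assumes "(\<lambda>i. 2 * H i) \<in> shell p q r"
  shows "2 * H a + 2 * H b = q"
    and "10 * H a + 2 * H b + 2 * H c + 2 * sum H R = p"
    and "2 * H a + 2 * H b - 6 * H c + 2 * sum H R = r"
    and "(H a)\<^sup>2 + (H b)\<^sup>2 + (H c)\<^sup>2 + (\<Sum>i\<in>R. (H i)\<^sup>2) = 8"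
  using assms sum_UNIV_R [of H] sum_UNIV_R [of "\<lambda>i. (H i)\<^sup>2"]
  by (simp_all add: shell_def power_mult_distrib flip: sum_distrib_left)

lemma shell_odd:
  assumes "(\<lambda>i. 1 + 2 * H i) \<in> shell p q r"
  shows "2 * H a + 2 * H b + 2 = q"
    and "10 * H a + 2 * H b + 2 * H c + 2 * sum H R + 28 = p"
    and "2 * H a + 2 * H b - 6 * H c + 2 * sum H R + 20 = r"
    and "(H a)\<^sup>2 + (H b)\<^sup>2 + (H c)\<^sup>2 + (\<Sum>i\<in>R. (H i)\<^sup>2) + H a + H b + H c + sum H R = 2"
  using assms sum_UNIV_R [of H] sum_UNIV_R [of "\<lambda>i. (H i)\<^sup>2"]
  by (simp_all add: shell_def power2_sum power_mult_distrib sum.distrib card_points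
      flip: sum_distrib_left mult.assoc)

lemma all_01:
  assumes "(\<Sum>i\<in>R. (H i)\<^sup>2) - sum H R = 0" "i \<in> R"
  shows "H i = 0 \<or> H i = (1::int)"
proof -
  have "(\<Sum>i\<in>R. (H i)\<^sup>2 - H i) = 0" using assms(1) by (simp add: sum_subtractf)
  then have "(H i)\<^sup>2 - H i = 0"
    using assms(2) int_square_minus_self_nonneg by (subst (asm) sum_nonneg_eq_0_iff) auto
  then show ?thesis by (rule int_square_minus_self_eq_0)
qed

lemma all_0m1:
  assumes "(\<Sum>i\<in>R. (H i)\<^sup>2) + sum H R = 0" "i \<in> R"
  shows "H i = 0 \<or> H i = (-1::int)"
proof -
  have "(\<Sum>i\<in>R. (H i)\<^sup>2 + H i) = 0" using assms(1) by (simp add: sum.distrib)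
  then have "(H i)\<^sup>2 + H i = 0"
    using assms(2) int_square_plus_self_nonneg by (subst (asm) sum_nonneg_eq_0_iff) auto
  then show ?thesis by (rule int_square_plus_self_eq_0)
qed

lemma all_0m1_but_one:
  fixes H :: "'n \<Rightarrow> int"
  assumes "(\<Sum>i\<in>R. (H i)\<^sup>2) + sum H R = 2"
  obtains j where "j \<in> R" "H j = 1 \<or> H j = -2" "\<And>i. i \<in> R - {j} \<Longrightarrow> H i = 0 \<or> H i = -1"
proof -
  have "(\<Sum>i\<in>R. (H i)\<^sup>2 + H i) = 2" using assms by (simp add: sum.distrib)
  then obtain j where "j \<in> R" "(H j)\<^sup>2 + H j = 2" "\<And>i. i \<in> R - {j} \<Longrightarrow> (H i)\<^sup>2 + H i = 0"
    by (rule sum_even_eq_2 [rotated 3]) (auto intro: int_square_plus_self_nonneg)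
  then show thesis using that int_square_plus_self_eq_2 int_square_plus_self_eq_0 by blast
qed

lemma sum_nonneg_sq_minus: "0 \<le> (\<Sum>i\<in>R. (H i)\<^sup>2) - sum H R" for H :: "'n \<Rightarrow> int"
  using sum_nonneg [of R "\<lambda>i. (H i)\<^sup>2 - H i"] int_square_minus_self_nonneg by (simp add: sum_subtractf)

lemma sum_nonneg_sq_plus: "0 \<le> (\<Sum>i\<in>R. (H i)\<^sup>2) + sum H R" for H :: "'n \<Rightarrow> int"
  using sum_nonneg [of R "\<lambda>i. (H i)\<^sup>2 + H i"] int_square_plus_self_nonneg by (simp add: sum.distrib)

lemma sum_odd_01:
  assumes "\<And>i. i \<in> A \<Longrightarrow> H i = 0 \<or> H i = (1::int)"
  shows "(\<Sum>i\<in>A. of_bool (odd (H i))) = sum H A"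
  using assms by (intro sum.cong refl) fastforce

lemma sum_odd_0m1:
  assumes "\<And>i. i \<in> A \<Longrightarrow> H i = 0 \<or> H i = (-1::int)"
  shows "(\<Sum>i\<in>A. of_bool (odd (H i))) = - sum H A"
  unfolding sum_negf [symmetric] using assms by (intro sum.cong refl) fastforce

lemma evenv_eqI:
  assumes "\<And>i. i \<in> R \<Longrightarrow> H i = 0 \<or> H i = 1" "H a \<in> {0, 1}" "H b \<in> {0, 1}" "H c \<in> {0, 1}"
  shows "(\<lambda>i. 2 * H i) = evenv {i. odd (H i)}"
proof
  fix i
  have "i = a \<or> i = b \<or> i = c \<or> i \<in> R" by (auto simp: R_def)
  then have "H i = 0 \<or> H i = 1" using assms by auto
  then show "2 * H i = evenv {i. odd (H i)} i" by (auto simp: evenv_def)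
qed

text \<open>The linear conditions express the coordinates b, c and the sum over R by H a. The norm
  then makes a nonnegative sum over R equal to a quadratic in H a that opens downwards, so two
  values remain.\<close>

lemma shell_112_subset:
  "shell 24 2 8 \<subseteq> evenv ` fam {a, c} \<union> (\<lambda>S. oddv S a) ` fam {a, b}"
proof
  fix X assume X: "X \<in> shell 24 2 8"
  then have "leechZ X" by (simp add: shell_def)
  then show "X \<in> evenv ` fam {a, c} \<union> (\<lambda>S. oddv S a) ` fam {a, b}"
  proof (cases rule: leechZ_cases)
    case (even H)
    note s = shell_even [OF X [unfolded even(1)]]
    let ?S = "{i. odd (H i)}"
    have b: "H b = 1 - H a" and c: "H c = 2 - H a" and R: "sum H R = 9 - 3 * H a" using s by linarith+
    have sq: "(\<Sum>i\<in>R. (H i)\<^sup>2) = 3 + 6 * H a - 3 * (H a)\<^sup>2"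
      using s(4) unfolding b c by (simp add: power2_eq_square algebra_simps)
    have d: "(\<Sum>i\<in>R. (H i)\<^sup>2) - sum H R = - 3 * ((H a - 1) * (H a - 2))"
      unfolding sq R by (simp add: power2_eq_square algebra_simps)
    then have "(H a - 1) * (H a - 2) \<le> 0" using sum_nonneg_sq_minus [of H] by linarith
    then have "H a = 1 \<or> H a = 2" unfolding mult_le_0_iff by linarith
    then have z: "(\<Sum>i\<in>R. (H i)\<^sup>2) - sum H R = 0" using d by auto
    have card: "int (card ?S) = of_bool (odd (H a)) + of_bool (odd (H b)) + of_bool (odd (H c)) + sum H R"
      using card_odd [of H] sum_odd_01 [of R H, OF all_01 [OF z]] by linarith
    \<comment> \<open>The value 2 would give a codeword of weight 4.\<close>
    have "H a = 1"
      using card not_weight_4 [OF even(2)] \<open>H a = 1 \<or> H a = 2\<close> b c R by auto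
    then have "?S \<in> octads" using card b c R octad_if_weight_8 [OF even(2)] by simp
    then have "?S \<in> fam {a, c}" using \<open>H a = 1\<close> b c by (auto simp: fam_def)
    moreover have "X = evenv ?S" unfolding even(1)
      by (rule evenv_eqI) (use \<open>H a = 1\<close> b c all_01 [OF z] in auto)
    ultimately show ?thesis by blast
  next
    case (odd H)
    note s = shell_odd [OF X [unfolded odd(1)]]
    let ?S = "{i. odd (H i)}"
    have b: "H b = - H a" and c: "H c = 1 - H a" and R: "sum H R = - 3 - 3 * H a" using s by linarith+
    have sq: "(\<Sum>i\<in>R. (H i)\<^sup>2) = 3 + 6 * H a - 3 * (H a)\<^sup>2"
      using s(4) R unfolding b c by (simp add: power2_eq_square algebra_simps)
    have d: "(\<Sum>i\<in>R. (H i)\<^sup>2) + sum H R = - 3 * (H a * (H a - 1))"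
      unfolding sq R by (simp add: power2_eq_square algebra_simps)
    then have "H a * (H a - 1) \<le> 0" using sum_nonneg_sq_plus [of H] by linarith
    then have "H a = 0 \<or> H a = 1" unfolding mult_le_0_iff by linarith
    then have z: "(\<Sum>i\<in>R. (H i)\<^sup>2) + sum H R = 0" using d by auto
    have card: "int (card ?S) = of_bool (odd (H a)) + of_bool (odd (H b)) + of_bool (odd (H c)) - sum H R"
      using card_odd [of H] sum_odd_0m1 [of R H, OF all_0m1 [OF z]] by linarith
    have a1: "H a = 1"
      using card not_weight_4 [OF odd(2)] \<open>H a = 0 \<or> H a = 1\<close> b c R by auto
    then have "?S \<in> octads" using card b c R octad_if_weight_8 [OF odd(2)] by simp
    then have "?S \<in> fam {a, b}" using a1 b c by (auto simp: fam_def)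
    moreover have "X i = oddv ?S a i" for i
    proof -
      consider "i = a" | "i = b" | "i = c" | "i \<in> R" "i \<noteq> a" by (auto simp: R_def)
      then show ?thesis
        by cases (use a1 b c all_0m1 [OF z, of i] in \<open>auto simp: odd(1) oddv_def\<close>)
    qed
    ultimately show ?thesis by blast
  qed
qed

text \<open>The quadratic argument again, but for odd vectors with H a = 0 the nonnegative sum is 2
  instead of 0. One coordinate then deviates from the values 0 and -1, and this yields the vectors
  \<open>minusv\<close>.\<close>

lemma shell_162_subset:
  "shell 24 2 16 \<subseteq> evenv ` fam {a} \<union> minusv ` R \<union> (\<lambda>S. oddv S a) ` fam {a, b, c}"
proof
  fix X assume X: "X \<in> shell 24 2 16"
  then have "leechZ X" by (simp add: shell_def)
  then show "X \<in> evenv ` fam {a} \<union> minusv ` R \<union> (\<lambda>S. oddv S a) ` fam {a, b, c}"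
  proof (cases rule: leechZ_cases)
    case (even H)
    note s = shell_even [OF X [unfolded even(1)]]
    let ?S = "{i. odd (H i)}"
    have b: "H b = 1 - H a" and c: "H c = 1 - H a" and R: "sum H R = 10 - 3 * H a" using s by linarith+
    have sq: "(\<Sum>i\<in>R. (H i)\<^sup>2) = 6 + 4 * H a - 3 * (H a)\<^sup>2"
      using s(4) unfolding b c by (simp add: power2_eq_square algebra_simps)
    have d: "(\<Sum>i\<in>R. (H i)\<^sup>2) - sum H R = - ((3 * H a - 4) * (H a - 1))"
      unfolding sq R by (simp add: power2_eq_square algebra_simps)
    then have "(3 * H a - 4) * (H a - 1) \<le> 0" using sum_nonneg_sq_minus [of H] by linarith
    then have a1: "H a = 1" unfolding mult_le_0_iff by presburger
    then have z: "(\<Sum>i\<in>R. (H i)\<^sup>2) - sum H R = 0" using d by auto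
    have card: "int (card ?S) = of_bool (odd (H a)) + of_bool (odd (H b)) + of_bool (odd (H c)) + sum H R"
      using card_odd [of H] sum_odd_01 [of R H, OF all_01 [OF z]] by linarith
    have "?S \<in> octads" using a1 card b c R octad_if_weight_8 [OF even(2)] by simp
    then have "?S \<in> fam {a}" using a1 b c by (auto simp: fam_def)
    moreover have "X = evenv ?S" unfolding even(1)
      by (rule evenv_eqI) (use a1 b c all_01 [OF z] in auto)
    ultimately show ?thesis by blast
  next
    case (odd H)
    note s = shell_odd [OF X [unfolded odd(1)]]
    let ?S = "{i. odd (H i)}"
    have b: "H b = - H a" and c: "H c = - H a" and R: "sum H R = - 2 - 3 * H a" using s by linarith+
    have sq: "(\<Sum>i\<in>R. (H i)\<^sup>2) = 4 + 4 * H a - 3 * (H a)\<^sup>2"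
      using s(4) R unfolding b c by (simp add: power2_eq_square algebra_simps)
    have d: "(\<Sum>i\<in>R. (H i)\<^sup>2) + sum H R = - ((3 * H a + 2) * (H a - 1))"
      unfolding sq R by (simp add: power2_eq_square algebra_simps)
    then have "(3 * H a + 2) * (H a - 1) \<le> 0" using sum_nonneg_sq_plus [of H] by linarith
    then consider "H a = 0" | "H a = 1" unfolding mult_le_0_iff by linarith
    then show ?thesis
    proof cases
      case 1
      then have "(\<Sum>i\<in>R. (H i)\<^sup>2) + sum H R = 2" using d by simp
      then obtain j where j: "j \<in> R" "H j = 1 \<or> H j = -2" "\<And>i. i \<in> R - {j} \<Longrightarrow> H i = 0 \<or> H i = -1"
        by (rule all_0m1_but_one) blast
      have sumR: "sum f R = f j + sum f (R - {j})" for f :: "'n \<Rightarrow> int" using j by (simp add: sum.remove)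
      have card: "int (card ?S) = of_bool (odd (H j)) - sum H (R - {j})"
        using card_odd [of H] sumR [of "\<lambda>i. of_bool (odd (H i))"] sum_odd_0m1 [of "R - {j}" H, OF j(3)]
        unfolding 1 b c by simp
      \<comment> \<open>The deviating value 1 would give a codeword of weight 4; the value -2 gives
        weight 0.\<close>
      have "H j \<noteq> 1" using card not_weight_4 [OF odd(2)] R 1 sumR [of H] by auto
      then have j2: "H j = -2" using j(2) by blast
      then have "card ?S = 0" using card R 1 sumR [of H] by simp
      then have "even (H i)" for i by auto
      then have "H i = 0" if "i \<in> R - {j}" for i using j(3) [OF that] by (metis dvd_minus_iff odd_one)
      then have "X i = minusv j i" for i
        using j j2 1 b c by (cases "i \<in> R") (auto simp: odd(1) minusv_def R_def)
      then show ?thesis using j by blast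
    next
      case 2
      then have z: "(\<Sum>i\<in>R. (H i)\<^sup>2) + sum H R = 0" using d by auto
      have card: "int (card ?S) = of_bool (odd (H a)) + of_bool (odd (H b)) + of_bool (odd (H c)) - sum H R"
      using card_odd [of H] sum_odd_0m1 [of R H, OF all_0m1 [OF z]] by linarith
      have "?S \<in> octads" using 2 card b c R octad_if_weight_8 [OF odd(2)] by simp
      then have "?S \<in> fam {a, b, c}" using 2 b c by (auto simp: fam_def)
      moreover have "X i = oddv ?S a i" for i
      proof -
        consider "i = a" | "i = b" | "i = c" | "i \<in> R" "i \<noteq> a" by (auto simp: R_def)
        then show ?thesis
          by cases (use 2 b c all_0m1 [OF z, of i] in \<open>auto simp: odd(1) oddv_def\<close>)
      qed
      ultimately show ?thesis by blast
    qed
  qed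
qed

text \<open>Here the case of one deviating coordinate leads to the vectors with entry 3 outside a,
  b, c, and H a = -2 leaves the single vector \<open>minusv a\<close>.\<close>

lemma shell_162b_subset:
  "shell 8 (-2) 16 \<subseteq> negv ` fam {b, c} \<union> (\<lambda>(S, j). oddv S j) ` (SIGMA S:fam {a, b, c}. S \<inter> R) \<union> {minusv a}"
proof
  fix X assume X: "X \<in> shell 8 (-2) 16"
  then have "leechZ X" by (simp add: shell_def)
  then show "X \<in> negv ` fam {b, c} \<union> (\<lambda>(S, j). oddv S j) ` (SIGMA S:fam {a, b, c}. S \<inter> R) \<union> {minusv a}"
  proof (cases rule: leechZ_cases)
    case (even H)
    note s = shell_even [OF X [unfolded even(1)]]
    let ?S = "{i. odd (H i)}"
    have b: "H b = - 1 - H a" and c: "H c = - 1 - H a" and R: "sum H R = 6 - 3 * H a" using s by linarith+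
    have sq: "(\<Sum>i\<in>R. (H i)\<^sup>2) = 6 - 4 * H a - 3 * (H a)\<^sup>2"
      using s(4) unfolding b c by (simp add: power2_eq_square algebra_simps)
    have d: "(\<Sum>i\<in>R. (H i)\<^sup>2) - sum H R = - (H a * (3 * H a + 1))"
      unfolding sq R by (simp add: power2_eq_square algebra_simps)
    then have "H a * (3 * H a + 1) \<le> 0" using sum_nonneg_sq_minus [of H] by linarith
    then have a0: "H a = 0" unfolding mult_le_0_iff by presburger
    then have z: "(\<Sum>i\<in>R. (H i)\<^sup>2) - sum H R = 0" using d by auto
    have card: "int (card ?S) = of_bool (odd (H a)) + of_bool (odd (H b)) + of_bool (odd (H c)) + sum H R"
      using card_odd [of H] sum_odd_01 [of R H, OF all_01 [OF z]] by linarith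
    have "?S \<in> octads" using a0 card b c R octad_if_weight_8 [OF even(2)] by simp
    then have "?S \<in> fam {b, c}" using a0 b c by (auto simp: fam_def)
    moreover have "X i = negv ?S i" for i
    proof -
      consider "i = a" | "i = b" | "i = c" | "i \<in> R" "i \<noteq> b" "i \<noteq> c" by (auto simp: R_def)
      then show ?thesis
        by cases (use a0 b c all_01 [OF z, of i] in \<open>auto simp: even(1) negv_def\<close>)
    qed
    ultimately show ?thesis by blast
  next
    case (odd H)
    note s = shell_odd [OF X [unfolded odd(1)]]
    let ?S = "{i. odd (H i)}"
    have b: "H b = - 2 - H a" and c: "H c = - 2 - H a" and R: "sum H R = - 6 - 3 * H a" using s by linarith+
    have sq: "(\<Sum>i\<in>R. (H i)\<^sup>2) = 4 - 4 * H a - 3 * (H a)\<^sup>2"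
      using s(4) R unfolding b c by (simp add: power2_eq_square algebra_simps)
    have d: "(\<Sum>i\<in>R. (H i)\<^sup>2) + sum H R = - ((3 * H a + 1) * (H a + 2))"
      unfolding sq R by (simp add: power2_eq_square algebra_simps)
    then have "(3 * H a + 1) * (H a + 2) \<le> 0" using sum_nonneg_sq_plus [of H] by linarith
    then consider "H a = -1" | "H a = -2" unfolding mult_le_0_iff by linarith
    then show ?thesis
    proof cases
      case 1
      then have "(\<Sum>i\<in>R. (H i)\<^sup>2) + sum H R = 2" using d by simp
      then obtain j where j: "j \<in> R" "H j = 1 \<or> H j = -2" "\<And>i. i \<in> R - {j} \<Longrightarrow> H i = 0 \<or> H i = -1"
        by (rule all_0m1_but_one) blast
      have sumR: "sum f R = f j + sum f (R - {j})" for f :: "'n \<Rightarrow> int" using j by (simp add: sum.remove)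
      have card: "int (card ?S) = 3 + of_bool (odd (H j)) - sum H (R - {j})"
        using card_odd [of H] sumR [of "\<lambda>i. of_bool (odd (H i))"] sum_odd_0m1 [of "R - {j}" H, OF j(3)]
        unfolding 1 b c by simp
      have "H j \<noteq> -2" using card not_weight_4 [OF odd(2)] R 1 sumR [of H] by auto
      then have j1: "H j = 1" using j(2) by blast
      then have "?S \<in> octads" using 1 card R sumR [of H] octad_if_weight_8 [OF odd(2)] by simp
      then have "?S \<in> fam {a, b, c}" using 1 b c by (auto simp: fam_def)
      moreover have "j \<in> ?S \<inter> R" using j j1 by simp
      moreover have "X i = oddv ?S j i" for i
      proof -
        consider "i = j" | "i = a" "i \<noteq> j" | "i = b" "i \<noteq> j" | "i = c" "i \<noteq> j" | "i \<in> R - {j}"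
          by (auto simp: R_def)
        then show ?thesis
          by cases (use 1 b c j1 j(3) [of i] in \<open>auto simp: odd(1) oddv_def\<close>)
      qed
      then have "X = (\<lambda>(S, j). oddv S j) (?S, j)" by auto
      ultimately show ?thesis by blast
    next
      case 2
      then have z: "(\<Sum>i\<in>R. (H i)\<^sup>2) + sum H R = 0" using d by auto
      have card: "int (card ?S) = of_bool (odd (H a)) + of_bool (odd (H b)) + of_bool (odd (H c)) - sum H R"
      using card_odd [of H] sum_odd_0m1 [of R H, OF all_0m1 [OF z]] by linarith
      have "card ?S = 0" using 2 card b c R by simp
      then have "even (H i)" for i by auto
      then have "H i = 0" if "i \<in> R" for i using all_0m1 [OF z that] by (metis dvd_minus_iff odd_one)
      then have "X i = minusv a i" for i
        using 2 b c by (cases "i \<in> R") (auto simp: odd(1) minusv_def R_def)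
      then show ?thesis by blast
    qed
  qed
qed

section \<open>Coordinate sums and norms of the explicit vectors\<close>

lemma sum_of_bool_eq_point: "(\<Sum>i\<in>UNIV. of_bool (i = j)) = (1 :: 'x::semiring_1)" for j :: 'n
  by (simp add: of_bool_def)

lemma sum_evenv: "sum (evenv S) UNIV = 2 * int (card S)"
  unfolding evenv_def by (simp only: sum_distrib_left [symmetric] sum_of_bool_mem)

lemma sum_negv: "sum (negv S) UNIV = 2 * int (card S) - 8"
  unfolding negv_def
  by (simp only: sum_subtractf sum_distrib_left [symmetric] sum_of_bool_mem sum_of_bool_eq_point)

lemma sum_oddv: "sum (oddv S j) UNIV = 28 - 2 * int (card S)"
  unfolding oddv_def
  by (simp only: sum.distrib sum_subtractf sum_distrib_left [symmetric] sum_of_bool_mem sum_of_bool_eq_point)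
    (simp add: card_points)

lemma sum_minusv: "sum (minusv j) UNIV = 20"
  unfolding minusv_def
  by (simp only: sum_subtractf sum_distrib_left [symmetric] sum_of_bool_eq_point) (simp add: card_points)

lemma norm_evenv: "(\<Sum>i\<in>UNIV. (evenv S i)\<^sup>2) = 4 * int (card S)"
proof -
  have "(evenv S i)\<^sup>2 = 4 * of_bool (i \<in> S)" for i by (auto simp: evenv_def)
  then show ?thesis by (simp only: sum_distrib_left [symmetric] sum_of_bool_mem)
qed

lemma norm_negv: "b \<in> S \<Longrightarrow> c \<in> S \<Longrightarrow> (\<Sum>i\<in>UNIV. (negv S i)\<^sup>2) = 4 * int (card S)"
proof -
  assume "b \<in> S" "c \<in> S"
  then have "(negv S i)\<^sup>2 = 4 * of_bool (i \<in> S)" for i by (auto simp: negv_def)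
  then show ?thesis by (simp only: sum_distrib_left [symmetric] sum_of_bool_mem)
qed

lemma norm_oddv: "j \<in> S \<Longrightarrow> (\<Sum>i\<in>UNIV. (oddv S j i)\<^sup>2) = 32"
proof -
  assume "j \<in> S"
  then have "(oddv S j i)\<^sup>2 = 1 + 8 * of_bool (i = j)" for i by (auto simp: oddv_def)
  then show ?thesis
    by (simp only: sum.distrib sum_distrib_left [symmetric] sum_of_bool_eq_point) (simp add: card_points)
qed

lemma norm_minusv: "(\<Sum>i\<in>UNIV. (minusv j i)\<^sup>2) = 32"
proof -
  have "(minusv j i)\<^sup>2 = 1 + 8 * of_bool (i = j)" for i by (auto simp: minusv_def)
  then show ?thesis
    by (simp only: sum.distrib sum_distrib_left [symmetric] sum_of_bool_eq_point) (simp add: card_points)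
qed

lemma leechZ_evenv: "S \<in> \<G> \<Longrightarrow> leechZ (evenv S)"
  by (rule leechZ_I [of S _ 0 "\<lambda>_. 0"]) (auto simp: evenv_def)

lemma leechZ_negv: "S \<in> \<G> \<Longrightarrow> leechZ (negv S)"
proof (rule leechZ_I [of S _ 0 "\<lambda>i. - of_bool (i = b) - of_bool (i = c)"])
  have "(\<Sum>i\<in>UNIV. - of_bool (i = b) - of_bool (i = c)) = (-2 :: int)"
    by (simp only: sum_subtractf sum_negf sum_of_bool_eq_point)
  then show "even ((\<Sum>i\<in>UNIV. - of_bool (i = b) - of_bool (i = c)) - (0::int))" by simp
qed (auto simp: negv_def)

lemma leechZ_oddv: "S \<in> \<G> \<Longrightarrow> leechZ (oddv S j)"
proof (rule leechZ_I [of S _ 1 "\<lambda>i. of_bool (i = j) - of_bool (i \<in> S)"])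
  assume S: "S \<in> \<G>"
  have "(\<Sum>i\<in>UNIV. of_bool (i = j) - of_bool (i \<in> S)) = 1 - int (card S)"
    by (simp only: sum_subtractf sum_of_bool_eq_point sum_of_bool_mem)
  then show "even ((\<Sum>i\<in>UNIV. of_bool (i = j) - of_bool (i \<in> S)) - (1::int))"
    using even_card_Int [OF S S] by simp
qed (auto simp: oddv_def)

lemma leechZ_minusv: "leechZ (minusv j)"
proof (rule leechZ_I [of "{}" _ 1 "\<lambda>i. - of_bool (i = j)"])
  have "(\<Sum>i\<in>UNIV. - of_bool (i = j)) = (- 1::int)"
    by (simp only: sum_negf sum_of_bool_eq_point)
  then show "even ((\<Sum>i\<in>UNIV. - of_bool (i = j)) - (1::int))" by simp
qed (auto simp: minusv_def empty_in_G)

lemma fam_mem: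
  assumes "S \<in> fam P"
  shows "S \<in> \<G>" "card S = 8" "a \<in> S \<longleftrightarrow> a \<in> P" "b \<in> S \<longleftrightarrow> b \<in> P" "c \<in> S \<longleftrightarrow> c \<in> P"
  using assms by (auto simp: fam_def octads_def)

lemma shell_112: "shell 24 2 8 = evenv ` fam {a, c} \<union> (\<lambda>S. oddv S a) ` fam {a, b}"
proof (rule antisym [OF shell_112_subset], intro subsetI)
  fix X assume "X \<in> evenv ` fam {a, c} \<union> (\<lambda>S. oddv S a) ` fam {a, b}"
  then consider S where "S \<in> fam {a, c}" "X = evenv S" | S where "S \<in> fam {a, b}" "X = oddv S a" by blast
  then show "X \<in> shell 24 2 8"
  proof cases
    case 1
    show ?thesis unfolding shell_def
      using 1 fam_mem [OF 1(1)] by (auto simp: leechZ_evenv sum_evenv norm_evenv) (auto simp: evenv_def)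
  next
    case 2
    show ?thesis unfolding shell_def
      using 2 fam_mem [OF 2(1)] by (auto simp: leechZ_oddv sum_oddv norm_oddv) (auto simp: oddv_def)
  qed
qed

lemma shell_162: "shell 24 2 16 = evenv ` fam {a} \<union> minusv ` R \<union> (\<lambda>S. oddv S a) ` fam {a, b, c}"
proof (rule antisym [OF shell_162_subset], intro subsetI)
  fix X assume "X \<in> evenv ` fam {a} \<union> minusv ` R \<union> (\<lambda>S. oddv S a) ` fam {a, b, c}"
  then consider S where "S \<in> fam {a}" "X = evenv S" | j where "j \<in> R" "X = minusv j"
    | S where "S \<in> fam {a, b, c}" "X = oddv S a" by blast
  then show "X \<in> shell 24 2 16"
  proof cases
    case 1
    show ?thesis unfolding shell_def
      using 1 fam_mem [OF 1(1)] by (auto simp: leechZ_evenv sum_evenv norm_evenv) (auto simp: evenv_def)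
  next
    case 2
    show ?thesis unfolding shell_def
      using 2 by (auto simp: leechZ_minusv sum_minusv norm_minusv) (auto simp: minusv_def R_def)
  next
    case 3
    show ?thesis unfolding shell_def
      using 3 fam_mem [OF 3(1)] by (auto simp: leechZ_oddv sum_oddv norm_oddv) (auto simp: oddv_def)
  qed
qed

lemma shell_162b:
  "shell 8 (-2) 16 = negv ` fam {b, c} \<union> (\<lambda>(S, j). oddv S j) ` (SIGMA S:fam {a, b, c}. S \<inter> R) \<union> {minusv a}"
proof (rule antisym [OF shell_162b_subset], intro subsetI)
  fix X assume "X \<in> negv ` fam {b, c} \<union> (\<lambda>(S, j). oddv S j) ` (SIGMA S:fam {a, b, c}. S \<inter> R) \<union> {minusv a}"
  then show "X \<in> shell 8 (-2) 16"
  proof (elim UnE)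
    assume "X \<in> negv ` fam {b, c}"
    then obtain S where 1: "S \<in> fam {b, c}" "X = negv S" by blast
    show ?thesis unfolding shell_def
      using 1 fam_mem [OF 1(1)] by (auto simp: leechZ_negv sum_negv norm_negv) (auto simp: negv_def)
  next
    assume 2: "X \<in> {minusv a}"
    show ?thesis unfolding shell_def
      using 2 by (auto simp: leechZ_minusv sum_minusv norm_minusv) (auto simp: minusv_def)
  next
    assume "X \<in> (\<lambda>(S, j). oddv S j) ` (SIGMA S:fam {a, b, c}. S \<inter> R)"
    then obtain S j where 3: "S \<in> fam {a, b, c}" "j \<in> S" "j \<in> R" "X = oddv S j" by auto
    then have "a \<noteq> j" "b \<noteq> j" "c \<noteq> j" by (auto simp: R_def)
    then show ?thesis unfolding shell_def
      using 3 fam_mem [OF 3(1)] by (auto simp: leechZ_oddv sum_oddv norm_oddv) (auto simp: oddv_def)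
  qed
qed

lemma inj_evenv: "inj evenv"
proof (rule injI)
  fix S T assume eq: "evenv S = evenv T"
  have "i \<in> S \<longleftrightarrow> i \<in> T" for i
    using fun_cong [OF eq, of i] by (auto simp: evenv_def of_bool_def split: if_splits)
  then show "S = T" by blast
qed

lemma inj_negv: "inj negv"
proof (rule injI)
  fix S T assume eq: "negv S = negv T"
  have "i \<in> S \<longleftrightarrow> i \<in> T" for i
    using fun_cong [OF eq, of i] by (auto simp: negv_def of_bool_def split: if_splits)
  then show "S = T" by blast
qed

lemma oddv_eqD: "oddv S j = oddv T j \<Longrightarrow> S = T"
proof -
  assume eq: "oddv S j = oddv T j"
  have "i \<in> S \<longleftrightarrow> i \<in> T" for i
    using fun_cong [OF eq, of i] by (auto simp: oddv_def of_bool_def split: if_splits)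
  then show "S = T" by blast
qed

lemma oddv_eqD2: "oddv S j = oddv T k \<Longrightarrow> j \<in> S \<Longrightarrow> k \<in> T \<Longrightarrow> S = T \<and> j = k"
proof -
  assume eq: "oddv S j = oddv T k" and "j \<in> S" "k \<in> T"
  then have "oddv T k j = 3" by (simp add: oddv_def flip: eq)
  then have "j = k" by (auto simp: oddv_def of_bool_def split: if_splits)
  then show ?thesis using eq oddv_eqD by blast
qed

lemma inj_minusv: "inj minusv"
proof (rule injI)
  fix j k assume "minusv j = minusv k"
  then have "minusv j j = minusv k j" by simp
  then show "j = k" by (auto simp: minusv_def of_bool_def split: if_splits)
qed

lemma even_evenv: "even (evenv S i)" and odd_oddv: "odd (oddv S j i)" and odd_minusv: "odd (minusv j i)"
  and even_negv: "even (negv S i)"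
  by (simp_all add: evenv_def oddv_def minusv_def negv_def)

section \<open>Summation over the shells\<close>

lemma sum_shell_112:
  "sum f (shell 24 2 8) = (\<Sum>S\<in>fam {a, c}. f (evenv S)) + (\<Sum>S\<in>fam {a, b}. f (oddv S a))"
  for f :: "_ \<Rightarrow> real"
proof -
  have "evenv S \<noteq> oddv T a" for S T using even_evenv odd_oddv by metis
  then have "evenv ` fam {a, c} \<inter> (\<lambda>S. oddv S a) ` fam {a, b} = {}" by blast
  moreover have "inj_on evenv (fam {a, c})" "inj_on (\<lambda>S. oddv S a) (fam {a, b})"
    using inj_evenv by (auto simp: inj_on_def dest: oddv_eqD)
  ultimately show ?thesis unfolding shell_112 by (simp add: sum.union_disjoint sum.reindex)
qed

lemma sum_shell_162:
  "sum f (shell 24 2 16) = (\<Sum>S\<in>fam {a}. f (evenv S)) + (\<Sum>j\<in>R. f (minusv j))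
     + (\<Sum>S\<in>fam {a, b, c}. f (oddv S a))"
  for f :: "_ \<Rightarrow> real"
proof -
  have "evenv S \<noteq> oddv T a" "evenv S \<noteq> minusv j" for S T j using even_evenv odd_oddv odd_minusv by metis+
  moreover have "minusv j \<noteq> oddv S a" if "j \<in> R" "S \<in> fam {a, b, c}" for j S
  proof
    assume "minusv j = oddv S a"
    then have "minusv j b = oddv S a b" by simp
    then show False using that fam_mem [OF that(2)] by (auto simp: minusv_def oddv_def R_def)
  qed
  ultimately have "evenv ` fam {a} \<inter> minusv ` R = {}"
      "(evenv ` fam {a} \<union> minusv ` R) \<inter> (\<lambda>S. oddv S a) ` fam {a, b, c} = {}" by blast+
  moreover have "inj_on evenv (fam {a})" "inj_on (\<lambda>S. oddv S a) (fam {a, b, c})" "inj_on minusv R"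
    using inj_evenv inj_minusv by (auto simp: inj_on_def dest: oddv_eqD)
  ultimately show ?thesis unfolding shell_162 by (simp add: sum.union_disjoint sum.reindex)
qed

lemma sum_shell_162b:
  "sum f (shell 8 (-2) 16) = (\<Sum>S\<in>fam {b, c}. f (negv S)) + (\<Sum>S\<in>fam {a, b, c}. \<Sum>j\<in>S \<inter> R. f (oddv S j))
     + f (minusv a)"
  for f :: "_ \<Rightarrow> real"
proof -
  let ?P = "SIGMA S:fam {a, b, c}. S \<inter> R"
  have "negv S \<noteq> oddv T j" "negv S \<noteq> minusv j" for S T j using even_negv odd_oddv odd_minusv by metis+
  note neq = this
  have neq2: "minusv a \<noteq> oddv S j" if "j \<in> R" "S \<in> fam {a, b, c}" for j S
  proof
    assume "minusv a = oddv S j"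
    then have "minusv a a = oddv S j a" by simp
    then show False using that fam_mem [OF that(2)] by (auto simp: minusv_def oddv_def R_def)
  qed
  have "negv ` fam {b, c} \<inter> (\<lambda>(S, j). oddv S j) ` ?P = {}"
    using neq(1) by auto
  moreover have "minusv a \<notin> negv ` fam {b, c}" using neq(2) by (metis imageE)
  moreover have "minusv a \<notin> (\<lambda>(S, j). oddv S j) ` ?P" using neq2 by auto
  moreover have "inj_on negv (fam {b, c})" "inj_on (\<lambda>(S, j). oddv S j) ?P"
    using inj_negv by (auto simp: inj_on_def dest: oddv_eqD2)
  ultimately show ?thesis unfolding shell_162b
    by (simp add: sum.union_disjoint sum.reindex sum.Sigma split_def)
qed

end

subsection \<open>Moments of the shells on the orthogonal complement\<close>

lemma sum_power2_expand:
  fixes f :: "'a \<Rightarrow> real"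
  shows "(sum f A)\<^sup>2 = (\<Sum>i\<in>A. \<Sum>j\<in>A. f i * f j)"
  by (simp add: power2_eq_square sum_product)

lemma sum_power3_expand:
  fixes f :: "'a \<Rightarrow> real"
  shows "(sum f A) ^ 3 = (\<Sum>i\<in>A. \<Sum>j\<in>A. \<Sum>k\<in>A. f i * f j * f k)"
proof -
  have "(sum f A) ^ 3 = (\<Sum>i\<in>A. \<Sum>j\<in>A. f i * f j) * sum f A"
    by (simp only: power3_eq_cube sum_product)
  also have "\<dots> = (\<Sum>i\<in>A. \<Sum>j\<in>A. (f i * f j) * sum f A)" by (simp only: sum_distrib_right)
  finally show ?thesis by (simp only: sum_distrib_left)
qed

lemma sum_pairs_diagonal:
  fixes x :: "'a \<Rightarrow> real"
  assumes "finite A"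
  shows "(\<Sum>i\<in>A. \<Sum>j\<in>A. x i * x j * (if i = j then p else q)) = (p - q) * (\<Sum>i\<in>A. (x i)\<^sup>2) + q * (sum x A)\<^sup>2"
proof -
  have "(\<Sum>i\<in>A. \<Sum>j\<in>A. x i * x j * (if i = j then p else q))
      = (\<Sum>i\<in>A. \<Sum>j\<in>A. q * (x i * x j) + (if i = j then (p - q) * (x i * x j) else 0))"
    by (intro sum.cong refl) (simp add: algebra_simps)
  also have "\<dots> = q * (\<Sum>i\<in>A. \<Sum>j\<in>A. x i * x j) + (p - q) * (\<Sum>i\<in>A. (x i)\<^sup>2)"
    using assms by (simp add: sum.distrib sum_distrib_left power2_eq_square)
  finally show ?thesis by (simp add: sum_power2_expand)
qed

text \<open>The weight depends only on the number of distinct indices. Start with d3 everywhere,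
  correct by d2 - d3 for each of three coincidences, then fix the full diagonal by d1 - 3 d2 + 2
  d3.\<close>

lemma sum_triples_diagonal:
  fixes x :: "'a \<Rightarrow> real"
  assumes "finite A" and d: "d (Suc 0) = d1" "d 2 = d2" "d 3 = d3"
  shows "(\<Sum>i\<in>A. \<Sum>j\<in>A. \<Sum>k\<in>A. x i * x j * x k * d (card {i, j, k}))
    = d3 * (sum x A) ^ 3 + 3 * (d2 - d3) * (sum x A * (\<Sum>i\<in>A. (x i)\<^sup>2))
      + (d1 - 3 * d2 + 2 * d3) * (\<Sum>i\<in>A. (x i) ^ 3)"
proof -
  let ?s = "sum x A" and ?q = "\<Sum>i\<in>A. (x i)\<^sup>2" and ?c = "\<Sum>i\<in>A. (x i) ^ 3"
  have "x i * x j * x k * d (card {i, j, k}) = d3 * (x i * x j * x k)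
      + (d2 - d3) * (if i = j then x i * x j * x k else 0)
      + (d2 - d3) * (if j = k then x i * x j * x k else 0)
      + (d2 - d3) * (if i = k then x i * x j * x k else 0)
      + (d1 - 3 * d2 + 2 * d3) * (if i = j then if j = k then x i * x j * x k else 0 else 0)" for i j k
    using d by (cases "i = j"; cases "j = k"; cases "i = k")
      (auto simp: algebra_simps numeral_2_eq_2 numeral_3_eq_3 card_insert_if)
  then have "(\<Sum>i\<in>A. \<Sum>j\<in>A. \<Sum>k\<in>A. x i * x j * x k * d (card {i, j, k}))
    = d3 * (\<Sum>i\<in>A. \<Sum>j\<in>A. \<Sum>k\<in>A. x i * x j * x k)
      + (d2 - d3) * (\<Sum>i\<in>A. \<Sum>j\<in>A. \<Sum>k\<in>A. if i = j then x i * x j * x k else 0)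
      + (d2 - d3) * (\<Sum>i\<in>A. \<Sum>j\<in>A. \<Sum>k\<in>A. if j = k then x i * x j * x k else 0)
      + (d2 - d3) * (\<Sum>i\<in>A. \<Sum>j\<in>A. \<Sum>k\<in>A. if i = k then x i * x j * x k else 0)
      + (d1 - 3 * d2 + 2 * d3) * (\<Sum>i\<in>A. \<Sum>j\<in>A. \<Sum>k\<in>A. if i = j then if j = k then x i * x j * x k else 0 else 0)"
    by (simp only: sum.distrib sum_distrib_left [symmetric])
  also have "(\<Sum>i\<in>A. \<Sum>j\<in>A. \<Sum>k\<in>A. x i * x j * x k) = ?s ^ 3" by (rule sum_power3_expand [symmetric])
  also have "(\<Sum>i\<in>A. \<Sum>j\<in>A. \<Sum>k\<in>A. if i = j then x i * x j * x k else 0) = ?s * ?q"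
  proof -
    have "(\<Sum>j\<in>A. \<Sum>k\<in>A. if i = j then x i * x j * x k else 0) = (x i)\<^sup>2 * ?s" if "i \<in> A" for i
    proof -
      have "(\<Sum>j\<in>A. \<Sum>k\<in>A. if i = j then x i * x j * x k else 0) = (\<Sum>j\<in>A. if i = j then \<Sum>k\<in>A. x i * x j * x k else 0)"
        by (intro sum.cong refl) auto
      then show ?thesis using that assms by (simp add: sum_distrib_left power2_eq_square)
    qed
    then show ?thesis by (simp add: sum_distrib_left mult.commute)
  qed
  also have "(\<Sum>i\<in>A. \<Sum>j\<in>A. \<Sum>k\<in>A. if j = k then x i * x j * x k else 0) = ?s * ?q"
    using assms by (simp add: sum_product power2_eq_square mult.assoc)
  also have "(\<Sum>i\<in>A. \<Sum>j\<in>A. \<Sum>k\<in>A. if i = k then x i * x j * x k else 0) = ?s * ?q"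
  proof -
    have "(\<Sum>i\<in>A. \<Sum>j\<in>A. \<Sum>k\<in>A. if i = k then x i * x j * x k else 0) = (\<Sum>i\<in>A. \<Sum>j\<in>A. x i * x j * x i)"
      using assms by simp
    also have "\<dots> = (\<Sum>j\<in>A. \<Sum>i\<in>A. x j * (x i)\<^sup>2)"
      by (subst sum.swap) (simp add: power2_eq_square mult_ac)
    finally show ?thesis by (simp add: sum_product)
  qed
  also have "(\<Sum>i\<in>A. \<Sum>j\<in>A. \<Sum>k\<in>A. if i = j then if j = k then x i * x j * x k else 0 else 0) = ?c"
  proof -
    have "(\<Sum>j\<in>A. \<Sum>k\<in>A. if i = j then if j = k then x i * x j * x k else 0 else 0) = (x i) ^ 3" if "i \<in> A" for i
    proof -
      have "(\<Sum>j\<in>A. \<Sum>k\<in>A. if i = j then if j = k then x i * x j * x k else 0 else 0)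
          = (\<Sum>j\<in>A. if i = j then \<Sum>k\<in>A. if j = k then x i * x j * x k else 0 else 0)"
        by (intro sum.cong refl) auto
      then show ?thesis using that assms by (simp add: power3_eq_cube)
    qed
    then show ?thesis by simp
  qed
  finally show ?thesis by (simp add: algebra_simps)
qed

context pointed_golay
begin

definition dotr :: "('n \<Rightarrow> int) \<Rightarrow> ('n \<Rightarrow> real) \<Rightarrow> real" where
  "dotr X x = (\<Sum>i\<in>UNIV. real_of_int (X i) * x i)"

text \<open>The orthogonality relations to \<open>u\<close>, \<open>v\<close>, \<open>w\<close>, solved for the three special coordinates.\<close>

definition perp :: "('n \<Rightarrow> real) \<Rightarrow> bool" where
  "perp x \<longleftrightarrow> x b = - x a \<and> x c = - x a \<and> sum x R = - 3 * x a"

lemma sum_fam_indicator: "sum x (R \<inter> S) = (\<Sum>i\<in>R. x i * of_bool (i \<in> S))" for x :: "'n \<Rightarrow> real"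
  by (simp add: sum.inter_restrict of_bool_def if_distrib cong: if_cong)

lemma sum_of_bool_fam: "(\<Sum>S\<in>fam P. of_bool (T \<subseteq> S)) = cnt P T"
  by (simp add: cnt_def sum_of_bool_eq Int_def)

lemma sum_fam_0: "(\<Sum>S\<in>fam P. 1) = cnt P {}"
  by (simp add: cnt_def)

lemma sum_fam_1: "(\<Sum>S\<in>fam P. sum x (R \<inter> S)) = (\<Sum>i\<in>R. x i * cnt P {i})" for x :: "'n \<Rightarrow> real"
proof -
  have "(\<Sum>S\<in>fam P. sum x (R \<inter> S)) = (\<Sum>S\<in>fam P. \<Sum>i\<in>R. x i * of_bool ({i} \<subseteq> S))"
    by (simp only: sum_fam_indicator insert_subset empty_subsetI simp_thms)
  also have "\<dots> = (\<Sum>i\<in>R. \<Sum>S\<in>fam P. x i * of_bool ({i} \<subseteq> S))" by (rule sum.swap)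
  finally show ?thesis by (simp only: sum_distrib_left [symmetric] sum_of_bool_fam)
qed

text \<open>Expanding the square and exchanging the sums reduces moments of octad sums to octad
  counts.\<close>

lemma sum_fam_2: "(\<Sum>S\<in>fam P. (sum x (R \<inter> S))\<^sup>2) = (\<Sum>i\<in>R. \<Sum>j\<in>R. x i * x j * cnt P {i, j})" for x :: "'n \<Rightarrow> real"
proof -
  have "(\<Sum>S\<in>fam P. (sum x (R \<inter> S))\<^sup>2) = (\<Sum>S\<in>fam P. \<Sum>i\<in>R. \<Sum>j\<in>R. x i * x j * of_bool ({i, j} \<subseteq> S))"
    unfolding sum_fam_indicator sum_power2_expand by (intro sum.cong refl) auto
  also have "\<dots> = (\<Sum>i\<in>R. \<Sum>S\<in>fam P. \<Sum>j\<in>R. x i * x j * of_bool ({i, j} \<subseteq> S))" by (rule sum.swap)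
  also have "\<dots> = (\<Sum>i\<in>R. \<Sum>j\<in>R. \<Sum>S\<in>fam P. x i * x j * of_bool ({i, j} \<subseteq> S))"
    by (intro sum.cong refl sum.swap)
  finally show ?thesis by (simp only: sum_distrib_left [symmetric] sum_of_bool_fam)
qed

lemma sum_fam_3: "(\<Sum>S\<in>fam P. (sum x (R \<inter> S)) ^ 3) = (\<Sum>i\<in>R. \<Sum>j\<in>R. \<Sum>k\<in>R. x i * x j * x k * cnt P {i, j, k})" for x :: "'n \<Rightarrow> real"
proof -
  have "(\<Sum>S\<in>fam P. (sum x (R \<inter> S)) ^ 3) = (\<Sum>S\<in>fam P. \<Sum>i\<in>R. \<Sum>j\<in>R. \<Sum>k\<in>R. x i * x j * x k * of_bool ({i, j, k} \<subseteq> S))"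
    unfolding sum_fam_indicator sum_power3_expand by (intro sum.cong refl) auto
  also have "\<dots> = (\<Sum>i\<in>R. \<Sum>S\<in>fam P. \<Sum>j\<in>R. \<Sum>k\<in>R. x i * x j * x k * of_bool ({i, j, k} \<subseteq> S))" by (rule sum.swap)
  also have "\<dots> = (\<Sum>i\<in>R. \<Sum>j\<in>R. \<Sum>S\<in>fam P. \<Sum>k\<in>R. x i * x j * x k * of_bool ({i, j, k} \<subseteq> S))"
    by (intro sum.cong refl sum.swap)
  also have "\<dots> = (\<Sum>i\<in>R. \<Sum>j\<in>R. \<Sum>k\<in>R. \<Sum>S\<in>fam P. x i * x j * x k * of_bool ({i, j, k} \<subseteq> S))"
    by (intro sum.cong refl sum.swap)
  finally show ?thesis by (simp only: sum_distrib_left [symmetric] sum_of_bool_fam)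
qed

lemma sum_fam_12:
  fixes x :: "'n \<Rightarrow> real"
  assumes "\<And>i. i \<in> R \<Longrightarrow> cnt P {i} = p" "\<And>i j. i \<in> R \<Longrightarrow> j \<in> R \<Longrightarrow> i \<noteq> j \<Longrightarrow> cnt P {i, j} = q"
  shows "(\<Sum>S\<in>fam P. sum x (R \<inter> S)) = p * sum x R"
    "(\<Sum>S\<in>fam P. (sum x (R \<inter> S))\<^sup>2) = (p - q) * (\<Sum>i\<in>R. (x i)\<^sup>2) + q * (sum x R)\<^sup>2"
proof -
  show "(\<Sum>S\<in>fam P. sum x (R \<inter> S)) = p * sum x R"
    unfolding sum_fam_1 sum_distrib_left by (intro sum.cong refl) (simp add: assms)
  have "(\<Sum>S\<in>fam P. (sum x (R \<inter> S))\<^sup>2) = (\<Sum>i\<in>R. \<Sum>j\<in>R. x i * x j * (if i = j then p else q))"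
    unfolding sum_fam_2 by (intro sum.cong refl) (auto simp: assms)
  then show "(\<Sum>S\<in>fam P. (sum x (R \<inter> S))\<^sup>2) = (p - q) * (\<Sum>i\<in>R. (x i)\<^sup>2) + q * (sum x R)\<^sup>2"
    by (simp add: sum_pairs_diagonal)
qed

lemma moments_pair:
  fixes x :: "'n \<Rightarrow> real"
  assumes "P \<in> {{a, b}, {a, c}, {b, c}}"
  shows "(\<Sum>S\<in>fam P. 1) = (56 :: real)" "(\<Sum>S\<in>fam P. sum x (R \<inter> S)) = 16 * sum x R"
    "(\<Sum>S\<in>fam P. (sum x (R \<inter> S))\<^sup>2) = 12 * (\<Sum>i\<in>R. (x i)\<^sup>2) + 4 * (sum x R)\<^sup>2"
proof -
  have p: "cnt P {i} = 16" if "i \<in> R" for i using cnt_pair(2) [OF _ assms, of "{i}"] that by simp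
  have q: "cnt P {i, j} = 4" if "i \<in> R" "j \<in> R" "i \<noteq> j" for i j using cnt_pair(3) [OF _ assms, of "{i, j}"] that by simp
  show "(\<Sum>S\<in>fam P. 1) = (56 :: real)" using sum_fam_0 [of P] cnt_pair(1) [OF _ assms, of "{}"] by simp
  show "(\<Sum>S\<in>fam P. sum x (R \<inter> S)) = 16 * sum x R"
    "(\<Sum>S\<in>fam P. (sum x (R \<inter> S))\<^sup>2) = 12 * (\<Sum>i\<in>R. (x i)\<^sup>2) + 4 * (sum x R)\<^sup>2"
    using sum_fam_12 [of P 16 4 x, OF p q] by simp_all
qed

lemma moments_abc:
  fixes x :: "'n \<Rightarrow> real"
  shows
  "(\<Sum>S\<in>fam {a, b, c}. 1) = (21 :: real)" "(\<Sum>S\<in>fam {a, b, c}. sum x (R \<inter> S)) = 5 * sum x R"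
  "(\<Sum>S\<in>fam {a, b, c}. (sum x (R \<inter> S))\<^sup>2) = 4 * (\<Sum>i\<in>R. (x i)\<^sup>2) + (sum x R)\<^sup>2"
proof -
  have p: "cnt {a, b, c} {i} = 5" if "i \<in> R" for i using cnt_abc(2) [of "{i}"] that by simp
  have q: "cnt {a, b, c} {i, j} = 1" if "i \<in> R" "j \<in> R" "i \<noteq> j" for i j using cnt_abc(3) [of "{i, j}"] that by simp
  show "(\<Sum>S\<in>fam {a, b, c}. 1) = (21 :: real)" using sum_fam_0 [of "{a, b, c}"] cnt_abc(1) [of "{}"] by simp
  show "(\<Sum>S\<in>fam {a, b, c}. sum x (R \<inter> S)) = 5 * sum x R"
    "(\<Sum>S\<in>fam {a, b, c}. (sum x (R \<inter> S))\<^sup>2) = 4 * (\<Sum>i\<in>R. (x i)\<^sup>2) + (sum x R)\<^sup>2"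
    using sum_fam_12 [of "{a, b, c}" 5 1 x, OF p q] by simp_all
qed

lemma moments_a:
  fixes x :: "'n \<Rightarrow> real"
  shows
  "(\<Sum>S\<in>fam {a}. 1) = (120 :: real)" "(\<Sum>S\<in>fam {a}. sum x (R \<inter> S)) = 40 * sum x R"
  "(\<Sum>S\<in>fam {a}. (sum x (R \<inter> S))\<^sup>2) = 28 * (\<Sum>i\<in>R. (x i)\<^sup>2) + 12 * (sum x R)\<^sup>2"
proof -
  have p: "cnt {a} {i} = 40" if "i \<in> R" for i using cnt_a(2) [of "{i}"] that by simp
  have q: "cnt {a} {i, j} = 12" if "i \<in> R" "j \<in> R" "i \<noteq> j" for i j using cnt_a(3) [of "{i, j}"] that by simp
  show "(\<Sum>S\<in>fam {a}. 1) = (120 :: real)" using sum_fam_0 [of "{a}"] cnt_a(1) [of "{}"] by simp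
  show "(\<Sum>S\<in>fam {a}. sum x (R \<inter> S)) = 40 * sum x R"
    "(\<Sum>S\<in>fam {a}. (sum x (R \<inter> S))\<^sup>2) = 28 * (\<Sum>i\<in>R. (x i)\<^sup>2) + 12 * (sum x R)\<^sup>2"
    using sum_fam_12 [of "{a}" 40 12 x, OF p q] by simp_all
qed

lemma card_triple_cases: "card {i, j, k} = 1 \<or> card {i, j, k} = 2 \<or> card {i, j, k} = 3" for i j k :: 'n
  by (auto simp: card_insert_if)

text \<open>For three distinct points the counts of both types are the same expression in the
  unknown count for \<open>{a, b, c}\<close>.\<close>

lemma third_moment_pairs:
  fixes x :: "'n \<Rightarrow> real"
  shows
  "(\<Sum>S\<in>fam {a, b}. (sum x (R \<inter> S)) ^ 3) = (\<Sum>S\<in>fam {a, c}. (sum x (R \<inter> S)) ^ 3)"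
proof -
  have "cnt {a, b} T = cnt {a, c} T" if "T \<subseteq> R" "card T = 1 \<or> card T = 2 \<or> card T = 3" for T
    using that cnt_pair [OF that(1), of "{a, b}"] cnt_pair [OF that(1), of "{a, c}"] by auto
  then show ?thesis
    unfolding sum_fam_3 using card_triple_cases by (intro sum.cong refl) simp
qed

lemma third_moment_a_abc:
  fixes x :: "'n \<Rightarrow> real"
  shows
  "(\<Sum>S\<in>fam {a}. (sum x (R \<inter> S)) ^ 3) = (\<Sum>S\<in>fam {a, b, c}. (sum x (R \<inter> S)) ^ 3)
    + 3 * (sum x R) ^ 3 + 24 * (sum x R * (\<Sum>i\<in>R. (x i)\<^sup>2)) + 8 * (\<Sum>i\<in>R. (x i) ^ 3)"
proof -
  \<comment> \<open>Differences of the two counts for one, two and three points: 40 - 5, 12 - 1 and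
    3. In the last the unknown count drops out.\<close>
  define d :: "nat \<Rightarrow> real" where "d n = (if n = 1 then 35 else if n = 2 then 11 else 3)" for n
  have *: "cnt {a} T = cnt {a, b, c} T + d (card T)" if "T \<subseteq> R" "card T = 1 \<or> card T = 2 \<or> card T = 3" for T
    using that cnt_a [OF that(1)] cnt_abc [OF that(1)] by (auto simp: d_def)
  have "(\<Sum>S\<in>fam {a}. (sum x (R \<inter> S)) ^ 3)
      = (\<Sum>i\<in>R. \<Sum>j\<in>R. \<Sum>k\<in>R. x i * x j * x k * cnt {a, b, c} {i, j, k} + x i * x j * x k * d (card {i, j, k}))"
    unfolding sum_fam_3 using card_triple_cases
    by (intro sum.cong refl) (simp add: * distrib_left)
  also have "\<dots> = (\<Sum>S\<in>fam {a, b, c}. (sum x (R \<inter> S)) ^ 3)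
      + (\<Sum>i\<in>R. \<Sum>j\<in>R. \<Sum>k\<in>R. x i * x j * x k * d (card {i, j, k}))"
    by (simp add: sum_fam_3 sum.distrib)
  also have "(\<Sum>i\<in>R. \<Sum>j\<in>R. \<Sum>k\<in>R. x i * x j * x k * d (card {i, j, k}))
     = 3 * (sum x R) ^ 3 + 24 * (sum x R * (\<Sum>i\<in>R. (x i)\<^sup>2)) + 8 * (\<Sum>i\<in>R. (x i) ^ 3)"
    by (subst sum_triples_diagonal [of R d 35 11 3]) (auto simp: d_def)
  finally show ?thesis by simp
qed

lemma sum_indicator_UNIV: "(\<Sum>i\<in>UNIV. of_bool (i \<in> S) * x i) = sum x S" for x :: "'n \<Rightarrow> real"
  by (simp add: of_bool_def if_distrib [of "\<lambda>z. z * _"] sum.If_cases cong: if_cong)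

lemma sum_point_UNIV: "(\<Sum>i\<in>UNIV. of_bool (i = j) * x i) = x j" for x :: "'n \<Rightarrow> real"
  by (simp add: of_bool_def if_distrib [of "\<lambda>z. z * _"] cong: if_cong)

lemma dotr_vectors:
  "dotr (evenv S) x = 2 * sum x S" "dotr (negv S) x = 2 * sum x S - 4 * x b - 4 * x c"
  "dotr (oddv S j) x = sum x UNIV - 2 * sum x S + 4 * x j" "dotr (minusv j) x = sum x UNIV - 4 * x j"
  by (simp_all add: dotr_def evenv_def negv_def oddv_def minusv_def distrib_right left_diff_distrib
      sum.distrib sum_subtractf mult.assoc sum_distrib_left [symmetric] sum_indicator_UNIV sum_point_UNIV)

lemma sum_fam: "S \<in> fam P \<Longrightarrow> sum x S = sum x P + sum x (R \<inter> S)" for x :: "'n \<Rightarrow> real"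
proof -
  assume "S \<in> fam P"
  then have "S = P \<union> (R \<inter> S)" "P \<inter> (R \<inter> S) = {}" by (auto simp: fam_def R_def)
  then show ?thesis by (metis finite sum.union_disjoint)
qed

lemma perp_sum_UNIV: "perp x \<Longrightarrow> sum x UNIV = - 4 * x a"
  by (simp add: sum_UNIV_R perp_def)

lemma dotr_fam:
  assumes "perp x"
  shows "S \<in> fam {a, c} \<Longrightarrow> dotr (evenv S) x = 2 * sum x (R \<inter> S)"
    "S \<in> fam {a, b} \<Longrightarrow> dotr (oddv S a) x = - 2 * sum x (R \<inter> S)"
    "S \<in> fam {a} \<Longrightarrow> dotr (evenv S) x = 2 * (sum x (R \<inter> S) + x a)"
    "dotr (minusv j) x = - 4 * (x j + x a)"
    "S \<in> fam {a, b, c} \<Longrightarrow> dotr (oddv S a) x = - 2 * (sum x (R \<inter> S) - x a)"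
    "S \<in> fam {b, c} \<Longrightarrow> dotr (negv S) x = 2 * (sum x (R \<inter> S) + 2 * x a)"
    "S \<in> fam {a, b, c} \<Longrightarrow> dotr (oddv S j) x = - 2 * (sum x (R \<inter> S) + x a - 2 * x j)"
  using assms perp_sum_UNIV [OF assms]
  by (simp_all add: dotr_vectors sum_fam perp_def)

lemma norm_perp: "perp x \<Longrightarrow> (\<Sum>i\<in>UNIV. (x i)\<^sup>2) = 3 * (x a)\<^sup>2 + (\<Sum>i\<in>R. (x i)\<^sup>2)"
  by (simp add: sum_UNIV_R perp_def)

lemma finite_shells [simp]: "finite (shell 24 2 8)" "finite (shell 24 2 16)" "finite (shell 8 (-2) 16)"
  by (simp_all add: shell_112 shell_162 shell_162b)

text \<open>96 = 112 * 8 * (9/4) / 21 is the design value for squared length 8 * 9/4 in dimension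
  21. The two halves contribute equal third moments with the factors 8 and -8.\<close>

lemma moments_112:
  assumes "perp x"
  shows "card (shell 24 2 8) = 112" "(\<Sum>X\<in>shell 24 2 8. dotr X x) = 0"
    "(\<Sum>X\<in>shell 24 2 8. (dotr X x)\<^sup>2) = 96 * (\<Sum>i\<in>UNIV. (x i)\<^sup>2)"
    "(\<Sum>X\<in>shell 24 2 8. (dotr X x) ^ 3) = 0"
proof -
  let ?s = "\<lambda>S. sum x (R \<inter> S)"
  have sR: "sum x R = - 3 * x a" using assms by (simp add: perp_def)
  have "real (card (shell 24 2 8)) = (\<Sum>X\<in>shell 24 2 8. 1)" by simp
  also have "\<dots> = 112" unfolding sum_shell_112 by (simp only: moments_pair insert_iff simp_thms)
  finally show "card (shell 24 2 8) = 112" by linarith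
  have 1: "(\<Sum>S\<in>fam {a, c}. (dotr (evenv S) x) ^ k) = 2 ^ k * (\<Sum>S\<in>fam {a, c}. ?s S ^ k)"
    "(\<Sum>S\<in>fam {a, b}. (dotr (oddv S a) x) ^ k) = (-2) ^ k * (\<Sum>S\<in>fam {a, b}. ?s S ^ k)" for k
    by (simp_all add: dotr_fam [OF assms] sum_distrib_left power_mult_distrib [symmetric] cong: sum.cong)
  note * = sum_shell_112 [of "\<lambda>X. (dotr X x) ^ _", unfolded 1]
  show "(\<Sum>X\<in>shell 24 2 8. dotr X x) = 0"
    using * [of 1] moments_pair(2) [of "{a, c}" x] moments_pair(2) [of "{a, b}" x] by simp
  show "(\<Sum>X\<in>shell 24 2 8. (dotr X x)\<^sup>2) = 96 * (\<Sum>i\<in>UNIV. (x i)\<^sup>2)"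
    using * [of 2] moments_pair(3) [of "{a, c}" x] moments_pair(3) [of "{a, b}" x]
    unfolding norm_perp [OF assms] sR by (simp add: power_mult_distrib)
  show "(\<Sum>X\<in>shell 24 2 8. (dotr X x) ^ 3) = 0"
    using * [of 3] third_moment_pairs [of x] by simp
qed

lemma sum_power2_shift: "(\<Sum>i\<in>A. (f i + r)\<^sup>2) = (\<Sum>i\<in>A. (f i)\<^sup>2) + 2 * r * sum f A + r\<^sup>2 * (\<Sum>i\<in>A. 1)" for f :: "'x \<Rightarrow> real"
proof -
  have "(f i + r)\<^sup>2 = (f i)\<^sup>2 + 2 * r * f i + r\<^sup>2 * 1" for i
    by (simp add: power2_eq_square algebra_simps)
  then show ?thesis by (simp only: sum.distrib sum_distrib_left)
qed

lemma sum_power3_shift: "(\<Sum>i\<in>A. (f i + r) ^ 3)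
   = (\<Sum>i\<in>A. (f i) ^ 3) + 3 * r * (\<Sum>i\<in>A. (f i)\<^sup>2) + 3 * r\<^sup>2 * sum f A + r ^ 3 * (\<Sum>i\<in>A. 1)" for f :: "'x \<Rightarrow> real"
proof -
  have "(f i + r) ^ 3 = (f i) ^ 3 + 3 * r * (f i)\<^sup>2 + 3 * r\<^sup>2 * f i + r ^ 3 * 1" for i
    by (simp add: power3_eq_cube power2_eq_square algebra_simps)
  then show ?thesis by (simp only: sum.distrib sum_distrib_left)
qed

text \<open>144 = 162 * 8 * (7/3) / 21. In the third moment the octads through a, b, c cancel the
  unknown part of those through a alone, and \<open>minusv\<close> cancels the remaining
  cubes.\<close>

lemma moments_162:
  assumes "perp x"
  shows "card (shell 24 2 16) = 162" "(\<Sum>X\<in>shell 24 2 16. dotr X x) = 0"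
    "(\<Sum>X\<in>shell 24 2 16. (dotr X x)\<^sup>2) = 144 * (\<Sum>i\<in>UNIV. (x i)\<^sup>2)"
    "(\<Sum>X\<in>shell 24 2 16. (dotr X x) ^ 3) = 0"
proof -
  let ?s = "\<lambda>S. sum x (R \<inter> S)"
  have sR: "sum x R = - 3 * x a" using assms by (simp add: perp_def)
  have cR: "(\<Sum>i\<in>R. 1) = (21 :: real)" by (simp add: card_R)
  have "real (card (shell 24 2 16)) = (\<Sum>X\<in>shell 24 2 16. 1)" by simp
  also have "\<dots> = 162" unfolding sum_shell_162 by (simp only: moments_a moments_abc cR)
  finally show "card (shell 24 2 16) = 162" by linarith
  have 1: "(\<Sum>S\<in>fam {a}. (dotr (evenv S) x) ^ k) = 2 ^ k * (\<Sum>S\<in>fam {a}. (?s S + x a) ^ k)"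
    "(\<Sum>j\<in>R. (dotr (minusv j) x) ^ k) = (-4) ^ k * (\<Sum>j\<in>R. (x j + x a) ^ k)"
    "(\<Sum>S\<in>fam {a, b, c}. (dotr (oddv S a) x) ^ k) = (-2) ^ k * (\<Sum>S\<in>fam {a, b, c}. (?s S + - x a) ^ k)" for k
    by (simp_all only: dotr_fam(3-5) [OF assms] sum_distrib_left power_mult_distrib [symmetric] diff_conv_add_uminus cong: sum.cong)
  note * = sum_shell_162 [of "\<lambda>X. (dotr X x) ^ _", unfolded 1]
  show "(\<Sum>X\<in>shell 24 2 16. dotr X x) = 0"
  proof -
    have "(\<Sum>S\<in>fam {a}. ?s S + x a) = 0"
      using moments_a(1) moments_a(2) [of x] by (simp add: sum.distrib sR)
    moreover have "(\<Sum>j\<in>R. x j + x a) = 18 * x a" by (simp add: sum.distrib sR card_R)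
    moreover have "(\<Sum>S\<in>fam {a, b, c}. ?s S + - x a) = - 36 * x a"
      using moments_abc(1) moments_abc(2) [of x] by (simp add: sum.distrib sum_subtractf sR)
    ultimately show ?thesis using * [of 1] by simp
  qed
  show "(\<Sum>X\<in>shell 24 2 16. (dotr X x)\<^sup>2) = 144 * (\<Sum>i\<in>UNIV. (x i)\<^sup>2)"
    unfolding * sum_power2_shift moments_a moments_abc cR norm_perp [OF assms] sR
    by (simp add: power2_eq_square algebra_simps)
  show "(\<Sum>X\<in>shell 24 2 16. (dotr X x) ^ 3) = 0"
    unfolding * sum_power3_shift moments_a moments_abc third_moment_a_abc cR sR
    by (simp add: power2_eq_square power3_eq_cube algebra_simps)
qed

text \<open>The size is 56 + 21 * 5 + 1. The second moment is the one that enters for the antipodal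
  code \<open>D_hat G\<close>, where odd powers cancel in pairs.\<close>

lemma moments_162b:
  assumes "perp x"
  shows "card (shell 8 (-2) 16) = 162"
    "(\<Sum>X\<in>shell 8 (-2) 16. (dotr X x)\<^sup>2) = 144 * (\<Sum>i\<in>UNIV. (x i)\<^sup>2)"
proof -
  let ?s = "\<lambda>S. sum x (R \<inter> S)"
  have sR: "sum x R = - 3 * x a" using assms by (simp add: perp_def)
  have card5: "card (S \<inter> R) = 5" if "S \<in> fam {a, b, c}" for S
  proof -
    have "S \<inter> R = S - {a, b, c}" by (auto simp: R_def)
    moreover have "{a, b, c} \<subseteq> S" using that by (auto simp: fam_def)
    ultimately show ?thesis using famD(2) [OF that] by (simp add: card_Diff_subset)
  qed
  have "real (card (shell 8 (-2) 16)) = (\<Sum>X\<in>shell 8 (-2) 16. 1)" by simp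
  also have "\<dots> = (\<Sum>S\<in>fam {b, c}. 1) + (\<Sum>S\<in>fam {a, b, c}. 5 * 1) + 1"
    unfolding sum_shell_162b by (simp add: card5)
  also have "\<dots> = 162"
    by (simp only: moments_pair moments_abc sum_distrib_left [symmetric] insert_iff simp_thms)
  finally show "card (shell 8 (-2) 16) = 162" by linarith
  \<comment> \<open>For fixed S the entry 3 runs through the five points of S in R; the square is
    expanded around the part independent of j.\<close>
  have inner: "(\<Sum>j\<in>S \<inter> R. (dotr (oddv S j) x)\<^sup>2)
      = 4 * (?s S)\<^sup>2 + 24 * x a * ?s S + 20 * (x a)\<^sup>2 * 1 + 16 * (\<Sum>j\<in>R. (x j)\<^sup>2 * of_bool ({j} \<subseteq> S))"
    if "S \<in> fam {a, b, c}" for S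
  proof -
    have "(\<Sum>j\<in>S \<inter> R. (dotr (oddv S j) x)\<^sup>2) = (\<Sum>j\<in>S \<inter> R. 4 * (?s S + x a)\<^sup>2 - 16 * (?s S + x a) * x j + 16 * (x j)\<^sup>2)"
      using that by (intro sum.cong refl) (simp add: dotr_fam [OF assms] power2_eq_square algebra_simps)
    also have "\<dots> = 5 * (4 * (?s S + x a)\<^sup>2) - 16 * (?s S + x a) * ?s S + 16 * (\<Sum>j\<in>S \<inter> R. (x j)\<^sup>2)"
      by (simp add: sum.distrib sum_subtractf card5 [OF that] Int_commute flip: sum_distrib_left)
    also have "(\<Sum>j\<in>S \<inter> R. (x j)\<^sup>2) = (\<Sum>j\<in>R. (x j)\<^sup>2 * of_bool ({j} \<subseteq> S))"
      using sum_fam_indicator [of "\<lambda>j. (x j)\<^sup>2" S] by (simp add: Int_commute)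
    finally show ?thesis by (simp add: power2_eq_square algebra_simps)
  qed
  have q: "(\<Sum>S\<in>fam {a, b, c}. \<Sum>j\<in>R. (x j)\<^sup>2 * of_bool ({j} \<subseteq> S)) = 5 * (\<Sum>j\<in>R. (x j)\<^sup>2)"
    using moments_abc(2) [of "\<lambda>j. (x j)\<^sup>2"]
    by (simp only: sum_fam_indicator insert_subset empty_subsetI simp_thms)
  have "(\<Sum>S\<in>fam {a, b, c}. \<Sum>j\<in>S \<inter> R. (dotr (oddv S j) x)\<^sup>2)
      = 4 * (\<Sum>S\<in>fam {a, b, c}. (?s S)\<^sup>2) + 24 * x a * (\<Sum>S\<in>fam {a, b, c}. ?s S)
        + 20 * (x a)\<^sup>2 * (\<Sum>S\<in>fam {a, b, c}. 1)
        + 16 * (\<Sum>S\<in>fam {a, b, c}. \<Sum>j\<in>R. (x j)\<^sup>2 * of_bool ({j} \<subseteq> S))"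
    by (simp only: inner sum.distrib sum_distrib_left cong: sum.cong)
  then have 2: "(\<Sum>S\<in>fam {a, b, c}. \<Sum>j\<in>S \<inter> R. (dotr (oddv S j) x)\<^sup>2) = 96 * (\<Sum>i\<in>R. (x i)\<^sup>2) + 96 * (x a)\<^sup>2"
    unfolding q moments_abc sR by (simp add: power2_eq_square)
  have "(\<Sum>S\<in>fam {b, c}. (dotr (negv S) x)\<^sup>2) = 4 * (\<Sum>S\<in>fam {b, c}. (?s S + 2 * x a)\<^sup>2)"
    by (simp only: dotr_fam(6) [OF assms] power_mult_distrib sum_distrib_left [symmetric] cong: sum.cong) simp
  also have "(\<Sum>S\<in>fam {b, c}. (?s S + 2 * x a)\<^sup>2) = 12 * (\<Sum>i\<in>R. (x i)\<^sup>2) + 68 * (x a)\<^sup>2"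
    unfolding sum_power2_shift using moments_pair(1) [of "{b, c}"] moments_pair(2,3) [of "{b, c}" x] sR by (simp add: power2_eq_square)
  finally have 3: "(\<Sum>S\<in>fam {b, c}. (dotr (negv S) x)\<^sup>2) = 48 * (\<Sum>i\<in>R. (x i)\<^sup>2) + 272 * (x a)\<^sup>2" by simp
  have 4: "(dotr (minusv a) x)\<^sup>2 = 64 * (x a)\<^sup>2"
    using dotr_fam(4) [OF assms, of a] by (simp add: power2_eq_square)
  show "(\<Sum>X\<in>shell 8 (-2) 16. (dotr X x)\<^sup>2) = 144 * (\<Sum>i\<in>UNIV. (x i)\<^sup>2)"
    unfolding sum_shell_162b 2 3 4 norm_perp [OF assms] by simp
qed

end

subsection \<open>Polarity of the shells\<close>

lemma sum_square_add3:
  fixes f g h :: "'a \<Rightarrow> int"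
  shows "(\<Sum>i\<in>A. (f i + g i + h i)\<^sup>2) = (\<Sum>i\<in>A. (f i)\<^sup>2) + (\<Sum>i\<in>A. (g i)\<^sup>2) + (\<Sum>i\<in>A. (h i)\<^sup>2)
    + 2 * (\<Sum>i\<in>A. f i * g i) + 2 * (\<Sum>i\<in>A. f i * h i) + 2 * (\<Sum>i\<in>A. g i * h i)"
proof -
  have "(f i + g i + h i)\<^sup>2 = (f i)\<^sup>2 + (g i)\<^sup>2 + (h i)\<^sup>2 + 2 * (f i * g i) + 2 * (f i * h i) + 2 * (g i * h i)" for i
    by (simp add: power2_eq_square algebra_simps)
  then show ?thesis by (simp only: sum.distrib sum_distrib_left)
qed

context pointed_golay
begin

definition wv :: "'n \<Rightarrow> int" where "wv i = 1 + 4 * of_bool (i = a)"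
definition vv :: "'n \<Rightarrow> int" where "vv i = 4 * of_bool (i = a) + 4 * of_bool (i = b)"
definition uv :: "'n \<Rightarrow> int" where "uv i = 1 - 4 * of_bool (i = c)"

lemma sum_times_point: "(\<Sum>i\<in>UNIV. f i * of_bool (i = j)) = f j" for f :: "'n \<Rightarrow> 'x::comm_ring_1"
  by (simp add: of_bool_def if_distrib cong: if_cong)

lemma inner_wv: "(\<Sum>i\<in>UNIV. X i * wv i) = sum X UNIV + 4 * X a"
  and inner_vv: "(\<Sum>i\<in>UNIV. X i * vv i) = 4 * (X a + X b)"
  and inner_uv: "(\<Sum>i\<in>UNIV. X i * uv i) = sum X UNIV - 4 * X c"
proof -
  have "X i * wv i = X i + 4 * (X i * of_bool (i = a))"
    "X i * vv i = 4 * (X i * of_bool (i = a)) + 4 * (X i * of_bool (i = b))"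
    "X i * uv i = X i - 4 * (X i * of_bool (i = c))" for i
    by (simp_all add: wv_def vv_def uv_def)
  then show "(\<Sum>i\<in>UNIV. X i * wv i) = sum X UNIV + 4 * X a" "(\<Sum>i\<in>UNIV. X i * vv i) = 4 * (X a + X b)"
    "(\<Sum>i\<in>UNIV. X i * uv i) = sum X UNIV - 4 * X c"
    by (simp_all only: sum.distrib sum_subtractf sum_distrib_left [symmetric] sum_times_point distrib_left)
qed

lemma sum_uvw: "sum wv UNIV = 28" "sum vv UNIV = 8" "sum uv UNIV = 20"
  using inner_wv [of "\<lambda>_. 1"] inner_vv [of "\<lambda>_. 1"] inner_uv [of "\<lambda>_. 1"] by (simp_all add: card_points)

lemma shell_iff:
  "X \<in> shell p q r \<longleftrightarrow> leechZ X \<and> (\<Sum>i\<in>UNIV. (X i)\<^sup>2) = 32 \<and> (\<Sum>i\<in>UNIV. X i * wv i) = p \<and>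
     (\<Sum>i\<in>UNIV. X i * vv i) = 4 * q \<and> (\<Sum>i\<in>UNIV. X i * uv i) = r"
  unfolding shell_def inner_wv inner_vv inner_uv by auto

lemma leechZ_wv: "leechZ wv"
proof (rule leechZ_I [of "{}" _ 1 "\<lambda>i. of_bool (i = a)"])
  show "even ((\<Sum>i\<in>UNIV. of_bool (i = a)) - (1::int))" by (simp only: sum_of_bool_eq_point) simp
qed (auto simp: wv_def empty_in_G)

lemma leechZ_vv: "leechZ vv"
proof (rule leechZ_I [of "{}" _ 0 "\<lambda>i. of_bool (i = a) + of_bool (i = b)"])
  show "even ((\<Sum>i\<in>UNIV. of_bool (i = a) + of_bool (i = b)) - (0::int))"
    by (simp only: sum.distrib sum_of_bool_eq_point) simp
qed (auto simp: vv_def empty_in_G)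

lemma leechZ_uv: "leechZ uv"
  using leechZ_minusv [of c] by (simp add: minusv_def [abs_def] uv_def [abs_def])

lemma inner_uvw:
  "(\<Sum>i\<in>UNIV. wv i * wv i) = 48" "(\<Sum>i\<in>UNIV. vv i * vv i) = 32" "(\<Sum>i\<in>UNIV. uv i * uv i) = 32"
  "(\<Sum>i\<in>UNIV. wv i * vv i) = 24" "(\<Sum>i\<in>UNIV. wv i * uv i) = 24" "(\<Sum>i\<in>UNIV. vv i * uv i) = 8"
  unfolding inner_wv inner_vv inner_uv sum_uvw by (simp_all add: wv_def vv_def uv_def)

text \<open>The minimum norm as a tool: a computed distance below 32 turns into an equation, which
  inner products can refute.\<close>

lemma eq_if_norm_small:
  assumes "leechZ X" "leechZ Y" "(\<Sum>i\<in>UNIV. (X i - Y i)\<^sup>2) < 32"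
  shows "X = Y"
proof (rule ccontr)
  assume "X \<noteq> Y"
  then have "(\<lambda>i. X i - Y i) \<noteq> (\<lambda>_. 0)" by (auto simp: fun_eq_iff)
  then show False using leechZ_min_norm [OF leechZ_diff [OF assms(1,2)]] assms(3) by simp
qed

text \<open>The squared norms of Y + Z - w and Y - Z are linear in the inner product, and the
  minimum norm bounds it on both sides. Divisibility by 8 leaves the two bounds.\<close>

lemma polar_112_162:
  assumes Y: "Y \<in> shell 24 2 8" and Z: "Z \<in> shell 24 2 16"
  shows "(\<Sum>i\<in>UNIV. Y i * Z i) = 8 \<or> (\<Sum>i\<in>UNIV. Y i * Z i) = 16"
proof -
  let ?p = "\<Sum>i\<in>UNIV. Y i * Z i"
  note Y' = Y [unfolded shell_iff] and Z' = Z [unfolded shell_iff]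
  have "(\<Sum>i\<in>UNIV. (Y i + Z i + - wv i)\<^sup>2) = 16 + 2 * ?p"
    unfolding sum_square_add3 using Y' Z' inner_uvw(1) by (simp add: sum_negf power2_eq_square)
  then have n1: "(\<Sum>i\<in>UNIV. (Y i + Z i - wv i)\<^sup>2) = 16 + 2 * ?p" by simp
  have "(\<Sum>i\<in>UNIV. (Y i + - Z i + 0)\<^sup>2) = 64 - 2 * ?p"
    unfolding sum_square_add3 using Y' Z' by (simp add: sum_negf)
  then have n2: "(\<Sum>i\<in>UNIV. (Y i - Z i)\<^sup>2) = 64 - 2 * ?p" by simp
  have "8 \<le> ?p"
  proof (rule ccontr)
    assume "\<not> 8 \<le> ?p"
    then have "(\<lambda>i. Y i + Z i) = wv"
      using n1 Y' Z' by (intro eq_if_norm_small leechZ_add leechZ_wv) auto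
    then have "(\<Sum>i\<in>UNIV. (Y i + Z i) * vv i) = 24" using inner_uvw(4) by (simp add: fun_eq_iff)
    then show False using Y' Z' by (simp add: distrib_right sum.distrib)
  qed
  moreover have "?p \<le> 16"
  proof (rule ccontr)
    assume "\<not> ?p \<le> 16"
    then have "Y = Z" using n2 Y' Z' by (intro eq_if_norm_small) auto
    then show False using Y' Z' by simp
  qed
  moreover obtain k where "?p = 8 * k" using leechZ_inner Y' Z' by blast
  ultimately show ?thesis by presburger
qed

text \<open>The minimal vectors w - v and w - u play the role of w and 0: they make the squared
  norms of Y + Z - (w - v) and Y - Z - (w - u) equal to 32 + 2p and 48 - 2p.\<close>

lemma polar_112_162b:
  assumes Y: "Y \<in> shell 24 2 8" and Z: "Z \<in> shell 8 (-2) 16"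
  shows "(\<Sum>i\<in>UNIV. Y i * Z i) = 0 \<or> (\<Sum>i\<in>UNIV. Y i * Z i) = 8"
proof -
  let ?p = "\<Sum>i\<in>UNIV. Y i * Z i"
  note Y' = Y [unfolded shell_iff] and Z' = Z [unfolded shell_iff]
  have "(\<Sum>i\<in>UNIV. (wv i + - vv i + 0)\<^sup>2) = 32" "(\<Sum>i\<in>UNIV. (wv i + - uv i + 0)\<^sup>2) = 32"
    unfolding sum_square_add3 using inner_uvw by (simp_all add: sum_negf power2_eq_square)
  then have sq: "(\<Sum>i\<in>UNIV. (wv i - vv i)\<^sup>2) = 32" "(\<Sum>i\<in>UNIV. (wv i - uv i)\<^sup>2) = 32" by simp_all
  define d e where "d = (\<lambda>i. wv i - vv i)" and "e = (\<lambda>i. wv i - uv i)"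
  have d: "(\<Sum>i\<in>UNIV. (d i)\<^sup>2) = 32" "(\<Sum>i\<in>UNIV. Y i * d i) = 16" "(\<Sum>i\<in>UNIV. Z i * d i) = 16"
    and e: "(\<Sum>i\<in>UNIV. (e i)\<^sup>2) = 32" "(\<Sum>i\<in>UNIV. Y i * e i) = 16" "(\<Sum>i\<in>UNIV. Z i * e i) = - 8"
    using sq Y' Z' by (simp_all add: d_def e_def right_diff_distrib sum_subtractf)
  have "(\<Sum>i\<in>UNIV. (Y i + Z i + - d i)\<^sup>2) = 32 + 2 * ?p"
    unfolding sum_square_add3 using Y' Z' d by (simp add: sum_negf)
  then have n1: "(\<Sum>i\<in>UNIV. (Y i + Z i - (wv i - vv i))\<^sup>2) = 32 + 2 * ?p" by (simp only: d_def add_uminus_conv_diff)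
  have "(\<Sum>i\<in>UNIV. (Y i + - Z i + - e i)\<^sup>2) = 48 - 2 * ?p"
    unfolding sum_square_add3 using Y' Z' e by (simp add: sum_negf)
  then have n2: "(\<Sum>i\<in>UNIV. (Y i - Z i - (wv i - uv i))\<^sup>2) = 48 - 2 * ?p" by (simp only: e_def add_uminus_conv_diff)
  have "0 \<le> ?p"
  proof (rule ccontr)
    assume "\<not> 0 \<le> ?p"
    then have "(\<lambda>i. Y i + Z i) = (\<lambda>i. wv i - vv i)"
      using n1 Y' Z' by (intro eq_if_norm_small leechZ_add leechZ_diff leechZ_wv leechZ_vv) auto
    then have "(\<Sum>i\<in>UNIV. (Y i + Z i) * vv i) = (\<Sum>i\<in>UNIV. (wv i - vv i) * vv i)" by (simp add: fun_eq_iff)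
    then show False using Y' Z' inner_uvw by (simp add: distrib_right left_diff_distrib sum.distrib sum_subtractf)
  qed
  moreover have "?p \<le> 8"
  proof (rule ccontr)
    assume "\<not> ?p \<le> 8"
    then have "(\<lambda>i. Y i - Z i) = (\<lambda>i. wv i - uv i)"
      using n2 Y' Z' by (intro eq_if_norm_small leechZ_diff leechZ_wv leechZ_uv) auto
    then have "(\<Sum>i\<in>UNIV. (Y i - Z i) * wv i) = (\<Sum>i\<in>UNIV. (wv i - uv i) * wv i)" by (simp add: fun_eq_iff)
    moreover have "(\<Sum>i\<in>UNIV. uv i * wv i) = 24" using inner_uvw(5) by (simp add: mult.commute)
    ultimately show False using Y' Z' inner_uvw by (simp add: left_diff_distrib sum_subtractf)
  qed
  moreover obtain k where "?p = 8 * k" using leechZ_inner Y' Z' by blast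
  ultimately show ?thesis by presburger
qed

subsection \<open>Vectors with two inner products\<close>

text \<open>The projections of the shells to the span of \<open>u\<close>, \<open>v\<close>, \<open>w\<close>, namely \<open>(3w - u - v)/4\<close>,
  \<open>(u - v)/6 + w/2\<close> and \<open>(u - v)/2 + w/6\<close>.\<close>

definition proj112 :: "'n \<Rightarrow> real" where
  "proj112 i = (if i = a then 5/2 else if i = b then -1/2 else if i = c then 3/2 else 1/2)"

definition proj162 :: "'n \<Rightarrow> real" where
  "proj162 i = (if i = a then 2 else if i = b \<or> i = c then 0 else 2/3)"

definition proj162b :: "'n \<Rightarrow> real" where
  "proj162b i = (if i = a then -2/3 else if i = b \<or> i = c then -4/3 else 2/3)"

lemma card_R_fam:
  assumes "S \<in> fam P" shows "card (R \<inter> S) = 8 - card P"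
proof -
  have "R \<inter> S = S - P" "P \<subseteq> S" using assms by (auto simp: fam_def R_def)
  then show ?thesis using famD(2) [OF assms] by (simp add: card_Diff_subset)
qed

text \<open>T is the set of nonzero second binary digits. Modulo 4 the sum over an octad S is 2 |T
  \<inter> S|, so divisibility by 4 is the parity test for T.\<close>

lemma leechZ_if_even_pairs:
  assumes m: "\<And>i. even (Z i - m)" and tot: "8 dvd (sum Z UNIV - 4 * m)"
    and fam: "\<And>S. S \<in> fam {a, b} \<union> fam {a, c} \<Longrightarrow> 4 dvd sum Z S"
  shows "leechZ Z"
proof -
  define T where "T = {i. odd ((Z i - m) div 2)}"
  define n where "n i = (Z i - m) div 2 div 2" for i
  have Z: "Z i = m + 2 * of_bool (i \<in> T) + 4 * n i" for i
  proof -
    obtain h where h: "Z i - m = 2 * h" using m [of i] by blast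
    have "h = of_bool (odd h) + 2 * (h div 2)" by (cases "even h") (auto elim!: evenE oddE)
    then show ?thesis using h by (simp add: T_def n_def)
  qed
  have "sum Z UNIV - 4 * m = 20 * m + 2 * int (card T) + 4 * sum n UNIV"
    unfolding sum_leech_rep [OF Z] by simp
  then have tot': "8 dvd (20 * m + 2 * int (card T) + 4 * sum n UNIV)" using tot by (simp only:)
  have "T \<in> \<G>"
  proof (rule mem_G_if_even_pairs)
    show "even (card T)" using tot' by presburger
    fix S assume S: "S \<in> fam {a, b} \<union> fam {a, c}"
    have "sum Z S = (\<Sum>i\<in>S. m + 2 * of_bool (i \<in> T) + 4 * n i)" using Z by simp
    also have "\<dots> = int (card S) * m + 2 * (\<Sum>i\<in>S. of_bool (i \<in> T)) + 4 * sum n S"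
      by (simp only: sum.distrib sum_distrib_left [symmetric]) simp
    also have "(\<Sum>i\<in>S. of_bool (i \<in> T)) = int (card (T \<inter> S))"
      by (simp add: sum_of_bool_eq Int_commute)
    finally have "sum Z S = 8 * m + 2 * int (card (T \<inter> S)) + 4 * sum n S" using S famD(2) by auto
    then have "4 dvd (8 * m + 2 * int (card (T \<inter> S)) + 4 * sum n S)" using fam [OF S] by simp
    then show "even (card (T \<inter> S))" by presburger
  qed
  moreover obtain k where "card T = 4 * k" using four_dvd_card \<open>T \<in> \<G>\<close> by blast
  then have "8 dvd (20 * m + 8 * int k + 4 * sum n UNIV)" using tot' by simp
  then have "even (sum n UNIV - m)" by presburger
  ultimately show ?thesis by (intro leechZ_I [OF _ Z])
qed

text \<open>Both \<open>proj162\<close> and \<open>proj162b\<close> equal 2/3 on R, so one shift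
  makes x integral there. The special coordinates then depend on one integer s, whose residue modulo
  3 selects the shell.\<close>

lemma classify_112_core:
  fixes x :: "'n \<Rightarrow> real" and X :: "'n \<Rightarrow> int"
  assumes x: "perp x" and nrm: "(\<Sum>i\<in>UNIV. (x i)\<^sup>2) = 56 / 3"
    and fam: "\<And>S. S \<in> fam {a, b} \<union> fam {a, c} \<Longrightarrow> sum x (R \<inter> S) = 2 \<or> sum x (R \<inter> S) = -2"
    and X: "\<And>i. i \<in> R \<Longrightarrow> real_of_int (X i) = x i + 2 / 3" and m: "\<And>i. i \<in> R \<Longrightarrow> even (X i - m)"
  shows "(\<exists>Z\<in>shell 24 2 16. \<forall>i. x i = real_of_int (Z i) - proj162 i) \<or>
    (\<exists>Z\<in>shell 8 (-2) 16. \<forall>i. x i = real_of_int (Z i) - proj162b i)"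
proof -
  \<comment> \<open>14 = 21 * (2/3), so s is the sum of x over R.\<close>
  define s where "s = sum X R - 14"
  define Q where "Q = (\<Sum>i\<in>R. (X i)\<^sup>2)"
  have "real_of_int (sum X R) = (\<Sum>i\<in>R. x i + 2 / 3)" by (simp add: X)
  also have "\<dots> = sum x R + 14" by (simp add: sum.distrib card_R)
  finally have s: "real_of_int s = - 3 * x a" using x by (simp add: s_def perp_def)
  have "real_of_int Q = (\<Sum>i\<in>R. (x i + 2 / 3)\<^sup>2)" by (simp add: Q_def X)
  also have "\<dots> = (\<Sum>i\<in>R. (x i)\<^sup>2) + 2 * (2/3) * sum x R + (2/3)\<^sup>2 * (\<Sum>i\<in>R. 1)" by (rule sum_power2_shift)
  also have "\<dots> = 28 - 3 * (x a)\<^sup>2 - 4 * x a"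
    using nrm x unfolding norm_perp [OF x] by (simp add: perp_def card_R power2_eq_square field_simps)
  finally have "3 * real_of_int Q = 84 - (real_of_int s)\<^sup>2 + 4 * real_of_int s"
    unfolding s by (simp add: power2_eq_square)
  then have "real_of_int (3 * Q) = real_of_int (84 - s\<^sup>2 + 4 * s)" by simp
  then have Q: "3 * Q = 84 - s\<^sup>2 + 4 * s" by linarith
  have sm: "even (s - m)"
  proof -
    have "even (\<Sum>i\<in>R. X i - m)" using m by (intro dvd_sum) auto
    then have "even (sum X R - 21 * m)" by (simp add: sum_subtractf card_R)
    then show ?thesis unfolding s_def by presburger
  qed
  have famX: "sum X (R \<inter> S) = 2 \<or> sum X (R \<inter> S) = 6" if "S \<in> fam {a, b} \<union> fam {a, c}" for S
  proof -
    have "card (R \<inter> S) = 6" using that card_R_fam by fastforce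
    moreover have "real_of_int (sum X (R \<inter> S)) = (\<Sum>i\<in>R \<inter> S. x i + 2 / 3)" by (simp add: X)
    ultimately have "real_of_int (sum X (R \<inter> S)) = sum x (R \<inter> S) + 4" by (simp add: sum.distrib)
    then show ?thesis using fam [OF that] by linarith
  qed
  have split: "sum Z S = Z a + Z b + sum Z (R \<inter> S)"
    if "S \<in> fam {a, b} \<union> fam {a, c}" "Z b = Z c" for S and Z :: "'n \<Rightarrow> int"
  proof -
    have "S \<inter> {a, b, c} = {a, b} \<or> S \<inter> {a, b, c} = {a, c}" using that(1) by (auto simp: fam_def)
    moreover have "S = (S \<inter> {a, b, c}) \<union> (R \<inter> S)" by (auto simp: R_def)
    ultimately consider "S = {a, b} \<union> (R \<inter> S)" | "S = {a, c} \<union> (R \<inter> S)" by metis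
    then show ?thesis
    proof cases
      case 1
      then have "sum Z S = sum Z ({a, b} \<union> (R \<inter> S))" by simp
      also have "\<dots> = sum Z {a, b} + sum Z (R \<inter> S)" by (rule sum.union_disjoint) auto
      finally show ?thesis by simp
    next
      case 2
      then have "sum Z S = sum Z ({a, c} \<union> (R \<inter> S))" by simp
      also have "\<dots> = sum Z {a, c} + sum Z (R \<inter> S)" by (rule sum.union_disjoint) auto
      finally show ?thesis using that(2) by simp
    qed
  qed
  \<comment> \<open>The norm equation excludes the residue 2 for s.\<close>
  have "3 dvd s * (s - 4)"
  proof
    show "s * (s - 4) = 3 * (28 - Q)" using Q by (simp add: power2_eq_square algebra_simps)
  qed
  then have "3 dvd s \<or> 3 dvd (s - 4)" by (simp add: prime_dvd_mult_iff)
  then have "(\<exists>k. s = 3 * k) \<or> (\<exists>k. s = 3 * k + 1)" by presburger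
  then consider k where "s = 3 * k" | k where "s = 3 * k + 1" by blast
  then show ?thesis
  proof cases
    case (1 k)
    \<comment> \<open>This is x + \<open>proj162\<close>, since x_a = -k.\<close>
    define Z where "Z i = (if i = a then 2 - k else if i = b \<or> i = c then k else X i)" for i
    have ZR: "sum Z A = sum X A" "(\<Sum>i\<in>A. (Z i)\<^sup>2) = (\<Sum>i\<in>A. (X i)\<^sup>2)" if "A \<subseteq> R" for A
      using that by (auto intro!: sum.cong simp: Z_def R_def)
    have Zabc: "Z a = 2 - k" "Z b = k" "Z c = k" by (simp_all add: Z_def)
    have tot: "sum Z UNIV = 16 + 4 * k"
      unfolding sum_UNIV_R [of Z] Zabc ZR(1) [OF subset_refl] using 1 s_def by simp
    have "leechZ Z"
    proof (rule leechZ_if_even_pairs [of _ m])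
      show "even (Z i - m)" for i using m [of i] sm 1 by (auto simp: Z_def R_def)
      show "8 dvd (sum Z UNIV - 4 * m)" using sm 1 unfolding tot by presburger
      show "4 dvd sum Z S" if "S \<in> fam {a, b} \<union> fam {a, c}" for S
        using famX [OF that] split [OF that, of Z] by (auto simp: Zabc ZR)
    qed
    moreover have "(\<Sum>i\<in>UNIV. (Z i)\<^sup>2) = 32"
    proof -
      have "(\<Sum>i\<in>UNIV. (Z i)\<^sup>2) = (2 - k)\<^sup>2 + 2 * k\<^sup>2 + Q"
        unfolding sum_UNIV_R [of "\<lambda>i. (Z i)\<^sup>2"] Zabc ZR(2) [OF subset_refl] by (simp add: Q_def)
      moreover have "Q = 28 - 3 * k\<^sup>2 + 4 * k" using Q 1 by (simp add: power2_eq_square)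
      ultimately show ?thesis by (simp add: power2_eq_square algebra_simps)
    qed
    ultimately have "Z \<in> shell 24 2 16" unfolding shell_def using tot by (simp add: Zabc)
    moreover have "x i = real_of_int (Z i) - proj162 i" for i
      using s 1 x X [of i] by (auto simp: Z_def proj162_def perp_def R_def)
    ultimately show ?thesis by blast
  next
    case (2 k)
    \<comment> \<open>This is x + \<open>proj162b\<close>, since x_a = -k - 1/3.\<close>
    define Z where "Z i = (if i = a then - 1 - k else if i = b \<or> i = c then k - 1 else X i)" for i
    have ZR: "sum Z A = sum X A" "(\<Sum>i\<in>A. (Z i)\<^sup>2) = (\<Sum>i\<in>A. (X i)\<^sup>2)" if "A \<subseteq> R" for A
      using that by (auto intro!: sum.cong simp: Z_def R_def)
    have Zabc: "Z a = - 1 - k" "Z b = k - 1" "Z c = k - 1" by (simp_all add: Z_def)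
    have tot: "sum Z UNIV = 12 + 4 * k"
      unfolding sum_UNIV_R [of Z] Zabc ZR(1) [OF subset_refl] using 2 s_def by simp
    have "leechZ Z"
    proof (rule leechZ_if_even_pairs [of _ m])
      show "even (Z i - m)" for i using m [of i] sm 2 by (auto simp: Z_def R_def)
      show "8 dvd (sum Z UNIV - 4 * m)" using sm 2 unfolding tot by presburger
      show "4 dvd sum Z S" if "S \<in> fam {a, b} \<union> fam {a, c}" for S
        using famX [OF that] split [OF that, of Z] by (auto simp: Zabc ZR)
    qed
    moreover have "(\<Sum>i\<in>UNIV. (Z i)\<^sup>2) = 32"
    proof -
      have "(\<Sum>i\<in>UNIV. (Z i)\<^sup>2) = (- 1 - k)\<^sup>2 + 2 * (k - 1)\<^sup>2 + Q"
        unfolding sum_UNIV_R [of "\<lambda>i. (Z i)\<^sup>2"] Zabc ZR(2) [OF subset_refl] by (simp add: Q_def)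
      moreover have "Q = 29 - 3 * k\<^sup>2 + 2 * k" using Q 2 by (simp add: power2_eq_square algebra_simps)
      ultimately show ?thesis by (simp add: power2_eq_square algebra_simps)
    qed
    ultimately have "Z \<in> shell 8 (-2) 16" unfolding shell_def using tot by (simp add: Zabc)
    moreover have "x i = real_of_int (Z i) - proj162b i" for i
      using s 2 x X [of i] by (auto simp: Z_def proj162b_def perp_def R_def)
    ultimately show ?thesis by blast
  qed
qed

lemma perp_uminus: "perp x \<Longrightarrow> perp (\<lambda>i. - x i)"
  by (simp add: perp_def sum_negf)

lemma fam_pair_nonempty: "\<exists>S. S \<in> fam {a, b}"
  using moments_pair(1) [of "{a, b}"] by (metis insertI1 sum.empty ex_in_conv zero_neq_numeral)

text \<open>All coordinates on R are congruent modulo 2 and their triples are integers. The residue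
  r of the triples modulo 3 is nonzero by the norm, and the sign of x exchanges the residues 1 and
  2.\<close>

theorem classify_112:
  assumes x: "perp x" and nrm: "(\<Sum>i\<in>UNIV. (x i)\<^sup>2) = 56 / 3"
    and dots: "\<And>Y. Y \<in> shell 24 2 8 \<Longrightarrow> dotr Y x = 4 \<or> dotr Y x = -4"
  shows "\<exists>e\<in>{1, -1}. (\<exists>Z\<in>shell 24 2 16. \<forall>i. x i = e * (real_of_int (Z i) - proj162 i)) \<or>
    (\<exists>Z\<in>shell 8 (-2) 16. \<forall>i. x i = e * (real_of_int (Z i) - proj162b i))"
proof -
  have fam: "sum x (R \<inter> S) = 2 \<or> sum x (R \<inter> S) = -2" if "S \<in> fam {a, b} \<union> fam {a, c}" for S
  proof -
    from that consider "S \<in> fam {a, b}" | "S \<in> fam {a, c}" by blast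
    then show ?thesis
    proof cases
      case 1
      then have "oddv S a \<in> shell 24 2 8" by (simp add: shell_112)
      then show ?thesis using dots [of "oddv S a"] dotr_fam(2) [OF x 1] by auto
    next
      case 2
      then have "evenv S \<in> shell 24 2 8" by (simp add: shell_112)
      then show ?thesis using dots [of "evenv S"] dotr_fam(1) [OF x 2] by auto
    qed
  qed
  have diff: "\<exists>k::int. x i - x j = 2 * of_int k" if ij: "i \<in> R" "j \<in> R" for i j
  proof (cases "i = j")
    case True
    then show ?thesis by (intro exI [of _ 0]) simp
  next
    case False
    obtain O1 O2 O3 O4 where O: "O1 \<in> fam {a, c}" "O2 \<in> fam {a, c}" "O3 \<in> fam {a, b}" "O4 \<in> fam {a, b}"
      "sum x (R \<inter> O1) + sum x (R \<inter> O2) - sum x (R \<inter> O3) - sum x (R \<inter> O4) = 2 * (x i - x j)"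
      using octad_quadruple [OF ij False] by metis
    \<comment> \<open>All four octad sums are 2 modulo 4, so their alternating sum 2 (x i - x j) is
      a multiple of 4.\<close>
    have "\<exists>k::int. sum x (R \<inter> S) = 2 - 4 * of_int k" if "S \<in> fam {a, b} \<union> fam {a, c}" for S
      using fam [OF that] by (elim disjE) (auto intro: exI [of _ 0] exI [of _ 1])
    then obtain k1 k2 k3 k4 :: int where
      "sum x (R \<inter> O1) = 2 - 4 * of_int k1" "sum x (R \<inter> O2) = 2 - 4 * of_int k2"
      "sum x (R \<inter> O3) = 2 - 4 * of_int k3" "sum x (R \<inter> O4) = 2 - 4 * of_int k4"
      using O by (metis UnI1 UnI2)
    then have "x i - x j = 2 * of_int (k3 + k4 - k1 - k2)" using O(5) by simp
    then show ?thesis by blast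
  qed
  obtain i0 where i0: "i0 \<in> R" using card_R by (metis card.empty ex_in_conv zero_neq_numeral)
  define n where "n i = (SOME k::int. x i - x i0 = 2 * of_int k)" for i
  have n: "x i = x i0 + 2 * of_int (n i)" if "i \<in> R" for i
    using someI_ex [OF diff [OF that i0]] by (simp add: n_def)
  obtain S0 where S0: "S0 \<in> fam {a, b}" using fam_pair_nonempty by blast
  \<comment> \<open>An octad of this type has six points in R; halving its sum \<plusminus>2 makes 3
    x i0 an integer.\<close>
  have "sum x (R \<inter> S0) = (\<Sum>i\<in>R \<inter> S0. x i0 + 2 * of_int (n i))" by (intro sum.cong refl) (simp add: n)
  also have "\<dots> = 6 * x i0 + 2 * of_int (sum n (R \<inter> S0))"
    using card_R_fam [OF S0] by (simp add: sum.distrib sum_distrib_left)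
  finally have "\<exists>r::int. 3 * x i0 = of_int r"
    using fam [of S0] S0
    by (auto intro: exI [of _ "1 - sum n (R \<inter> S0)"] exI [of _ "- 1 - sum n (R \<inter> S0)"])
  then obtain r :: int where r: "3 * x i0 = of_int r" by blast
  define X where "X i = r + 6 * n i" for i
  have X: "x i = of_int (X i) / 3" if "i \<in> R" for i
    using n [OF that] r by (simp add: X_def)
  have sumX: "of_int (sum X R) = - 9 * x a"
  proof -
    have "of_int (sum X R) = (\<Sum>i\<in>R. 3 * x i)" by (simp add: X)
    also have "\<dots> = 3 * sum x R" by (simp add: sum_distrib_left)
    finally show ?thesis using x by (simp add: perp_def)
  qed
  have "of_int (\<Sum>i\<in>R. (X i)\<^sup>2) = (\<Sum>i\<in>R. 9 * (x i)\<^sup>2)" by (simp add: X power_divide)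
  also have "\<dots> = 9 * (\<Sum>i\<in>R. (x i)\<^sup>2)" by (simp add: sum_distrib_left)
  \<comment> \<open>504 = 27 * 56/3: the left side is 27 times the squared norm of x.\<close>
  finally have "of_int ((sum X R)\<^sup>2 + 3 * (\<Sum>i\<in>R. (X i)\<^sup>2)) = (504 :: real)"
    using nrm unfolding norm_perp [OF x] of_int_add of_int_mult of_int_power sumX
    by (simp add: power_mult_distrib)
  then have N: "(sum X R)\<^sup>2 + 3 * (\<Sum>i\<in>R. (X i)\<^sup>2) = 504" by linarith
  \<comment> \<open>Otherwise x is integral on R. Even entries would need a square of the form 14 -
    3 t, which is 2 modulo 3; odd entries give 3 * 189 > 504.\<close>
  have "r mod 3 \<noteq> 0"
  proof
    assume "r mod 3 = 0"
    then obtain q where q: "r = 3 * q" by auto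
    show False
    proof (cases "even q")
      case True
      then obtain l where l: "q = 2 * l" by blast
      define M where "M i = l + n i" for i
      have "X i = 6 * M i" for i by (simp add: X_def M_def q l)
      then have "36 * (sum M R)\<^sup>2 + 108 * (\<Sum>i\<in>R. (M i)\<^sup>2) = 504"
        using N by (simp add: power_mult_distrib flip: sum_distrib_left)
      then have e: "(sum M R)\<^sup>2 = 14 - 3 * (\<Sum>i\<in>R. (M i)\<^sup>2)" by simp
      have "0 \<le> (\<Sum>i\<in>R. (M i)\<^sup>2)" by (simp add: sum_nonneg)
      moreover have "0 \<le> 14 - 3 * (\<Sum>i\<in>R. (M i)\<^sup>2)" using e by (metis zero_le_power2)
      ultimately have "(\<Sum>i\<in>R. (M i)\<^sup>2) \<in> {0, 1, 2, 3, 4}" by auto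
      then have "(sum M R)\<^sup>2 \<in> {14, 11, 8, 5, 2}" using e by auto
      moreover have "\<bar>sum M R\<bar> < 4"
      proof (rule ccontr)
        assume "\<not> \<bar>sum M R\<bar> < 4"
        then have "4\<^sup>2 \<le> \<bar>sum M R\<bar>\<^sup>2" by (intro power_mono) auto
        then show False using \<open>(sum M R)\<^sup>2 \<in> {14, 11, 8, 5, 2}\<close> by auto
      qed
      then have "sum M R \<in> {-3, -2, -1, 0, 1, 2, 3}" by auto
      ultimately show False by auto
    next
      case False
      then obtain l where l: "q = 2 * l + 1" by (blast elim: oddE)
      have "9 \<le> (X i)\<^sup>2" for i
      proof -
        have "X i = 3 * (2 * (l + n i) + 1)" by (simp add: X_def q l)
        then have "3 \<le> \<bar>X i\<bar>" by presburger
        then have "3\<^sup>2 \<le> \<bar>X i\<bar>\<^sup>2" by (intro power_mono) auto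
        then show ?thesis by simp
      qed
      then have "(\<Sum>i\<in>R. 9) \<le> (\<Sum>i\<in>R. (X i)\<^sup>2)" by (intro sum_mono)
      then have "189 \<le> (\<Sum>i\<in>R. (X i)\<^sup>2)" by (simp add: card_R)
      moreover have "0 \<le> (sum X R)\<^sup>2" by simp
      ultimately show False using N by linarith
    qed
  qed
  then have "r mod 3 = 1 \<or> r mod 3 = 2" by presburger
  then consider q where "r = 3 * q + 1" | q where "r = 3 * q + 2" by (metis mult_div_mod_eq)
  then show ?thesis
  proof cases
    case (1 q)
    have "(\<exists>Z\<in>shell 24 2 16. \<forall>i. x i = real_of_int (Z i) - proj162 i) \<or>
      (\<exists>Z\<in>shell 8 (-2) 16. \<forall>i. x i = real_of_int (Z i) - proj162b i)"
    proof (rule classify_112_core [OF x nrm fam])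
      show "real_of_int (q + 1 + 2 * n i) = x i + 2 / 3" if "i \<in> R" for i
        using X [OF that] 1 by (simp add: X_def field_simps)
      show "even ((q + 1 + 2 * n i) - (q + 1))" for i by simp
    qed
    then show ?thesis by (intro bexI [of _ 1]) auto
  next
    case (2 q)
    have "(\<exists>Z\<in>shell 24 2 16. \<forall>i. - x i = real_of_int (Z i) - proj162 i) \<or>
      (\<exists>Z\<in>shell 8 (-2) 16. \<forall>i. - x i = real_of_int (Z i) - proj162b i)"
    proof (rule classify_112_core [OF perp_uminus [OF x]])
      show "(\<Sum>i\<in>UNIV. (- x i)\<^sup>2) = 56 / 3" using nrm by simp
      show "(\<Sum>i\<in>R \<inter> S. - x i) = 2 \<or> (\<Sum>i\<in>R \<inter> S. - x i) = - 2" if "S \<in> fam {a, b} \<union> fam {a, c}" for S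
        using fam [OF that] by (auto simp: sum_negf)
      show "real_of_int (- q - 2 * n i) = - x i + 2 / 3" if "i \<in> R" for i
        using X [OF that] 2 by (simp add: X_def field_simps)
      show "even ((- q - 2 * n i) - (- q))" for i by simp
    qed
    then have "(\<exists>Z\<in>shell 24 2 16. \<forall>i. x i = - 1 * (real_of_int (Z i) - proj162 i)) \<or>
      (\<exists>Z\<in>shell 8 (-2) 16. \<forall>i. x i = - 1 * (real_of_int (Z i) - proj162b i))"
      by (elim disjE bexE) (metis minus_minus mult_minus1)+
    then show ?thesis by (intro bexI [of _ "-1"]) auto
  qed
qed

text \<open>The vectors \<open>minusv j\<close> leave two values for each coordinate on R, so x is
  described by a set K. The other inner products are parity conditions on K, met by the octads that
  complete K with a and one of b, c.\<close>

lemma classify_162_core: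
  assumes x: "perp x" and xa: "x a = - 1 / 2"
    and dots: "\<And>Z. Z \<in> shell 24 2 16 \<union> shell 8 (-2) 16 \<Longrightarrow> dotr Z x = 4 \<or> dotr Z x = -4"
  shows "\<exists>e\<in>{1, -1}. \<exists>Y\<in>shell 24 2 8. \<forall>i. x i = e * (real_of_int (Y i) - proj112 i)"
proof -
  have xabc: "x b = 1 / 2" "x c = 1 / 2" "sum x R = 3 / 2" using x xa by (auto simp: perp_def)
  have xR: "x j = 3 / 2 \<or> x j = - 1 / 2" if "j \<in> R" for j
  proof -
    have "minusv j \<in> shell 24 2 16 \<union> shell 8 (-2) 16" using that by (simp add: shell_162)
    from dots [OF this] show ?thesis unfolding dotr_fam(4) [OF x] xa by auto
  qed
  define K where "K = {j \<in> R. x j = 3 / 2}"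
  have KR: "K \<subseteq> R" by (auto simp: K_def)
  have x_eq: "x i = - 1 / 2 + 2 * of_bool (i \<in> K)" if "i \<in> R" for i
    using xR [OF that] that by (auto simp: K_def)
  have sumx: "sum x A = - real (card A) / 2 + 2 * real (card (K \<inter> A))" if "A \<subseteq> R" for A
  proof -
    have "sum x A = (\<Sum>i\<in>A. - 1 / 2 + 2 * of_bool (i \<in> K))" using that x_eq by (intro sum.cong) auto
    also have "\<dots> = (\<Sum>i\<in>A. - 1 / 2) + 2 * (\<Sum>i\<in>A. of_bool (i \<in> K))"
      by (simp only: sum.distrib sum_distrib_left)
    also have "(\<Sum>i\<in>A. of_bool (i \<in> K)) = real (card (K \<inter> A))" by (simp add: sum_of_bool_eq Int_commute)
    finally show ?thesis by simp
  qed
  have cardK: "card K = 6"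
    using sumx [OF subset_refl] xabc(3) KR by (simp add: card_R Int_absorb2)
  have KS: "K \<inter> (R \<inter> S) = K \<inter> S" for S using KR by auto
  note sumS = sumx [of "R \<inter> _", OF Int_lower1, unfolded KS]
  have odd_a: "odd (card (K \<inter> S))" if "S \<in> fam {a}" for S
  proof -
    have "evenv S \<in> shell 24 2 16 \<union> shell 8 (-2) 16" using that by (simp add: shell_162)
    from dots [OF this] have "card (K \<inter> S) = 1 \<or> card (K \<inter> S) = 3"
      unfolding dotr_fam(3) [OF x that] xa sumS card_R_fam [OF that] by auto
    then show ?thesis by auto
  qed
  have even_abc: "even (card (K \<inter> S))" if "S \<in> fam {a, b, c}" for S
  proof -
    have "oddv S a \<in> shell 24 2 16 \<union> shell 8 (-2) 16" using that by (simp add: shell_162)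
    from dots [OF this] have "card (K \<inter> S) = 0 \<or> card (K \<inter> S) = 2"
      unfolding dotr_fam(5) [OF x that] xa sumS card_R_fam [OF that] by auto
    then show ?thesis by auto
  qed
  have odd_bc: "odd (card (K \<inter> S))" if "S \<in> fam {b, c}" for S
  proof -
    have "negv S \<in> shell 24 2 16 \<union> shell 8 (-2) 16" using that by (simp add: shell_162b)
    from dots [OF this] have "card (K \<inter> S) = 1 \<or> card (K \<inter> S) = 3"
      unfolding dotr_fam(6) [OF x that] xa sumS card_R_fam [OF that] by auto
    then show ?thesis by auto
  qed
  have nK: "a \<notin> K" "b \<notin> K" "c \<notin> K" using KR by auto
  \<comment> \<open>Adding a and b makes the odd intersections with octads of types {a} and {b, c}
    even and keeps those of type {a, b, c} even.\<close>
  let ?X = "insert a (insert b K)"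
  have cardX: "card ?X = 8" using nK cardK by simp
  have "?X \<in> \<G> \<or> {b, c} \<triangle> ?X \<in> \<G>"
  proof (rule mem_G_if_even_others)
    show "even (card ?X)" by (simp add: cardX)
    fix S assume "S \<in> fam {a, b, c} \<union> fam {a} \<union> fam {b, c}"
    then consider "S \<in> fam {a, b, c}" | "S \<in> fam {a}" | "S \<in> fam {b, c}" by blast
    then show "even (card (?X \<inter> S))"
    proof cases
      case 1
      then have "?X \<inter> S = insert a (insert b (K \<inter> S))" using fam_mem [OF 1] by auto
      then show ?thesis using even_abc [OF 1] nK by simp
    next
      case 2
      then have "?X \<inter> S = insert a (K \<inter> S)" using fam_mem [OF 2] by auto
      then show ?thesis using odd_a [OF 2] nK by simp
    next
      case 3
      then have "?X \<inter> S = insert b (K \<inter> S)" using fam_mem [OF 3] by auto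
      then show ?thesis using odd_bc [OF 3] nK by simp
    qed
  qed
  moreover have "{b, c} \<triangle> ?X = insert a (insert c K)" using nK by auto
  ultimately consider "?X \<in> \<G>" | "insert a (insert c K) \<in> \<G>" by auto
  then show ?thesis
  proof cases
    case 1
    then have "?X \<in> fam {a, b}" using cardX nK by (auto simp: fam_def octads_def)
    then have "oddv ?X a \<in> shell 24 2 8" by (simp add: shell_112)
    moreover have "x i = - 1 * (real_of_int (oddv ?X a i) - proj112 i)" for i
      using xabc xa nK x_eq [of i] by (cases "i \<in> R") (auto simp: oddv_def proj112_def R_def)
    ultimately show ?thesis by blast
  next
    case 2
    then have "insert a (insert c K) \<in> fam {a, c}" using cardK nK by (auto simp: fam_def octads_def)
    then have "evenv (insert a (insert c K)) \<in> shell 24 2 8" by (simp add: shell_112)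
    moreover have "x i = 1 * (real_of_int (evenv (insert a (insert c K)) i) - proj112 i)" for i
      using xabc xa nK x_eq [of i] by (cases "i \<in> R") (auto simp: evenv_def proj112_def R_def)
    ultimately show ?thesis by blast
  qed
qed

lemma dotr_uminus: "dotr X (\<lambda>i. - x i) = - dotr X x"
  by (simp add: dotr_def sum_negf)

text \<open>The vector \<open>minusv a\<close> of the third shell fixes x_a up to sign; replacing x
  by -x normalizes it.\<close>

theorem classify_162:
  assumes x: "perp x"
    and dots: "\<And>Z. Z \<in> shell 24 2 16 \<union> shell 8 (-2) 16 \<Longrightarrow> dotr Z x = 4 \<or> dotr Z x = -4"
  shows "\<exists>e\<in>{1, -1}. \<exists>Y\<in>shell 24 2 8. \<forall>i. x i = e * (real_of_int (Y i) - proj112 i)"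
proof -
  have "minusv a \<in> shell 24 2 16 \<union> shell 8 (-2) 16" by (simp add: shell_162b)
  from dots [OF this] have "x a = - 1 / 2 \<or> x a = 1 / 2" unfolding dotr_fam(4) [OF x] by auto
  then show ?thesis
  proof
    assume "x a = - 1 / 2"
    then show ?thesis using classify_162_core [OF x _ dots] by blast
  next
    assume "x a = 1 / 2"
    then have xa: "- x a = - 1 / 2" by simp
    have "dotr Z (\<lambda>i. - x i) = 4 \<or> dotr Z (\<lambda>i. - x i) = - 4" if "Z \<in> shell 24 2 16 \<union> shell 8 (-2) 16" for Z
      using dots [OF that] unfolding dotr_uminus by linarith
    then have "\<exists>e\<in>{1, -1}. \<exists>Y\<in>shell 24 2 8. \<forall>i. - x i = e * (real_of_int (Y i) - proj112 i)"
      by (rule classify_162_core [OF perp_uminus [OF x] xa])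
    then obtain e Y where "e \<in> {1, -1}" "Y \<in> shell 24 2 8" "\<And>i. - x i = e * (real_of_int (Y i) - proj112 i)"
      by blast
    then show ?thesis
      by (intro bexI [of _ "- e"] bexI [of _ Y]) (auto simp: minus_equation_iff [of "x _"])
  qed
qed

end

section \<open>Polarization bounds from cubic interpolation\<close>

lemma Rolle_zero:
  fixes f f' :: "real \<Rightarrow> real"
  assumes "a < b" "f a = 0" "f b = 0" "continuous_on {a..b} f"
    and der: "\<And>x. a < x \<Longrightarrow> x < b \<Longrightarrow> (f has_real_derivative f' x) (at x)"
  shows "\<exists>z. a < z \<and> z < b \<and> f' z = 0"
proof -
  have "\<exists>z. a < z \<and> z < b \<and> DERIV f z :> 0"
    using assms(1-4) der by (intro Rolle) (auto simp: real_differentiable_def)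
  then obtain z where z: "a < z" "z < b" "DERIV f z :> 0" by blast
  moreover have "f' z = 0" using DERIV_unique [OF der [OF z(1,2)] z(3)] .
  ultimately show ?thesis by blast
qed

lemma Rolle_zero_inside:
  fixes f f' :: "real \<Rightarrow> real"
  assumes "a < b" "f a = 0" "f b = 0" "{a, b} \<subseteq> {l<..<u}"
    and der: "\<And>x. x \<in> {l<..<u} \<Longrightarrow> (f has_real_derivative f' x) (at x)"
  shows "\<exists>z. a < z \<and> z < b \<and> f' z = 0"
proof (rule Rolle_zero [OF assms(1-3)])
  show "continuous_on {a..b} f"
  proof (rule continuous_at_imp_continuous_on, rule ballI)
    fix x assume "x \<in> {a..b}"
    then have "x \<in> {l<..<u}" using assms(4) by auto
    then show "isCont f x" using der by (blast intro: DERIV_isCont)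
  qed
  show "(f has_real_derivative f' x) (at x)" if "a < x" "x < b" for x
    using that assms(4) by (intro der) auto
qed

lemma four_zeros_third_derivative:
  fixes f :: "nat \<Rightarrow> real \<Rightarrow> real"
  assumes der: "\<And>j x. j < 3 \<Longrightarrow> x \<in> {l<..<u} \<Longrightarrow> (f j has_real_derivative f (Suc j) x) (at x)"
    and z: "z1 < z2" "z2 < z3" "z3 < z4" "l < z1" "z4 < u" "f 0 z1 = 0" "f 0 z2 = 0" "f 0 z3 = 0" "f 0 z4 = 0"
  shows "\<exists>x\<in>{l<..<u}. f 3 x = 0"
proof -
  have R: "\<exists>z. a < z \<and> z < b \<and> f (Suc j) z = 0"
    if "j < 3" "a < b" "f j a = 0" "f j b = 0" "l < a" "b < u" for j a b
    using that by (intro Rolle_zero_inside [where l = l and u = u and f = "f j"] der) auto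
  obtain y1 where y1: "z1 < y1" "y1 < z2" "f (Suc 0) y1 = 0" using R [of 0 z1 z2] z by auto
  obtain y2 where y2: "z2 < y2" "y2 < z3" "f (Suc 0) y2 = 0" using R [of 0 z2 z3] z by auto
  obtain y3 where y3: "z3 < y3" "y3 < z4" "f (Suc 0) y3 = 0" using R [of 0 z3 z4] z by auto
  obtain x1 where x1: "y1 < x1" "x1 < y2" "f (Suc (Suc 0)) x1 = 0" using R [of "Suc 0" y1 y2] y1 y2 z by auto
  obtain x2 where x2: "y2 < x2" "x2 < y3" "f (Suc (Suc 0)) x2 = 0" using R [of "Suc 0" y2 y3] y2 y3 z by auto
  obtain x where x: "x1 < x" "x < x2" "f (Suc (Suc (Suc 0))) x = 0"
    using R [of "Suc (Suc 0)" x1 x2] x1 x2 y1 y2 y3 z by auto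
  then have "x \<in> {l<..<u}" "f 3 x = 0" using x1 x2 y1 y3 z by (auto simp: numeral_3_eq_3)
  then show ?thesis by blast
qed

text \<open>Even and odd parts decouple at symmetric nodes: A and C solve one two-by-two system, B
  and E the other.\<close>

lemma hermite_cubic_exists:
  fixes s y1 y2 d1 d2 :: real
  assumes "s \<noteq> 0"
  shows "\<exists>A B C E. A + B * s + C * s\<^sup>2 + E * s ^ 3 = y1 \<and> A - B * s + C * s\<^sup>2 - E * s ^ 3 = y2 \<and>
    B + 2 * C * s + 3 * E * s\<^sup>2 = d1 \<and> B - 2 * C * s + 3 * E * s\<^sup>2 = d2"
proof -
  define q where "q = (y1 - y2) / (2 * s)"
  define E where "E = ((d1 + d2) / 2 - q) / (2 * s\<^sup>2)"
  define B where "B = q - E * s\<^sup>2"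
  define C where "C = (d1 - d2) / (4 * s)"
  define A where "A = (y1 + y2) / 2 - C * s\<^sup>2"
  have "q * s = (y1 - y2) / 2" using assms by (simp add: q_def)
  then have 1: "B * s + E * s ^ 3 = (y1 - y2) / 2"
    by (simp add: B_def algebra_simps power2_eq_square power3_eq_cube)
  have 2: "2 * (E * s\<^sup>2) = (d1 + d2) / 2 - q" using assms by (simp add: E_def)
  have 3: "2 * C * s = (d1 - d2) / 2" using assms by (simp add: C_def)
  have "A + B * s + C * s\<^sup>2 + E * s ^ 3 = y1" "A - B * s + C * s\<^sup>2 - E * s ^ 3 = y2"
    using 1 by (simp_all add: A_def field_simps)
  moreover have "B + 3 * E * s\<^sup>2 = (d1 + d2) / 2" using 2 by (simp add: B_def)
  then have "B + 2 * C * s + 3 * E * s\<^sup>2 = d1" "B - 2 * C * s + 3 * E * s\<^sup>2 = d2"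
    using 3 by (simp_all add: field_simps)
  ultimately show ?thesis by blast
qed

text \<open>The error of Hermite interpolation at the double nodes \<open>\<plusminus>s\<close> is a positive multiple of
  \<open>(t\<^sup>2 - s\<^sup>2)\<^sup>2\<close> when the fourth derivative is positive. The point \<open>t\<close> may be an endpoint, since
  Rolle's theorem only needs continuity there.\<close>

lemma hermite_cubic_below:
  fixes D :: "nat \<Rightarrow> real \<Rightarrow> real"
  assumes der: "\<And>j x. j < 4 \<Longrightarrow> x \<in> {-1<..<1} \<Longrightarrow> (D j has_real_derivative D (Suc j) x) (at x)"
    and pos: "\<And>x. x \<in> {-1<..<1} \<Longrightarrow> 0 < D 4 x"
    and s: "0 < s" "s < 1"
    and p: "A + B * s + C * s\<^sup>2 + E * s ^ 3 = D 0 s" "A - B * s + C * s\<^sup>2 - E * s ^ 3 = D 0 (- s)"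
      "B + 2 * C * s + 3 * E * s\<^sup>2 = D 1 s" "B - 2 * C * s + 3 * E * s\<^sup>2 = D 1 (- s)"
    and t: "t \<in> {-1..1}" "t \<noteq> s" "t \<noteq> - s" and cont: "continuous_on (insert t {-1<..<1}) (D 0)"
  shows "A + B * t + C * t\<^sup>2 + E * t ^ 3 < D 0 t"
proof -
  have ts: "t\<^sup>2 - s\<^sup>2 \<noteq> 0" using t by (simp add: power2_eq_iff)
  \<comment> \<open>Chosen so that f vanishes at t too; the claim amounts to 0 < \<kappa>.\<close>
  define \<kappa> where "\<kappa> = (D 0 t - (A + B * t + C * t\<^sup>2 + E * t ^ 3)) / (t\<^sup>2 - s\<^sup>2)\<^sup>2"
  define f where "f x = D 0 x - (A + B * x + C * x\<^sup>2 + E * x ^ 3) - \<kappa> * (x\<^sup>2 - s\<^sup>2)\<^sup>2" for x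
  \<comment> \<open>\<open>g j\<close> is the derivative of f of order j + 1. The list starts there
    because f need not be differentiable at t when t is an endpoint.\<close>
  define g where "g j x = (if j = 0 then D 1 x - (B + 2 * C * x + 3 * E * x\<^sup>2) - 4 * \<kappa> * x * (x\<^sup>2 - s\<^sup>2)
    else if j = 1 then D 2 x - (2 * C + 6 * E * x) - \<kappa> * (12 * x\<^sup>2 - 4 * s\<^sup>2)
    else if j = 2 then D 3 x - 6 * E - 24 * \<kappa> * x else D 4 x - 24 * \<kappa>)" for j :: nat and x
  have der_f: "(f has_real_derivative g 0 x) (at x)" if "x \<in> {-1<..<1}" for x
  proof -
    have d: "(D 0 has_real_derivative D 1 x) (at x)" using der [of 0 x] that by simp
    show ?thesis unfolding f_def g_def
      by (rule derivative_eq_intros d refl | simp del: One_nat_def)+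
  qed
  have der_g: "(g j has_real_derivative g (Suc j) x) (at x)" if "j < 3" "x \<in> {-1<..<1}" for j x
  proof -
    have d: "(D 1 has_real_derivative D 2 x) (at x)" "(D 2 has_real_derivative D 3 x) (at x)"
      "(D 3 has_real_derivative D 4 x) (at x)"
      using der [of 1 x] der [of 2 x] der [of 3 x] that by (simp_all add: numeral_eq_Suc)
    from \<open>j < 3\<close> consider "j = 0" | "j = 1" | "j = 2" by linarith
    then show ?thesis
    proof cases
      case 1
      show ?thesis unfolding 1 g_def
        by ((rule derivative_eq_intros d refl | simp del: One_nat_def)+, (simp add: algebra_simps power2_eq_square power3_eq_cube)?)
    next
      case 2
      show ?thesis unfolding 2 g_def
        by (rule derivative_eq_intros d refl | simp del: One_nat_def)+
    next
      case 3
      show ?thesis unfolding 3 g_def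
        by (rule derivative_eq_intros d refl | simp del: One_nat_def)+
    qed
  qed
  have f0: "f t = 0" "f s = 0" "f (- s) = 0"
    using ts p by (simp_all add: f_def \<kappa>_def)
  have g0: "g 0 s = 0" "g 0 (- s) = 0" using p by (simp_all add: g_def)
  have cont_f: "continuous_on {l..r} f" if "{l..r} \<subseteq> insert t {-1<..<1}" for l r
    unfolding f_def by (intro continuous_intros continuous_on_subset [OF cont that])
  have Rf: "\<exists>z. l < z \<and> z < r \<and> g 0 z = 0"
    if "l < r" "f l = 0" "f r = 0" "l = t \<or> -1 < l" "r = t \<or> r < 1" for l r
  proof (rule Rolle_zero [OF that(1-3) cont_f])
    show "{l..r} \<subseteq> insert t {-1<..<1}"
    proof
      fix x assume "x \<in> {l..r}"
      then have "x = t \<or> -1 < x \<and> x < 1" using that t(1) by (smt (verit) atLeastAtMost_iff)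
      then show "x \<in> insert t {-1<..<1}" by auto
    qed
    show "(f has_real_derivative g 0 x) (at x)" if "l < x" "x < r" for x
      using that \<open>l = t \<or> -1 < l\<close> \<open>r = t \<or> r < 1\<close> t(1) by (intro der_f) auto
  qed
  have four: "\<exists>x\<in>{-1<..<1}. g 3 x = 0"
    if "z1 < z2" "z2 < z3" "z3 < z4" "-1 < z1" "z4 < 1" "g 0 z1 = 0" "g 0 z2 = 0" "g 0 z3 = 0" "g 0 z4 = 0"
    for z1 z2 z3 z4
    by (rule four_zeros_third_derivative [where f = g and l = "-1" and u = 1, OF der_g that])
  have "\<exists>x\<in>{-1<..<1}. g 3 x = 0"
  \<comment> \<open>Rolle between the zeros t, s, -s of f gives two zeros of \<open>g 0\<close>;
    with the double nodes \<plusminus>s there are four. The constant 24 below is the fourth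
    derivative of (x^2 - s^2)^2.\<close>
  proof -
    consider "t < - s" | "- s < t" "t < s" | "s < t" using t by linarith
    then show ?thesis
    proof cases
      case 1
      obtain y where y: "t < y" "y < - s" "g 0 y = 0" using Rf [of t "- s"] 1 f0 s t by auto
      obtain z where z: "- s < z" "z < s" "g 0 z = 0" using Rf [of "- s" s] f0 s t by auto
      show ?thesis
        using y z g0 s t by (intro four [of y "- s" z s]) auto
    next
      case 2
      obtain y where y: "- s < y" "y < t" "g 0 y = 0" using Rf [of "- s" t] 2 f0 s t by auto
      obtain z where z: "t < z" "z < s" "g 0 z = 0" using Rf [of t s] 2 f0 s t by auto
      show ?thesis
        using y z g0 s t by (intro four [of "- s" y z s]) auto
    next
      case 3
      obtain y where y: "- s < y" "y < s" "g 0 y = 0" using Rf [of "- s" s] f0 s t by auto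
      obtain z where z: "s < z" "z < t" "g 0 z = 0" using Rf [of s t] 3 f0 s t by auto
      show ?thesis
        using y z g0 s t by (intro four [of "- s" y s z]) auto
    qed
  qed
  then obtain x where x: "x \<in> {-1<..<1}" "g 3 x = 0" by blast
  then have "24 * \<kappa> = D 4 x" by (simp add: g_def)
  then have "0 < \<kappa>" using pos [OF x(1)] by simp
  then show ?thesis using ts by (simp add: \<kappa>_def zero_less_divide_iff)
qed

lemma potential_cubic_minorant:
  assumes h: "potential h" "pos_nth_deriv 4 h" and s: "0 < s" "s < 1"
  shows "\<exists>A B C E. \<forall>t\<in>{-1..1}. ereal (A + B * t + C * t\<^sup>2 + E * t ^ 3) \<le> h t \<and>
    (h t = ereal (A + B * t + C * t\<^sup>2 + E * t ^ 3) \<longleftrightarrow> t = s \<or> t = - s)"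
proof -
  define H where "H t = real_of_ereal (h t)" for t
  define D where "D j = (deriv ^^ j) H" for j
  have fin: "h t = ereal (H t)" if "t \<in> {-1..1}" "h t \<noteq> \<infinity>" for t
    using h(1) that by (cases "h t") (auto simp: potential_def H_def)
  have fin': "h t = ereal (H t)" if "t \<in> {-1<..<1}" for t
    using h(1) that by (intro fin) (auto simp: potential_def)
  have der: "(D j has_real_derivative D (Suc j) x) (at x)" if "j < 4" "x \<in> {-1<..<1}" for j x
  proof -
    have "D j field_differentiable at x"
      using h(2) that unfolding pos_nth_deriv_def D_def H_def by blast
    then show ?thesis by (simp add: D_def DERIV_deriv_iff_field_differentiable)
  qed
  have pos: "0 < D 4 x" if "x \<in> {-1<..<1}" for x
    using h(2) that unfolding pos_nth_deriv_def D_def H_def by blast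
  obtain A B C E where p: "A + B * s + C * s\<^sup>2 + E * s ^ 3 = D 0 s" "A - B * s + C * s\<^sup>2 - E * s ^ 3 = D 0 (- s)"
      "B + 2 * C * s + 3 * E * s\<^sup>2 = D 1 s" "B - 2 * C * s + 3 * E * s\<^sup>2 = D 1 (- s)"
    using hermite_cubic_exists [of s "D 0 s" "D 0 (- s)" "D 1 s" "D 1 (- s)"] s by auto
  have D0: "D 0 = H" by (simp add: D_def)
  have "ereal (A + B * t + C * t\<^sup>2 + E * t ^ 3) \<le> h t \<and>
    (h t = ereal (A + B * t + C * t\<^sup>2 + E * t ^ 3) \<longleftrightarrow> t = s \<or> t = - s)" if t: "t \<in> {-1..1}" for t
  proof (cases "t = s \<or> t = - s")
    case True
    then have "h t = ereal (H t)" "A + B * t + C * t\<^sup>2 + E * t ^ 3 = H t"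
      using s p fin' by (auto simp: D0)
    then show ?thesis using True by simp
  next
    case ns: False
    show ?thesis
    proof (cases "h t = \<infinity>")
      case True
      then show ?thesis using ns by simp
    next
      case False
      have "continuous_on (insert t {-1<..<1}) h"
        using h(1) t by (auto simp: potential_def intro: continuous_on_subset)
      moreover have "h ` insert t {-1<..<1} \<subseteq> UNIV - {\<infinity>, - \<infinity>}"
        using fin [OF t False] fin' by auto
      ultimately have "continuous_on (insert t {-1<..<1}) (\<lambda>x. real_of_ereal (h x))"
        using continuous_on_compose2 [OF continuous_on_real] by blast
      then have "continuous_on (insert t {-1<..<1}) (D 0)" by (simp add: D0 H_def [abs_def])
      then have "A + B * t + C * t\<^sup>2 + E * t ^ 3 < H t"
        using hermite_cubic_below [OF der pos s p t] ns by (simp add: D0)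
      then show ?thesis using fin [OF t False] ns by simp
    qed
  qed
  then show ?thesis by blast
qed

lemma inner_in_interval:
  assumes "x \<in> perp_sphere W" "y \<in> perp_sphere W"
  shows "x \<bullet> y \<in> {-1..1}"
  using Cauchy_Schwarz_ineq2 [of x y] assms by (auto simp: perp_sphere_def)

text \<open>The moment conditions make the potential of the cubic minorant constant on the sphere.\<close>

proposition polarization_of_design:
  fixes W :: "'a::euclidean_space set"
  assumes h: "potential h" "pos_nth_deriv 4 h" and s: "0 < s" "s < 1"
    and Z: "finite Z" "Z \<subseteq> perp_sphere W"
    and mom: "\<And>x. x \<in> perp_sphere W \<Longrightarrow> (\<Sum>z\<in>Z. x \<bullet> z) = 0"
      "\<And>x. x \<in> perp_sphere W \<Longrightarrow> (\<Sum>z\<in>Z. (x \<bullet> z)\<^sup>2) = real (card Z) * s\<^sup>2"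
      "\<And>x. x \<in> perp_sphere W \<Longrightarrow> (\<Sum>z\<in>Z. (x \<bullet> z) ^ 3) = 0"
    and M: "M = {x \<in> perp_sphere W. \<forall>z\<in>Z. x \<bullet> z = s \<or> x \<bullet> z = - s}" "M \<noteq> {}"
  shows "minimizers h W Z = M"
    and "polarization h W Z = ereal (real (card Z) / 2 * (real_of_ereal (h (- s)) + real_of_ereal (h s)))"
proof -
  obtain A B C E where p: "\<And>t. t \<in> {-1..1} \<Longrightarrow> ereal (A + B * t + C * t\<^sup>2 + E * t ^ 3) \<le> h t"
    "\<And>t. t \<in> {-1..1} \<Longrightarrow> h t = ereal (A + B * t + C * t\<^sup>2 + E * t ^ 3) \<longleftrightarrow> t = s \<or> t = - s"
    using potential_cubic_minorant [OF h s] by blast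
  define P where "P t = A + B * t + C * t\<^sup>2 + E * t ^ 3" for t
  define m where "m = real (card Z) * (A + C * s\<^sup>2)"
  have sumP: "(\<Sum>z\<in>Z. P (x \<bullet> z)) = m" if "x \<in> perp_sphere W" for x
  proof -
    have "(\<Sum>z\<in>Z. P (x \<bullet> z)) = real (card Z) * A + B * (\<Sum>z\<in>Z. x \<bullet> z) + C * (\<Sum>z\<in>Z. (x \<bullet> z)\<^sup>2) + E * (\<Sum>z\<in>Z. (x \<bullet> z) ^ 3)"
      unfolding P_def by (simp add: sum.distrib flip: sum_distrib_left)
    then show ?thesis using mom [OF that] by (simp add: m_def algebra_simps)
  qed
  have I: "x \<bullet> z \<in> {-1..1}" if "x \<in> perp_sphere W" "z \<in> Z" for x z
    using inner_in_interval that Z by blast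
  have low: "ereal m \<le> U_pot h x Z" if x: "x \<in> perp_sphere W" for x
  proof -
    have "ereal m = (\<Sum>z\<in>Z. ereal (P (x \<bullet> z)))" using sumP [OF x] by simp
    also have "\<dots> \<le> U_pot h x Z"
      unfolding U_pot_def P_def by (intro sum_mono p I x)
    finally show ?thesis .
  qed
  have eq: "U_pot h x Z = ereal m \<longleftrightarrow> x \<in> M" if x: "x \<in> perp_sphere W" for x
  proof
    assume "x \<in> M"
    then have "h (x \<bullet> z) = ereal (P (x \<bullet> z))" if "z \<in> Z" for z
      using that p(2) [OF I [OF x that]] by (auto simp: M P_def)
    then have "U_pot h x Z = (\<Sum>z\<in>Z. ereal (P (x \<bullet> z)))" unfolding U_pot_def by simp
    then show "U_pot h x Z = ereal m" using sumP [OF x] by simp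
  next
    assume U: "U_pot h x Z = ereal m"
    show "x \<in> M"
    proof (rule ccontr)
      assume "x \<notin> M"
      then obtain z where z: "z \<in> Z" "\<not> (x \<bullet> z = s \<or> x \<bullet> z = - s)" using x by (auto simp: M)
      then have lt: "ereal (P (x \<bullet> z)) < h (x \<bullet> z)"
        using p [OF I [OF x z(1)]] by (simp add: P_def order_less_le)
      have "(\<Sum>y\<in>Z - {z}. ereal (P (x \<bullet> y))) \<le> (\<Sum>y\<in>Z - {z}. h (x \<bullet> y))"
        unfolding P_def by (intro sum_mono p I x) auto
      then have "ereal (\<Sum>y\<in>Z - {z}. P (x \<bullet> y)) \<le> (\<Sum>y\<in>Z - {z}. h (x \<bullet> y))" by simp
      \<comment> \<open>The lower bound for the other terms is finite, so the strict inequality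
        survives addition even if some values of h are infinite.\<close>
      then have "ereal (P (x \<bullet> z)) + ereal (\<Sum>y\<in>Z - {z}. P (x \<bullet> y)) < h (x \<bullet> z) + (\<Sum>y\<in>Z - {z}. h (x \<bullet> y))"
        using lt by (cases "h (x \<bullet> z)"; cases "\<Sum>y\<in>Z - {z}. h (x \<bullet> y)") auto
      moreover have "P (x \<bullet> z) + (\<Sum>y\<in>Z - {z}. P (x \<bullet> y)) = m"
        using sumP [OF x] Z z by (simp add: sum.remove)
      moreover have "h (x \<bullet> z) + (\<Sum>y\<in>Z - {z}. h (x \<bullet> y)) = U_pot h x Z"
        unfolding U_pot_def using Z z by (simp add: sum.remove)
      ultimately show False using U by simp
    qed
  qed
  have MS: "M \<subseteq> perp_sphere W" by (auto simp: M)
  obtain x0 where x0: "x0 \<in> M" using M(2) by blast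
  then have U0: "U_pot h x0 Z = ereal m" using eq MS by blast
  show "minimizers h W Z = M"
  proof (intro equalityI subsetI)
    fix x assume "x \<in> minimizers h W Z"
    then have x: "x \<in> perp_sphere W" "U_pot h x Z \<le> U_pot h x0 Z"
      using x0 MS by (auto simp: minimizers_def)
    then have "U_pot h x Z = ereal m" using low [OF x(1)] U0 by simp
    then show "x \<in> M" using eq x by blast
  next
    fix x assume "x \<in> M"
    then have "x \<in> perp_sphere W" "U_pot h x Z = ereal m" using MS eq by auto
    then show "x \<in> minimizers h W Z" using low by (auto simp: minimizers_def)
  qed
  have "polarization h W Z = ereal m"
    unfolding polarization_def
    by (rule antisym) (use U0 x0 MS in \<open>auto intro: INF_lower2 INF_greatest low\<close>)
  moreover have "h s = ereal (P s)" "h (- s) = ereal (P (- s))"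
    using p(2) [of s] p(2) [of "- s"] s by (auto simp: P_def)
  then have "m = real (card Z) / 2 * (real_of_ereal (h (- s)) + real_of_ereal (h s))"
    by (simp add: m_def P_def field_simps power3_eq_cube)
  ultimately show "polarization h W Z = ereal (real (card Z) / 2 * (real_of_ereal (h (- s)) + real_of_ereal (h s)))"
    by simp
qed

section \<open>The codes in Euclidean space\<close>

definition supp :: "bit ^ 'n \<Rightarrow> 'n set" where
  "supp c = {i. c $ i \<noteq> 0}"

lemma supp_add: "supp (c + d) = supp c \<triangle> supp d"
proof -
  have "x + y \<noteq> 0 \<longleftrightarrow> (x \<noteq> 0) \<noteq> (y \<noteq> 0)" for x y :: bit
    by (cases x; cases y) auto
  then show ?thesis by (auto simp: supp_def)
qed

lemma inj_supp: "inj supp"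
proof (rule injI)
  fix c d :: "bit ^ 'n" assume eq: "supp c = supp d"
  have "c $ i = d $ i" for i
  proof -
    have "c $ i \<noteq> 0 \<longleftrightarrow> d $ i \<noteq> 0" using eq by (auto simp: supp_def)
    then show ?thesis by (cases "c $ i"; cases "d $ i") auto
  qed
  then show "c = d" by (simp add: vec_eq_iff)
qed

text \<open>Over two scalars a linear combination is a subset sum, and independence of a basis makes
  different subsets give different sums.\<close>

lemma card_binary_subspace:
  fixes V :: "(bit ^ 'n) set"
  assumes "vec.subspace V" "vec.dim V \<noteq> 0"
  shows "card V = 2 ^ vec.dim V"
proof -
  obtain B where B: "B \<subseteq> V" "vec.independent B" "V \<subseteq> vec.span B" "card B = vec.dim V"
    by (rule vec.basis_exists)
  \<comment> \<open>An infinite set has cardinality 0, which the nonzero dimension excludes.\<close>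
  have fin: "finite B" using B(4) assms(2) by (metis card.infinite)
  have V: "V = vec.span B" using B assms(1) by (simp add: vec.span_minimal subset_antisym)
  have "V = (\<lambda>S. \<Sum>v\<in>S. v) ` Pow B"
  proof (intro equalityI subsetI)
    fix x assume "x \<in> V"
    then obtain u where "x = (\<Sum>v\<in>B. u v *s v)" unfolding V vec.span_finite [OF fin] by blast
    also have "\<dots> = (\<Sum>v\<in>B. if u v \<noteq> 0 then v else 0)"
    proof (intro sum.cong refl)
      fix v show "u v *s v = (if u v \<noteq> 0 then v else 0)" by (cases "u v") auto
    qed
    also have "\<dots> = (\<Sum>v\<in>{v \<in> B. u v \<noteq> 0}. v)" using fin by (simp add: sum.inter_filter)
    finally show "x \<in> (\<lambda>S. \<Sum>v\<in>S. v) ` Pow B" by blast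
  next
    fix x assume "x \<in> (\<lambda>S. \<Sum>v\<in>S. v) ` Pow B"
    then obtain S where S: "S \<subseteq> B" "x = (\<Sum>v\<in>S. v)" by blast
    show "x \<in> V" unfolding V S(2) by (rule vec.span_sum) (use S in \<open>auto intro: vec.span_base\<close>)
  qed
  moreover have "inj_on (\<lambda>S. \<Sum>v\<in>S. v) (Pow B)"
  proof (rule inj_onI)
    fix S T assume ST: "S \<in> Pow B" "T \<in> Pow B" "(\<Sum>v\<in>S. v) = (\<Sum>v\<in>T. v)"
    define u :: "bit ^ 'n \<Rightarrow> bit" where "u v = of_bool (v \<in> S) - of_bool (v \<in> T)" for v
    have r: "(\<Sum>v\<in>B. of_bool (v \<in> U) *s v) = (\<Sum>v\<in>U. v)" if "U \<in> Pow B" for U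
    proof -
      have "(\<Sum>v\<in>B. of_bool (v \<in> U) *s v) = (\<Sum>v\<in>B. if v \<in> U then v else 0)"
        by (intro sum.cong refl) auto
      also have "\<dots> = (\<Sum>v\<in>B \<inter> U. v)" using fin by (simp add: sum.inter_restrict)
      also have "B \<inter> U = U" using that by auto
      finally show ?thesis .
    qed
    have "(\<Sum>v\<in>B. u v *s v) = 0"
      unfolding u_def vec.scale_left_diff_distrib sum_subtractf using r [OF ST(1)] r [OF ST(2)] ST(3) by simp
    then have "u v = 0" if "v \<in> B" for v
      using B(2) that unfolding vec.dependent_finite [OF fin] by blast
    then have "v \<in> S \<longleftrightarrow> v \<in> T" if "v \<in> B" for v
      using that by (fastforce simp: u_def of_bool_def split: if_splits)
    then show "S = T" using ST by blast
  qed
  ultimately have "card V = card (Pow B)" by (simp add: card_image)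
  then show ?thesis using B fin by (simp add: card_Pow)
qed

lemma of_int_bit_eq_0_iff: "(of_int k :: bit) = 0 \<longleftrightarrow> even k"
proof (cases "even k")
  case True
  then obtain l where "k = 2 * l" by blast
  then show ?thesis by simp
next
  case False
  then obtain l where "k = 2 * l + 1" by (blast elim: oddE)
  then show ?thesis by simp
qed

lemma distinct_24: "(1::24) \<noteq> 2" "(1::24) \<noteq> 3" "(2::24) \<noteq> 3"
  by (simp_all add: bit0.Rep_inject_sym bit0.Rep_1 bit0.Rep_numeral)

lemma orthogonal_comp_span_iff:
  "x \<in> orthogonal_comp (span S) \<longleftrightarrow> (\<forall>y\<in>S. x \<bullet> y = 0)" for x :: "'a::euclidean_space"
proof
  assume "x \<in> orthogonal_comp (span S)"
  then show "\<forall>y\<in>S. x \<bullet> y = 0"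
    by (auto simp: orthogonal_comp_def orthogonal_def inner_commute intro: span_base)
next
  assume *: "\<forall>y\<in>S. x \<bullet> y = 0"
  then have "orthogonal x y" if "y \<in> span S" for y
    using orthogonal_to_span [OF that, of x] by (auto simp: orthogonal_def)
  then show "x \<in> orthogonal_comp (span S)"
    by (auto simp: orthogonal_comp_def orthogonal_commute)
qed

lemma N_proj_decomposition:
  fixes W :: "'a::euclidean_space set"
  assumes "subspace W" "q \<in> W" "d \<in> orthogonal_comp W"
  shows "N_proj W (q + d) = d /\<^sub>R norm d"
proof -
  have "orth_proj W (q + d) = q"
    unfolding orth_proj_def
  proof (rule the_equality)
    show "q \<in> W \<and> q + d - q \<in> orthogonal_comp W" using assms by simp
    fix p assume p: "p \<in> W \<and> q + d - p \<in> orthogonal_comp W"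
    have "(q + d - p) - d \<in> orthogonal_comp W"
      by (rule subspace_diff [OF subspace_orthogonal_comp conjunct2 [OF p] assms(3)])
    then have "q - p \<in> orthogonal_comp W" by (simp add: algebra_simps)
    moreover have "q - p \<in> W" using p assms by (intro subspace_diff) auto
    ultimately have "orthogonal (q - p) (q - p)" by (auto simp: orthogonal_comp_def)
    then show "p = q" by (simp add: orthogonal_def)
  qed
  then show ?thesis by (simp add: N_proj_def)
qed

text \<open>For odd powers of inner products the summand on the right vanishes; this supplies the
  odd moments of antipodal codes.\<close>

lemma sum_symmetric:
  fixes f :: "'a::real_vector \<Rightarrow> real"
  assumes "finite S" "S \<inter> uminus ` S = {}"
  shows "sum f (S \<union> uminus ` S) = (\<Sum>z\<in>S. f z + f (- z))"
  using assms by (simp add: sum.union_disjoint sum.reindex sum.distrib)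

locale golay_code =
  fixes G :: "(bit ^ 24) set"
  assumes golay_code: "extended_golay_code G"

sublocale golay_code \<subseteq> pointed_golay "supp ` G" "1::24" "2::24" "3::24"
proof
  have G: "vec.subspace G" "vec.dim G = 12" "\<And>c. c \<in> G \<Longrightarrow> c \<noteq> 0 \<Longrightarrow> 8 \<le> hamming_weight c"
    using golay_code by (auto simp: extended_golay_code_def)
  show "A \<triangle> B \<in> supp ` G" if "A \<in> supp ` G" "B \<in> supp ` G" for A B
    using that G(1) by (auto simp flip: supp_add intro!: imageI vec.subspace_add)
  show "card (supp ` G) = 4096"
    using card_binary_subspace [OF G(1)] G(2) by (simp add: card_image inj_on_subset [OF inj_supp])
  show "8 \<le> card A" if A: "A \<in> supp ` G" "A \<noteq> {}" for A
  proof -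
    obtain c where c: "c \<in> G" "A = supp c" using A by blast
    then have "c \<noteq> 0" using A by (auto simp: supp_def)
    then show ?thesis using G(3) c by (simp add: hamming_weight_def supp_def)
  qed
qed (use distinct_24 in auto)

context golay_code
begin

section \<open>Lattice vectors in Euclidean coordinates\<close>

definition emb :: "(24 \<Rightarrow> int) \<Rightarrow> real ^ 24" where
  "emb X = (1 / sqrt 8) *\<^sub>R (\<chi> i. real_of_int (X i))"

lemma emb_nth: "emb X $ i = real_of_int (X i) / sqrt 8"
  by (simp add: emb_def)

lemma inj_emb: "inj emb"
  by (rule injI) (auto simp: vec_eq_iff emb_nth)

lemma inner_emb: "emb X \<bullet> emb Y = real_of_int (\<Sum>i\<in>UNIV. X i * Y i) / 8"
  by (simp add: inner_vec_def emb_nth sum_divide_distrib)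

lemma inner_emb_right: "x \<bullet> emb X = dotr X (\<lambda>i. x $ i) / sqrt 8"
  by (simp add: inner_vec_def emb_nth dotr_def sum_divide_distrib mult.commute)

lemma vec_emb: "vec_w = emb wv" "vec_v = emb vv" "vec_u = emb uv"
  using distinct by (auto simp: vec_eq_iff emb_nth vec_w_def vec_v_def vec_u_def wv_def vv_def uv_def)

lemma leech_emb: "leech G = emb ` {X. leechZ X}"
proof -
  have *: "(\<chi> i. (of_int (f i) :: bit)) \<in> G \<longleftrightarrow> {i. odd (f i)} \<in> supp ` G" for f :: "24 \<Rightarrow> int"
  proof -
    have "supp (\<chi> i. of_int (f i)) = {i. odd (f i)}" by (simp add: supp_def of_int_bit_eq_0_iff)
    then show ?thesis using inj_image_mem_iff [OF inj_supp] by metis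
  qed
  have "leech G = {emb (\<lambda>i. x $ i) | x. leechZ (\<lambda>i. x $ i)}"
    unfolding leech_def emb_def leechZ_iff * ..
  also have "\<dots> = emb ` {X. leechZ X}"
    by (auto intro: exI [of _ "\<chi> i. _ i"])
  finally show ?thesis .
qed

lemma inner_emb_integer:
  assumes "leechZ X" "leechZ Y" shows "\<exists>k::int. emb X \<bullet> emb Y = of_int k"
proof -
  obtain k where "(\<Sum>i\<in>UNIV. X i * Y i) = 8 * k" using leechZ_inner [OF assms] by blast
  then show ?thesis by (auto simp: inner_emb)
qed

lemma inner_vecs:
  "vec_w \<bullet> vec_w = 6" "vec_v \<bullet> vec_v = 4" "vec_u \<bullet> vec_u = 4"
  "vec_w \<bullet> vec_v = 3" "vec_w \<bullet> vec_u = 3" "vec_v \<bullet> vec_u = 1"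
  "vec_v \<bullet> vec_w = 3" "vec_u \<bullet> vec_w = 3" "vec_u \<bullet> vec_v = 1"
proof -
  show *: "vec_w \<bullet> vec_w = 6" "vec_v \<bullet> vec_v = 4" "vec_u \<bullet> vec_u = 4"
    "vec_w \<bullet> vec_v = 3" "vec_w \<bullet> vec_u = 3" "vec_v \<bullet> vec_u = 1"
    unfolding vec_emb inner_emb inner_uvw by simp_all
  show "vec_v \<bullet> vec_w = 3" "vec_u \<bullet> vec_w = 3" "vec_u \<bullet> vec_v = 1"
    using * inner_commute [of vec_v vec_w] inner_commute [of vec_u vec_w] inner_commute [of vec_u vec_v] by simp_all
qed

lemma emb_shell_iff:
  "emb X \<in> emb ` shell p q r \<longleftrightarrow> emb X \<in> leech G \<and> emb X \<bullet> emb X = 4 \<and> emb X \<bullet> vec_w = p / 8 \<and>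
    emb X \<bullet> vec_v = q / 2 \<and> emb X \<bullet> vec_u = r / 8"
proof -
  have "emb X \<bullet> emb X = 4 \<longleftrightarrow> (\<Sum>i\<in>UNIV. (X i)\<^sup>2) = 32"
    unfolding inner_emb power2_eq_square by (auto simp del: of_int_sum of_int_mult)
  moreover have "emb X \<bullet> vec_w = p / 8 \<longleftrightarrow> (\<Sum>i\<in>UNIV. X i * wv i) = p"
    unfolding vec_emb inner_emb by (auto simp del: of_int_sum of_int_mult)
  moreover have "emb X \<bullet> vec_v = q / 2 \<longleftrightarrow> (\<Sum>i\<in>UNIV. X i * vv i) = 4 * q"
  proof -
    have "emb X \<bullet> vec_v = q / 2 \<longleftrightarrow> real_of_int (\<Sum>i\<in>UNIV. X i * vv i) = real_of_int (4 * q)"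
      unfolding vec_emb inner_emb by (auto simp del: of_int_sum)
    then show ?thesis by (simp only: of_int_eq_iff)
  qed
  moreover have "emb X \<bullet> vec_u = r / 8 \<longleftrightarrow> (\<Sum>i\<in>UNIV. X i * uv i) = r"
    unfolding vec_emb inner_emb by (auto simp del: of_int_sum of_int_mult)
  moreover have "emb X \<in> leech G \<longleftrightarrow> leechZ X" "emb X \<in> emb ` shell p q r \<longleftrightarrow> X \<in> shell p q r"
    unfolding leech_emb using inj_image_mem_iff [OF inj_emb] by auto
  ultimately show ?thesis unfolding shell_iff by blast
qed

lemma emb_shell:
  "emb ` shell p q r = {x \<in> leech G. x \<bullet> x = 4 \<and> x \<bullet> vec_w = p / 8 \<and> x \<bullet> vec_v = q / 2 \<and> x \<bullet> vec_u = r / 8}"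
proof (intro equalityI subsetI)
  fix x assume x: "x \<in> emb ` shell p q r"
  then obtain X where "x = emb X" by blast
  then show "x \<in> {x \<in> leech G. x \<bullet> x = 4 \<and> x \<bullet> vec_w = p / 8 \<and> x \<bullet> vec_v = q / 2 \<and> x \<bullet> vec_u = r / 8}"
    using x emb_shell_iff [of X p q r] by simp
next
  fix x assume x: "x \<in> {x \<in> leech G. x \<bullet> x = 4 \<and> x \<bullet> vec_w = p / 8 \<and> x \<bullet> vec_v = q / 2 \<and> x \<bullet> vec_u = r / 8}"
  then obtain X where "x = emb X" unfolding leech_emb by blast
  then show "x \<in> emb ` shell p q r" using x emb_shell_iff [of X p q r] by simp
qed

lemma norm_eq_iff_inner: "0 \<le> r \<Longrightarrow> norm x = r \<longleftrightarrow> x \<bullet> x = r\<^sup>2" for x :: "'x::real_inner"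
  unfolding power2_norm_eq_inner [symmetric] by (simp add: power2_eq_iff_nonneg)

lemma C112_emb: "C112 G = emb ` shell 24 2 8" and C162_emb: "C162 G = emb ` shell 24 2 16"
  unfolding emb_shell by (auto simp: C112_def C162_def C275_def leech_shell_def power2_norm_eq_inner)

text \<open>Expanding the four norms gives a linear system for the inner products with u, v, w; its
  solution is 2, -1, 1.\<close>

lemma C162''_emb: "C162'' G = emb ` shell 8 (-2) 16"
proof -
  have "norm g = 2 \<and> norm (g - (vec_u - vec_v)) = 2 \<and> norm (g + vec_v) = sqrt 6 \<and> norm (g - (vec_w - vec_v)) = 2
    \<longleftrightarrow> g \<bullet> g = 4 \<and> g \<bullet> vec_w = 1 \<and> g \<bullet> vec_v = - 1 \<and> g \<bullet> vec_u = 2" for g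
  proof -
    have "(g - (vec_u - vec_v)) \<bullet> (g - (vec_u - vec_v)) = g \<bullet> g - 2 * (g \<bullet> vec_u) + 2 * (g \<bullet> vec_v) + 6"
      "(g + vec_v) \<bullet> (g + vec_v) = g \<bullet> g + 2 * (g \<bullet> vec_v) + 4"
      "(g - (vec_w - vec_v)) \<bullet> (g - (vec_w - vec_v)) = g \<bullet> g - 2 * (g \<bullet> vec_w) + 2 * (g \<bullet> vec_v) + 4"
      by (simp_all add: inner_diff_left inner_diff_right inner_add_left inner_add_right inner_vecs
          inner_commute [of vec_u g] inner_commute [of vec_v g] inner_commute [of vec_w g])
    then show ?thesis by (simp add: norm_eq_iff_inner) linarith
  qed
  then show ?thesis unfolding emb_shell C162''_def by auto
qed

end

context golay_code
begin

lemma W_perp_iff: "x \<in> orthogonal_comp W_uvw \<longleftrightarrow> x \<bullet> vec_u = 0 \<and> x \<bullet> vec_v = 0 \<and> x \<bullet> vec_w = 0"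
  unfolding W_uvw_def orthogonal_comp_span_iff by auto

lemma subspace_W: "subspace W_uvw"
  by (simp add: W_uvw_def)

lemma vecs_in_W: "vec_u \<in> W_uvw" "vec_v \<in> W_uvw" "vec_w \<in> W_uvw"
  by (simp_all add: W_uvw_def span_base)

lemmas W_intros = subspace_add [OF subspace_W] subspace_diff [OF subspace_W] subspace_scale [OF subspace_W] vecs_in_W
  subspace_neg [OF subspace_W]

lemma dotr_uvw:
  "dotr wv x = sum x UNIV + 4 * x 1" "dotr vv x = 4 * x 1 + 4 * x 2" "dotr uv x = sum x UNIV - 4 * x 3"
  by (simp_all add: dotr_def wv_def vv_def uv_def distrib_right left_diff_distrib
      sum.distrib sum_subtractf mult.assoc sum_distrib_left [symmetric] sum_point_UNIV)

lemma W_perp_iff_perp: "x \<in> orthogonal_comp W_uvw \<longleftrightarrow> perp (\<lambda>i. x $ i)"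
  unfolding W_perp_iff vec_emb inner_emb_right dotr_uvw perp_def
  using sum_UNIV_R [of "\<lambda>i. x $ i"] by auto

section \<open>Components orthogonal to the span and the unit codes\<close>

text \<open>The orthogonal projections of the shells to the span. All vectors of a shell have the
  same inner products with u, v, w, so the Gram matrix determines a single point.\<close>

definition P112 :: "real ^ 24" where
  "P112 = (3 / 4) *\<^sub>R vec_w - (1 / 4) *\<^sub>R vec_u - (1 / 4) *\<^sub>R vec_v"
definition P162 :: "real ^ 24" where
  "P162 = (1 / 6) *\<^sub>R vec_u - (1 / 6) *\<^sub>R vec_v + (1 / 2) *\<^sub>R vec_w"
definition P162b :: "real ^ 24" where
  "P162b = (1 / 2) *\<^sub>R vec_u - (1 / 2) *\<^sub>R vec_v + (1 / 6) *\<^sub>R vec_w"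

lemma P_in_W: "P112 \<in> W_uvw" "P162 \<in> W_uvw" "P162b \<in> W_uvw"
  unfolding P112_def P162_def P162b_def by (intro W_intros)+

lemma P_nth: "P112 $ i = proj112 i / sqrt 8" "P162 $ i = proj162 i / sqrt 8" "P162b $ i = proj162b i / sqrt 8"
  using distinct
  by (auto simp: P112_def P162_def P162b_def vec_emb emb_nth wv_def vv_def uv_def
      proj112_def proj162_def proj162b_def field_simps)

definition dA :: "(24 \<Rightarrow> int) \<Rightarrow> real ^ 24" where "dA X = emb X - P112"
definition dB :: "(24 \<Rightarrow> int) \<Rightarrow> real ^ 24" where "dB X = emb X - P162"
definition dG :: "(24 \<Rightarrow> int) \<Rightarrow> real ^ 24" where "dG X = emb X - P162b"

lemma shell_inner:
  assumes "X \<in> shell p q r"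
  shows "emb X \<bullet> emb X = 4" "emb X \<bullet> vec_w = p / 8" "emb X \<bullet> vec_v = q / 2" "emb X \<bullet> vec_u = r / 8"
    "vec_w \<bullet> emb X = p / 8" "vec_v \<bullet> emb X = q / 2" "vec_u \<bullet> emb X = r / 8"
proof -
  show *: "emb X \<bullet> emb X = 4" "emb X \<bullet> vec_w = p / 8" "emb X \<bullet> vec_v = q / 2" "emb X \<bullet> vec_u = r / 8"
    using imageI [OF assms, of emb] emb_shell_iff [of X p q r] by simp_all
  show "vec_w \<bullet> emb X = p / 8" "vec_v \<bullet> emb X = q / 2" "vec_u \<bullet> emb X = r / 8"
    using *(2-4) inner_commute [of vec_w "emb X"] inner_commute [of vec_v "emb X"]
      inner_commute [of vec_u "emb X"] by simp_all
qed

lemmas shell_inner_simps = shell_inner [where p = 24 and q = 2 and r = 8, simplified]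
  shell_inner [where p = 24 and q = 2 and r = 16, simplified]
  shell_inner [where p = 8 and q = "-2" and r = 16, simplified]

lemmas P_defs = P112_def P162_def P162b_def
lemmas inner_expand = inner_diff_left inner_diff_right inner_add_left inner_add_right inner_vecs

lemma d_perp:
  "X \<in> shell 24 2 8 \<Longrightarrow> dA X \<in> orthogonal_comp W_uvw"
  "X \<in> shell 24 2 16 \<Longrightarrow> dB X \<in> orthogonal_comp W_uvw"
  "X \<in> shell 8 (-2) 16 \<Longrightarrow> dG X \<in> orthogonal_comp W_uvw"
  unfolding W_perp_iff dA_def dB_def dG_def P_defs
  by (simp_all add: inner_expand shell_inner_simps)

lemma perp_W_inner: "x \<in> orthogonal_comp W_uvw \<Longrightarrow> y \<in> W_uvw \<Longrightarrow> x \<bullet> y = 0"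
  by (auto simp: orthogonal_comp_def orthogonal_def inner_commute)

lemma inner_d:
  assumes "x \<in> orthogonal_comp W_uvw"
  shows "x \<bullet> dA X = x \<bullet> emb X" "x \<bullet> dB X = x \<bullet> emb X" "x \<bullet> dG X = x \<bullet> emb X"
  using perp_W_inner [OF assms] P_in_W by (simp_all add: dA_def dB_def dG_def inner_diff_right)

text \<open>The subtracted constants are the inner products of the projections to the span.\<close>

lemma dA_dA: "X \<in> shell 24 2 8 \<Longrightarrow> Y \<in> shell 24 2 8 \<Longrightarrow> dA X \<bullet> dA Y = emb X \<bullet> emb Y - 7 / 4"
  and dB_dB: "X \<in> shell 24 2 16 \<Longrightarrow> Y \<in> shell 24 2 16 \<Longrightarrow> dB X \<bullet> dB Y = emb X \<bullet> emb Y - 5 / 3"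
  and dG_dG: "X \<in> shell 8 (-2) 16 \<Longrightarrow> Y \<in> shell 8 (-2) 16 \<Longrightarrow> dG X \<bullet> dG Y = emb X \<bullet> emb Y - 5 / 3"
  and dA_dB: "X \<in> shell 24 2 8 \<Longrightarrow> Y \<in> shell 24 2 16 \<Longrightarrow> dA X \<bullet> dB Y = emb X \<bullet> emb Y - 3 / 2"
  and dA_dG: "X \<in> shell 24 2 8 \<Longrightarrow> Y \<in> shell 8 (-2) 16 \<Longrightarrow> dA X \<bullet> dG Y = emb X \<bullet> emb Y - 1 / 2"
  and dB_dG: "X \<in> shell 24 2 16 \<Longrightarrow> Y \<in> shell 8 (-2) 16 \<Longrightarrow> dB X \<bullet> dG Y = emb X \<bullet> emb Y - 1"
  by (simp_all add: inner_d d_perp) (simp_all add: dA_def dB_def dG_def P_defs inner_expand shell_inner_simps)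

lemma norm_d:
  "X \<in> shell 24 2 8 \<Longrightarrow> norm (dA X) = 3 / 2"
  "X \<in> shell 24 2 16 \<Longrightarrow> norm (dB X) = sqrt 21 / 3"
  "X \<in> shell 8 (-2) 16 \<Longrightarrow> norm (dG X) = sqrt 21 / 3"
  by (subst norm_eq_iff_inner, simp, simp add: dA_dA dB_dB dG_dG shell_inner_simps power_divide)+

definition uA :: "(24 \<Rightarrow> int) \<Rightarrow> real ^ 24" where "uA X = dA X /\<^sub>R (3 / 2)"
definition uB :: "(24 \<Rightarrow> int) \<Rightarrow> real ^ 24" where "uB X = dB X /\<^sub>R (sqrt 21 / 3)"
definition uG :: "(24 \<Rightarrow> int) \<Rightarrow> real ^ 24" where "uG X = dG X /\<^sub>R (sqrt 21 / 3)"

lemma d_u: "dA X = (3 / 2) *\<^sub>R uA X" "dB X = (sqrt 21 / 3) *\<^sub>R uB X" "dG X = (sqrt 21 / 3) *\<^sub>R uG X"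
  by (simp_all add: uA_def uB_def uG_def)

definition hatA :: "(real ^ 24) set" where "hatA = uA ` shell 24 2 8"
definition hatB :: "(real ^ 24) set" where "hatB = uB ` shell 24 2 16"
definition hatG :: "(real ^ 24) set" where "hatG = uG ` shell 8 (-2) 16"

text \<open>Any shift inside the span is lost under projection, so the shifts in
  \<open>code_C\<close> and \<open>code_D\<close> do not affect the projected codes.\<close>

lemma N_d:
  assumes "q \<in> W_uvw"
  shows "X \<in> shell 24 2 8 \<Longrightarrow> N_proj W_uvw (q + dA X) = uA X"
    "X \<in> shell 24 2 8 \<Longrightarrow> N_proj W_uvw (q - dA X) = - uA X"
    "X \<in> shell 24 2 16 \<Longrightarrow> N_proj W_uvw (q + dB X) = uB X"
    "X \<in> shell 24 2 16 \<Longrightarrow> N_proj W_uvw (q - dB X) = - uB X"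
    "X \<in> shell 8 (-2) 16 \<Longrightarrow> N_proj W_uvw (q + dG X) = uG X"
    "X \<in> shell 8 (-2) 16 \<Longrightarrow> N_proj W_uvw (q - dG X) = - uG X"
proof -
  have "N_proj W_uvw (q + d) = d /\<^sub>R norm d" "N_proj W_uvw (q - d) = - (d /\<^sub>R norm d)"
    if "d \<in> orthogonal_comp W_uvw" for d
    using N_proj_decomposition [OF subspace_W assms that]
      N_proj_decomposition [OF subspace_W assms subspace_neg [OF subspace_orthogonal_comp that]] by simp_all
  then show "X \<in> shell 24 2 8 \<Longrightarrow> N_proj W_uvw (q + dA X) = uA X"
    "X \<in> shell 24 2 8 \<Longrightarrow> N_proj W_uvw (q - dA X) = - uA X"
    "X \<in> shell 24 2 16 \<Longrightarrow> N_proj W_uvw (q + dB X) = uB X"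
    "X \<in> shell 24 2 16 \<Longrightarrow> N_proj W_uvw (q - dB X) = - uB X"
    "X \<in> shell 8 (-2) 16 \<Longrightarrow> N_proj W_uvw (q + dG X) = uG X"
    "X \<in> shell 8 (-2) 16 \<Longrightarrow> N_proj W_uvw (q - dG X) = - uG X"
    unfolding uA_def uB_def uG_def using d_perp norm_d by metis+
qed

lemma emb_d: "emb X = P112 + dA X" "emb X = P162 + dB X" "emb X = P162b + dG X"
  by (simp_all add: dA_def dB_def dG_def)

lemma N_C112: "N_proj W_uvw ` C112 G = hatA"
  unfolding C112_emb hatA_def image_image
  by (intro image_cong refl) (simp only: emb_d(1) N_d [OF P_in_W(1)])

lemma N_C162: "N_proj W_uvw ` C162 G = hatB"
  unfolding C162_emb hatB_def image_image
  by (intro image_cong refl) (simp only: emb_d(2) N_d [OF P_in_W(2)])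

lemma C_hat_eq: "C_hat G = hatA \<union> uminus ` hatA"
proof -
  have "(1 / 2) *\<^sub>R (vec_w - vec_u - vec_v) + (vec_w - emb X)
      = ((1 / 2) *\<^sub>R (vec_w - vec_u - vec_v) + vec_w - P112) - dA X" for X
    by (simp add: dA_def)
  moreover have "(1 / 2) *\<^sub>R (vec_w - vec_u - vec_v) + vec_w - P112 \<in> W_uvw" by (intro W_intros P_in_W)
  ultimately have "N_proj W_uvw ((1 / 2) *\<^sub>R (vec_w - vec_u - vec_v) + (vec_w - emb X)) = - uA X"
    if "X \<in> shell 24 2 8" for X using N_d(2) that by metis
  then show ?thesis
    unfolding C_hat_def code_C_def C112'_def image_Un N_C112
    by (simp add: C112_emb hatA_def image_image cong: image_cong_simp)
qed

lemma D_hat_eq: "D_hat G = (hatB \<union> hatG) \<union> uminus ` (hatB \<union> hatG)"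
proof -
  have 1: "N_proj W_uvw ((1 / 3) *\<^sub>R (vec_u - vec_v) + (vec_w - emb X)) = - uB X"
    if "X \<in> shell 24 2 16" for X
  proof -
    have "(1 / 3) *\<^sub>R (vec_u - vec_v) + (vec_w - emb X)
        = ((1 / 3) *\<^sub>R (vec_u - vec_v) + vec_w - P162) - dB X"
      by (simp add: dB_def)
    moreover have "(1 / 3) *\<^sub>R (vec_u - vec_v) + vec_w - P162 \<in> W_uvw" by (intro W_intros P_in_W)
    ultimately show ?thesis using N_d(4) that by metis
  qed
  have 2: "N_proj W_uvw (- ((1 / 3) *\<^sub>R (vec_u - vec_v)) + (1 / 3) *\<^sub>R vec_w + emb X) = uG X"
    if "X \<in> shell 8 (-2) 16" for X
  proof -
    have "- ((1 / 3) *\<^sub>R (vec_u - vec_v)) + (1 / 3) *\<^sub>R vec_w + emb X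
        = (- ((1 / 3) *\<^sub>R (vec_u - vec_v)) + (1 / 3) *\<^sub>R vec_w + P162b) + dG X"
      by (simp add: dG_def)
    moreover have "- ((1 / 3) *\<^sub>R (vec_u - vec_v)) + (1 / 3) *\<^sub>R vec_w + P162b \<in> W_uvw" by (intro W_intros P_in_W)
    ultimately show ?thesis using N_d(5) that by metis
  qed
  have 3: "N_proj W_uvw (- ((1 / 3) *\<^sub>R (vec_u - vec_v)) + (2 / 3) *\<^sub>R vec_w + (vec_u - vec_v - emb X)) = - uG X"
    if "X \<in> shell 8 (-2) 16" for X
  proof -
    have "- ((1 / 3) *\<^sub>R (vec_u - vec_v)) + (2 / 3) *\<^sub>R vec_w + (vec_u - vec_v - emb X)
        = (- ((1 / 3) *\<^sub>R (vec_u - vec_v)) + (2 / 3) *\<^sub>R vec_w + (vec_u - vec_v) - P162b) - dG X"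
      by (simp add: dG_def)
    moreover have "- ((1 / 3) *\<^sub>R (vec_u - vec_v)) + (2 / 3) *\<^sub>R vec_w + (vec_u - vec_v) - P162b \<in> W_uvw"
      by (intro W_intros P_in_W)
    ultimately show ?thesis using N_d(6) that by metis
  qed
  have "D_hat G = hatB \<union> uminus ` hatB \<union> hatG \<union> uminus ` hatG"
    unfolding D_hat_def code_D_def C162'_def C162'''_def image_Un N_C162
    using 1 2 3 by (simp add: C162_emb C162''_emb hatB_def hatG_def image_image cong: image_cong_simp)
  then show ?thesis by (auto simp: image_Un)
qed

lemma hat_sphere: "hatA \<subseteq> perp_sphere W_uvw" "hatB \<union> hatG \<subseteq> perp_sphere W_uvw"
proof -
  have scale: "k *\<^sub>R d \<in> orthogonal_comp W_uvw" if "d \<in> orthogonal_comp W_uvw" for k d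
    using subspace_scale [OF subspace_orthogonal_comp that] .
  have "uA X \<in> perp_sphere W_uvw" if "X \<in> shell 24 2 8" for X
    using scale [OF d_perp(1) [OF that]] norm_d(1) [OF that] by (simp add: perp_sphere_def uA_def)
  moreover have "uB X \<in> perp_sphere W_uvw" if "X \<in> shell 24 2 16" for X
    using scale [OF d_perp(2) [OF that]] norm_d(2) [OF that] by (simp add: perp_sphere_def uB_def)
  moreover have "uG X \<in> perp_sphere W_uvw" if "X \<in> shell 8 (-2) 16" for X
    using scale [OF d_perp(3) [OF that]] norm_d(3) [OF that] by (simp add: perp_sphere_def uG_def)
  ultimately show "hatA \<subseteq> perp_sphere W_uvw" "hatB \<union> hatG \<subseteq> perp_sphere W_uvw"
    by (auto simp: hatA_def hatB_def hatG_def)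
qed

lemma perp_sphere_uminus: "uminus ` S \<subseteq> perp_sphere W_uvw" if "S \<subseteq> perp_sphere W_uvw" for S
  using that subspace_neg [OF subspace_orthogonal_comp] by (auto simp: perp_sphere_def)

lemma finite_hat [simp]: "finite hatA" "finite hatB" "finite hatG"
  by (simp_all add: hatA_def hatB_def hatG_def)

lemma inj_hat: "inj_on uA A" "inj_on uB A" "inj_on uG A"
proof -
  have "X = Y" if "dA X = dA Y \<or> dB X = dB Y \<or> dG X = dG Y" for X Y
    using that injD [OF inj_emb, of X Y] by (auto simp: dA_def dB_def dG_def)
  then show "inj_on uA A" "inj_on uB A" "inj_on uG A"
    unfolding inj_on_def d_u by auto
qed

lemma perp_0: "perp (\<lambda>_. 0)"
  by (simp add: perp_def)

lemma card_hat: "card hatA = 112" "card hatB = 162" "card hatG = 162"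
  unfolding hatA_def hatB_def hatG_def
  by (simp_all add: card_image inj_hat moments_112(1) [OF perp_0] moments_162(1) [OF perp_0] moments_162b(1) [OF perp_0])

lemma shell_leechZ: "X \<in> shell p q r \<Longrightarrow> leechZ X"
  by (simp add: shell_def)

text \<open>Opposite points would come from lattice vectors with inner product -1/2, against
  integrality.\<close>

lemma hatA_antipodal: "hatA \<inter> uminus ` hatA = {}"
proof (rule ccontr)
  assume "\<not> ?thesis"
  then obtain X Y where XY: "X \<in> shell 24 2 8" "Y \<in> shell 24 2 8" "uA X = - uA Y"
    by (auto simp: hatA_def)
  then have eq: "dA X = - dA Y" unfolding d_u by simp
  have "dA X \<bullet> dA Y = - (9 / 4)" using eq dA_dA [OF XY(2,2)] shell_inner(1) [OF XY(2)] by simp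
  then have "emb X \<bullet> emb Y = - (1 / 2)" using dA_dA [OF XY(1,2)] by simp
  moreover obtain k :: int where "emb X \<bullet> emb Y = of_int k"
    using inner_emb_integer [OF shell_leechZ [OF XY(1)] shell_leechZ [OF XY(2)]] by blast
  ultimately have "of_int (2 * k) = (of_int (- 1) :: real)" by simp
  then have "2 * k = - 1" by (simp only: of_int_eq_iff)
  then show False by presburger
qed

text \<open>Coincidences would need lattice inner products -2/3, -4/3 or 10/3, against
  integrality.\<close>

lemma hatBG_antipodal: "(hatB \<union> hatG) \<inter> uminus ` (hatB \<union> hatG) = {}" and hatB_hatG: "hatB \<inter> hatG = {}"
proof -
  have no: False if "of_int (3 * k) = (of_int l :: real)" "\<not> 3 dvd l" for k l :: int
    using that by (simp only: of_int_eq_iff) auto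
  have BB: "uB X \<noteq> - uB Y" if XY: "X \<in> shell 24 2 16" "Y \<in> shell 24 2 16" for X Y
  proof
    assume "uB X = - uB Y"
    then have eq: "dB X = - dB Y" unfolding d_u by simp
    obtain k :: int where k: "emb X \<bullet> emb Y = of_int k" using inner_emb_integer [OF shell_leechZ [OF XY(1)] shell_leechZ [OF XY(2)]] by blast
    have "dB X \<bullet> dB Y = - (7 / 3)" using eq dB_dB [OF XY(2,2)] shell_inner(1) [OF XY(2)] by simp
    then have "of_int (3 * k) = (of_int (- 2) :: real)" using dB_dB [OF XY] k by simp
    then show False using no by fastforce
  qed
  have GG: "uG X \<noteq> - uG Y" if XY: "X \<in> shell 8 (-2) 16" "Y \<in> shell 8 (-2) 16" for X Y
  proof
    assume "uG X = - uG Y"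
    then have eq: "dG X = - dG Y" unfolding d_u by simp
    obtain k :: int where k: "emb X \<bullet> emb Y = of_int k" using inner_emb_integer [OF shell_leechZ [OF XY(1)] shell_leechZ [OF XY(2)]] by blast
    have "dG X \<bullet> dG Y = - (7 / 3)" using eq dG_dG [OF XY(2,2)] shell_inner(1) [OF XY(2)] by simp
    then have "of_int (3 * k) = (of_int (- 2) :: real)" using dG_dG [OF XY] k by simp
    then show False using no by fastforce
  qed
  have BG: "uB X \<noteq> - uG Y" "uB X \<noteq> uG Y" if XY: "X \<in> shell 24 2 16" "Y \<in> shell 8 (-2) 16" for X Y
  proof -
    obtain k :: int where k: "emb X \<bullet> emb Y = of_int k" using inner_emb_integer [OF shell_leechZ [OF XY(1)] shell_leechZ [OF XY(2)]] by blast
    show "uB X \<noteq> - uG Y"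
    proof
      assume "uB X = - uG Y"
      then have eq: "dB X = - dG Y" unfolding d_u by simp
      have "dB X \<bullet> dG Y = - (7 / 3)" using eq dG_dG [OF XY(2,2)] shell_inner(1) [OF XY(2)] by simp
      then have "of_int (3 * k) = (of_int (- 4) :: real)" using dB_dG [OF XY] k by simp
      then show False using no by fastforce
    qed
    show "uB X \<noteq> uG Y"
    proof
      assume "uB X = uG Y"
      then have eq: "dB X = dG Y" unfolding d_u by simp
      have "dB X \<bullet> dG Y = 7 / 3" using eq dG_dG [OF XY(2,2)] shell_inner(1) [OF XY(2)] by simp
      then have "of_int (3 * k) = (of_int 10 :: real)" using dB_dG [OF XY] k by simp
      then show False using no by fastforce
    qed
  qed
  have GB: "uG Y \<noteq> - uB X" if XY: "X \<in> shell 24 2 16" "Y \<in> shell 8 (-2) 16" for X Y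
    using BG(1) [OF XY] by (metis minus_minus)
  show "hatB \<inter> hatG = {}" using BG(2) by (auto simp: hatB_def hatG_def)
  show "(hatB \<union> hatG) \<inter> uminus ` (hatB \<union> hatG) = {}"
    using BB GG BG(1) GB by (auto simp: hatB_def hatG_def image_Un)
qed

lemma card_C_hat: "card (C_hat G) = 224"
  unfolding C_hat_eq using hatA_antipodal by (simp add: card_Un_disjoint card_image card_hat)

lemma card_D_hat: "card (D_hat G) = 648"
proof -
  have "card (hatB \<union> hatG) = 324" using hatB_hatG by (simp add: card_Un_disjoint card_hat)
  then show ?thesis
    unfolding D_hat_eq using hatBG_antipodal by (subst card_Un_disjoint) (simp_all add: card_image)
qed

lemma sphere_sum: "x \<in> perp_sphere W_uvw \<Longrightarrow> (\<Sum>i\<in>UNIV. (x $ i)\<^sup>2) = 1"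
proof -
  assume "x \<in> perp_sphere W_uvw"
  then have "x \<bullet> x = 1" by (simp add: perp_sphere_def norm_eq_iff_inner)
  then show ?thesis by (simp add: inner_vec_def power2_eq_square)
qed

lemma inner_hat:
  assumes "x \<in> perp_sphere W_uvw"
  shows "x \<bullet> uA X = dotr X (\<lambda>i. x $ i) * (2 / (3 * sqrt 8))"
    "x \<bullet> uB X = dotr X (\<lambda>i. x $ i) * (3 / (sqrt 21 * sqrt 8))"
    "x \<bullet> uG X = dotr X (\<lambda>i. x $ i) * (3 / (sqrt 21 * sqrt 8))"
  using assms by (simp_all add: uA_def uB_def uG_def inner_d perp_sphere_def inner_emb_right)

lemma moments_hatA:
  assumes x: "x \<in> perp_sphere W_uvw"
  shows "(\<Sum>z\<in>hatA. x \<bullet> z) = 0" "(\<Sum>z\<in>hatA. (x \<bullet> z)\<^sup>2) = 112 / 21" "(\<Sum>z\<in>hatA. (x \<bullet> z) ^ 3) = 0"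
proof -
  have p: "perp (\<lambda>i. x $ i)" using x by (simp add: perp_sphere_def W_perp_iff_perp)
  show "(\<Sum>z\<in>hatA. x \<bullet> z) = 0" "(\<Sum>z\<in>hatA. (x \<bullet> z)\<^sup>2) = 112 / 21" "(\<Sum>z\<in>hatA. (x \<bullet> z) ^ 3) = 0"
    unfolding hatA_def sum.reindex [OF inj_hat(1)] o_def inner_hat [OF x] power_mult_distrib
      sum_distrib_right [symmetric] moments_112 [OF p] sphere_sum [OF x]
    by (simp_all add: power_divide power_mult_distrib)
qed

lemma moments_hatB:
  assumes x: "x \<in> perp_sphere W_uvw"
  shows "(\<Sum>z\<in>hatB. x \<bullet> z) = 0" "(\<Sum>z\<in>hatB. (x \<bullet> z)\<^sup>2) = 162 / 21" "(\<Sum>z\<in>hatB. (x \<bullet> z) ^ 3) = 0"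
proof -
  have p: "perp (\<lambda>i. x $ i)" using x by (simp add: perp_sphere_def W_perp_iff_perp)
  show "(\<Sum>z\<in>hatB. x \<bullet> z) = 0" "(\<Sum>z\<in>hatB. (x \<bullet> z)\<^sup>2) = 162 / 21" "(\<Sum>z\<in>hatB. (x \<bullet> z) ^ 3) = 0"
    unfolding hatB_def sum.reindex [OF inj_hat(2)] o_def inner_hat [OF x] power_mult_distrib
      sum_distrib_right [symmetric] moments_162 [OF p] sphere_sum [OF x]
    by (simp_all add: power_divide power_mult_distrib)
qed

lemma moment_hatG:
  assumes x: "x \<in> perp_sphere W_uvw"
  shows "(\<Sum>z\<in>hatG. (x \<bullet> z)\<^sup>2) = 162 / 21"
proof -
  have p: "perp (\<lambda>i. x $ i)" using x by (simp add: perp_sphere_def W_perp_iff_perp)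
  show ?thesis
    unfolding hatG_def sum.reindex [OF inj_hat(3)] o_def inner_hat [OF x] power_mult_distrib
      sum_distrib_right [symmetric] moments_162b [OF p] sphere_sum [OF x]
    by (simp add: power_divide power_mult_distrib)
qed

section \<open>Points with only two inner products\<close>

abbreviation \<sigma> :: real where "\<sigma> \<equiv> 1 / sqrt 21"

definition two_valued :: "(real ^ 24) set \<Rightarrow> (real ^ 24) set" where
  "two_valued Z = {x \<in> perp_sphere W_uvw. \<forall>z\<in>Z. x \<bullet> z = \<sigma> \<or> x \<bullet> z = - \<sigma>}"

lemma two_valued_symmetric: "two_valued (Z \<union> uminus ` Z) = two_valued Z"
  by (auto simp: two_valued_def minus_equation_iff [of "_ \<bullet> _"] equation_minus_iff)

lemma two_valued_uminus: "x \<in> two_valued Z \<Longrightarrow> - x \<in> two_valued Z"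
  using perp_sphere_uminus [of "{x}"] by (auto simp: two_valued_def)

lemma sqrt21: "sqrt 21 * sqrt 21 = 21" "sqrt 8 * sqrt 8 = 8" "sqrt 21 > 0" "sqrt 8 > 0"
  by simp_all

text \<open>Lattice inner products 1, 2 minus 3/2, or 0, 1 minus 1/2, give \<plusminus>1/2. Dividing
  by the norms 3/2 and sqrt 21 / 3 gives \<plusminus>\<sigma>.\<close>

lemma inner_hatA_hatBG:
  assumes y: "y \<in> hatA" and z: "z \<in> hatB \<union> hatG"
  shows "y \<bullet> z = \<sigma> \<or> y \<bullet> z = - \<sigma>"
proof -
  obtain Y where Y: "Y \<in> shell 24 2 8" "y = uA Y" using y by (auto simp: hatA_def)
  have "\<exists>d. (dA Y \<bullet> d = 1 / 2 \<or> dA Y \<bullet> d = - 1 / 2) \<and> z = d /\<^sub>R (sqrt 21 / 3)"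
  proof (cases "z \<in> hatB")
    case True
    then obtain Z where Z: "Z \<in> shell 24 2 16" "z = uB Z" by (auto simp: hatB_def)
    have "emb Y \<bullet> emb Z = 1 \<or> emb Y \<bullet> emb Z = 2"
      using polar_112_162 [OF Y(1) Z(1)] unfolding inner_emb by (auto simp del: of_int_sum of_int_mult)
    then show ?thesis using dA_dB [OF Y(1) Z(1)] Z(2) by (intro exI [of _ "dB Z"]) (auto simp: uB_def)
  next
    case False
    then obtain Z where Z: "Z \<in> shell 8 (-2) 16" "z = uG Z" using z by (auto simp: hatG_def)
    have "emb Y \<bullet> emb Z = 0 \<or> emb Y \<bullet> emb Z = 1"
      using polar_112_162b [OF Y(1) Z(1)] unfolding inner_emb by (auto simp del: of_int_sum of_int_mult)
    then show ?thesis using dA_dG [OF Y(1) Z(1)] Z(2) by (intro exI [of _ "dG Z"]) (auto simp: uG_def)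
  qed
  then obtain d where d: "dA Y \<bullet> d = 1 / 2 \<or> dA Y \<bullet> d = - 1 / 2" "z = d /\<^sub>R (sqrt 21 / 3)" by blast
  then show ?thesis using sqrt21 unfolding Y(2) d(2) uA_def by (auto simp: field_simps)
qed

lemma sqrt8_d:
  "sqrt 8 * dA X $ i = real_of_int (X i) - proj112 i" "sqrt 8 * dB X $ i = real_of_int (X i) - proj162 i"
  "sqrt 8 * dG X $ i = real_of_int (X i) - proj162b i"
  by (simp_all add: dA_def dB_def dG_def emb_nth P_nth right_diff_distrib)

lemma two_valued_hatA: "two_valued hatA = D_hat G"
proof (intro equalityI subsetI)
  fix x assume "x \<in> D_hat G"
  then obtain z where z: "z \<in> hatB \<union> hatG" "x = z \<or> x = - z" by (auto simp: D_hat_eq)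
  then have "z \<in> two_valued hatA"
    using hat_sphere(2) inner_hatA_hatBG by (auto simp: two_valued_def inner_commute [of z])
  then show "x \<in> two_valued hatA" using z two_valued_uminus by blast
next
  fix x assume x: "x \<in> two_valued hatA"
  then have xs: "x \<in> perp_sphere W_uvw" by (simp add: two_valued_def)
  \<comment> \<open>l = sqrt 8 * (sqrt 21 / 3), the length of the vectors \<open>dB\<close> and
    \<open>dG\<close> in integer coordinates; it turns inner products \<plusminus>\<sigma> into
    \<plusminus>4.\<close>
  define l where "l = 8 * sqrt 21 / (3 * sqrt 8)"
  have l0: "l > 0" by (simp add: l_def)
  have l1: "l * (3 * sqrt 8) = 8 * sqrt 21" by (simp add: l_def)
  define y where "y i = l * x $ i" for i
  have dotr_y: "dotr Y y = l * dotr Y (\<lambda>i. x $ i)" for Y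
    by (simp add: dotr_def y_def sum_distrib_left mult_ac)
  have "perp (\<lambda>i. x $ i)" using xs by (simp add: perp_sphere_def W_perp_iff_perp)
  then have py: "perp y" by (simp add: perp_def y_def flip: sum_distrib_left)
  have ny: "(\<Sum>i\<in>UNIV. (y i)\<^sup>2) = 56 / 3"
  proof -
    have "(\<Sum>i\<in>UNIV. (y i)\<^sup>2) = l\<^sup>2" using sphere_sum [OF xs] by (simp add: y_def power_mult_distrib flip: sum_distrib_left)
    then show ?thesis by (simp add: l_def power_divide power_mult_distrib)
  qed
  have dy: "dotr Y y = 4 \<or> dotr Y y = - 4" if Y: "Y \<in> shell 24 2 8" for Y
  proof -
    have "x \<bullet> uA Y = \<sigma> \<or> x \<bullet> uA Y = - \<sigma>"
      using x Y by (auto simp: two_valued_def hatA_def)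
    then have "dotr Y (\<lambda>i. x $ i) = \<sigma> * (3 * sqrt 8 / 2) \<or> dotr Y (\<lambda>i. x $ i) = - \<sigma> * (3 * sqrt 8 / 2)"
      unfolding inner_hat [OF xs] using sqrt21 by (auto simp: field_simps)
    moreover have "l * (\<sigma> * (3 * sqrt 8 / 2)) = 4" by (simp add: l_def)
    ultimately show ?thesis unfolding dotr_y by auto
  qed
  obtain e where e: "e \<in> {1, -1}"
    "(\<exists>Z\<in>shell 24 2 16. \<forall>i. y i = e * (real_of_int (Z i) - proj162 i)) \<or>
      (\<exists>Z\<in>shell 8 (-2) 16. \<forall>i. y i = e * (real_of_int (Z i) - proj162b i))"
    using classify_112 [OF py ny dy] by (rule bexE)
  have x_eq: "x = e *\<^sub>R (d /\<^sub>R (sqrt 21 / 3))" if "\<And>i. y i = e * (sqrt 8 * d $ i)" for d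
  proof -
    have "x $ i = e * (inverse (sqrt 21 / 3) * d $ i)" for i
    proof -
      have "l * x $ i = e * (sqrt 8 * d $ i)" using that [of i] by (simp add: y_def)
      then have "(3 * sqrt 8) * (l * x $ i) = (3 * sqrt 8) * (e * (sqrt 8 * d $ i))" by simp
      then have "(l * (3 * sqrt 8)) * x $ i = e * (3 * (sqrt 8 * sqrt 8) * d $ i)" by (simp only: mult_ac)
      then have "sqrt 21 * x $ i = e * (3 * d $ i)" unfolding l1 sqrt21 by (simp add: mult_ac)
      then show ?thesis using sqrt21(3) by (simp add: field_simps)
    qed
    then show ?thesis unfolding vec_eq_iff vector_scaleR_component real_scaleR_def by blast
  qed
  from e(2) show "x \<in> D_hat G"
  proof (elim disjE bexE)
    fix Z assume Z: "Z \<in> shell 24 2 16" "\<forall>i. y i = e * (real_of_int (Z i) - proj162 i)"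
    have "x = e *\<^sub>R uB Z"
      unfolding uB_def by (rule x_eq) (simp only: sqrt8_d Z(2))
    then show ?thesis unfolding D_hat_eq using Z(1) e(1) by (auto simp: hatB_def)
  next
    fix Z assume Z: "Z \<in> shell 8 (-2) 16" "\<forall>i. y i = e * (real_of_int (Z i) - proj162b i)"
    have "x = e *\<^sub>R uG Z"
      unfolding uG_def by (rule x_eq) (simp only: sqrt8_d Z(2))
    then show ?thesis unfolding D_hat_eq using Z(1) e(1) by (auto simp: hatG_def)
  qed
qed

lemma two_valued_hatBG: "two_valued (hatB \<union> hatG) = C_hat G"
proof (intro equalityI subsetI)
  fix x assume "x \<in> C_hat G"
  then obtain z where z: "z \<in> hatA" "x = z \<or> x = - z" by (auto simp: C_hat_eq)
  then have "z \<in> two_valued (hatB \<union> hatG)"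
    using hat_sphere(1) inner_hatA_hatBG by (auto simp: two_valued_def)
  then show "x \<in> two_valued (hatB \<union> hatG)" using z two_valued_uminus by blast
next
  fix x assume x: "x \<in> two_valued (hatB \<union> hatG)"
  then have xs: "x \<in> perp_sphere W_uvw" by (simp add: two_valued_def)
  \<comment> \<open>l = sqrt 8 * (3 / 2), the length of the vectors \<open>dA\<close> in integer
    coordinates.\<close>
  define l where "l = 12 / sqrt 8"
  define y where "y i = l * x $ i" for i
  have dotr_y: "dotr Y y = l * dotr Y (\<lambda>i. x $ i)" for Y
    by (simp add: dotr_def y_def sum_distrib_left mult_ac)
  have "perp (\<lambda>i. x $ i)" using xs by (simp add: perp_sphere_def W_perp_iff_perp)
  then have py: "perp y" by (simp add: perp_def y_def flip: sum_distrib_left)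
  have dy: "dotr Y y = 4 \<or> dotr Y y = - 4" if Y: "Y \<in> shell 24 2 16 \<union> shell 8 (-2) 16" for Y
  proof -
    have "dotr Y (\<lambda>i. x $ i) * (3 / (sqrt 21 * sqrt 8)) = \<sigma> \<or> dotr Y (\<lambda>i. x $ i) * (3 / (sqrt 21 * sqrt 8)) = - \<sigma>"
    proof -
      have tv: "x \<bullet> z = \<sigma> \<or> x \<bullet> z = - \<sigma>" if "z \<in> hatB \<union> hatG" for z
        using x that by (simp add: two_valued_def)
      from Y have "uB Y \<in> hatB \<union> hatG \<or> uG Y \<in> hatB \<union> hatG" by (auto simp: hatB_def hatG_def)
      then show ?thesis using tv [of "uB Y"] tv [of "uG Y"] unfolding inner_hat [OF xs] by blast
    qed
    then have "dotr Y (\<lambda>i. x $ i) = sqrt 8 / 3 \<or> dotr Y (\<lambda>i. x $ i) = - (sqrt 8 / 3)"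
      using sqrt21 by (auto simp: field_simps)
    moreover have "l * (sqrt 8 / 3) = 4" by (simp add: l_def)
    ultimately show ?thesis unfolding dotr_y by (metis mult_minus_right)
  qed
  have "\<exists>e\<in>{1, -1}. \<exists>Y\<in>shell 24 2 8. \<forall>i. y i = e * (real_of_int (Y i) - proj112 i)"
    by (rule classify_162 [OF py]) (rule dy)
  then obtain e Y where e: "e \<in> {1, -1}" "Y \<in> shell 24 2 8" "\<And>i. y i = e * (real_of_int (Y i) - proj112 i)"
    by (elim bexE) blast
  have "x $ i = (e *\<^sub>R uA Y) $ i" for i
  proof -
    have "y i = e * (sqrt 8 * dA Y $ i)" by (simp only: sqrt8_d e(3))
    then have "12 * x $ i = e * ((sqrt 8 * sqrt 8) * dA Y $ i)"
      using sqrt21(4) by (simp add: y_def l_def field_simps)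
    then have "12 * x $ i = e * (8 * dA Y $ i)" unfolding sqrt21 .
    then show ?thesis by (simp add: uA_def field_simps)
  qed
  then have "x = e *\<^sub>R uA Y" by (simp add: vec_eq_iff)
  then show "x \<in> C_hat G" unfolding C_hat_eq using e(1,2) by (auto simp: hatA_def)
qed

lemma dim_W_perp: "dim (orthogonal_comp W_uvw) = 21"
proof -
  have ne: "vec_u \<noteq> vec_v" "vec_u \<noteq> vec_w" "vec_v \<noteq> vec_w" using inner_vecs by force+
  have "independent {vec_u, vec_v, vec_w}"
  proof (rule independent_if_scalars_zero)
    fix f x assume s: "(\<Sum>y\<in>{vec_u, vec_v, vec_w}. f y *\<^sub>R y) = 0" and x: "x \<in> {vec_u, vec_v, vec_w}"
    have s': "f vec_u *\<^sub>R vec_u + f vec_v *\<^sub>R vec_v + f vec_w *\<^sub>R vec_w = 0" using s ne by (simp add: add.assoc)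
    have "(f vec_u *\<^sub>R vec_u + f vec_v *\<^sub>R vec_v + f vec_w *\<^sub>R vec_w) \<bullet> y = 0" for y unfolding s' by simp
    from this [of vec_u] this [of vec_v] this [of vec_w]
    have "4 * f vec_u + f vec_v + 3 * f vec_w = 0" "f vec_u + 4 * f vec_v + 3 * f vec_w = 0"
      "3 * f vec_u + 3 * f vec_v + 6 * f vec_w = 0"
      by (simp_all add: inner_add_left inner_vecs mult.commute)
    then have "f vec_u = 0" "f vec_v = 0" "f vec_w = 0" by linarith+
    then show "f x = 0" using x by auto
  qed simp
  then have "dim W_uvw = 3" unfolding W_uvw_def dim_span using ne by (simp add: dim_eq_card_independent)
  moreover have "{y \<in> UNIV. \<forall>x\<in>W_uvw. orthogonal x y} = orthogonal_comp W_uvw"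
    by (auto simp: orthogonal_comp_def)
  ultimately show ?thesis
    using dim_subspace_orthogonal_to_vectors [OF subspace_W subspace_UNIV] by simp
qed

lemma \<sigma>_bounds: "0 < \<sigma>" "\<sigma> < 1" "\<sigma>\<^sup>2 = 1 / 21"
  by (simp_all add: power_divide)

section \<open>Minimizers and polarization values\<close>

lemma polarization_two_valued:
  assumes h: "potential h" "pos_nth_deriv 4 h" and Z: "finite Z" "Z \<subseteq> perp_sphere W_uvw" "two_valued Z \<noteq> {}"
    and mom: "\<And>x. x \<in> perp_sphere W_uvw \<Longrightarrow> (\<Sum>z\<in>Z. x \<bullet> z) = 0"
      "\<And>x. x \<in> perp_sphere W_uvw \<Longrightarrow> (\<Sum>z\<in>Z. (x \<bullet> z)\<^sup>2) = real (card Z) / 21"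
      "\<And>x. x \<in> perp_sphere W_uvw \<Longrightarrow> (\<Sum>z\<in>Z. (x \<bullet> z) ^ 3) = 0"
  shows "minimizers h W_uvw Z = two_valued Z"
    "polarization h W_uvw Z = ereal (real (card Z) / 2 * (real_of_ereal (h (- \<sigma>)) + real_of_ereal (h \<sigma>)))"
  using polarization_of_design [OF h \<sigma>_bounds(1,2) Z(1,2) mom(1) _ mom(3) two_valued_def Z(3)] mom(2) \<sigma>_bounds(3)
  by simp_all

lemma hats_nonempty: "C_hat G \<noteq> {}" "D_hat G \<noteq> {}"
  using card_C_hat card_D_hat by auto

lemma polarization_C_hat:
  assumes h: "potential h" "pos_nth_deriv 4 h"
  shows "minimizers h W_uvw (C_hat G) = D_hat G"
    "polarization h W_uvw (C_hat G) = ereal (112 * (real_of_ereal (h (- \<sigma>)) + real_of_ereal (h \<sigma>)))"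
proof -
  have tv: "two_valued (C_hat G) = D_hat G"
    unfolding C_hat_eq two_valued_symmetric two_valued_hatA ..
  have sub: "C_hat G \<subseteq> perp_sphere W_uvw" "finite (C_hat G)"
    using hat_sphere(1) perp_sphere_uminus unfolding C_hat_eq by auto
  note sym = sum_symmetric [OF finite_hat(1) hatA_antipodal, folded C_hat_eq]
  have "(\<Sum>z\<in>C_hat G. x \<bullet> z) = 0" "(\<Sum>z\<in>C_hat G. (x \<bullet> z)\<^sup>2) = real (card (C_hat G)) / 21"
    "(\<Sum>z\<in>C_hat G. (x \<bullet> z) ^ 3) = 0" if "x \<in> perp_sphere W_uvw" for x
    unfolding sym card_C_hat using moments_hatA [OF that] by (simp_all flip: sum_distrib_left)
  from polarization_two_valued [OF h sub(2,1) _ this] show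
    "minimizers h W_uvw (C_hat G) = D_hat G"
    "polarization h W_uvw (C_hat G) = ereal (112 * (real_of_ereal (h (- \<sigma>)) + real_of_ereal (h \<sigma>)))"
    using hats_nonempty tv by (simp_all add: card_C_hat)
qed

lemma polarization_D_hat:
  assumes h: "potential h" "pos_nth_deriv 4 h"
  shows "minimizers h W_uvw (D_hat G) = C_hat G"
    "polarization h W_uvw (D_hat G) = ereal (324 * (real_of_ereal (h (- \<sigma>)) + real_of_ereal (h \<sigma>)))"
proof -
  have tv: "two_valued (D_hat G) = C_hat G"
    unfolding D_hat_eq two_valued_symmetric two_valued_hatBG ..
  have sub: "D_hat G \<subseteq> perp_sphere W_uvw" "finite (D_hat G)"
    using hat_sphere(2) perp_sphere_uminus [OF hat_sphere(2)] unfolding D_hat_eq by auto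
  have fin: "finite (hatB \<union> hatG)" by simp
  note sym = sum_symmetric [OF fin hatBG_antipodal, folded D_hat_eq]
  have "(\<Sum>z\<in>D_hat G. x \<bullet> z) = 0" "(\<Sum>z\<in>D_hat G. (x \<bullet> z)\<^sup>2) = real (card (D_hat G)) / 21"
    "(\<Sum>z\<in>D_hat G. (x \<bullet> z) ^ 3) = 0" if "x \<in> perp_sphere W_uvw" for x
    unfolding sym card_D_hat using moments_hatB(2) [OF that] moment_hatG [OF that] hatB_hatG
    by (simp_all add: sum.union_disjoint flip: sum_distrib_left)
  from polarization_two_valued [OF h sub(2,1) _ this] show
    "minimizers h W_uvw (D_hat G) = C_hat G"
    "polarization h W_uvw (D_hat G) = ereal (324 * (real_of_ereal (h (- \<sigma>)) + real_of_ereal (h \<sigma>)))"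
    using hats_nonempty tv by (simp_all add: card_D_hat)
qed

lemma polarization_C112:
  assumes h: "potential h" "pos_nth_deriv 4 h"
  shows "minimizers h W_uvw (N_proj W_uvw ` C112 G) \<noteq> {}"
    "polarization h W_uvw (N_proj W_uvw ` C112 G) = ereal (56 * (real_of_ereal (h (- \<sigma>)) + real_of_ereal (h \<sigma>)))"
  using polarization_two_valued [OF h finite_hat(1) hat_sphere(1)] moments_hatA two_valued_hatA hats_nonempty(2)
  by (simp_all add: N_C112 card_hat)

text \<open>The points of \<open>C_hat G\<close> are two-valued on the larger set
  \<open>hatB \<union> hatG\<close>, hence on \<open>hatB\<close>; this shows that the bound is
  attained.\<close>

lemma polarization_C162:
  assumes h: "potential h" "pos_nth_deriv 4 h"
  shows "minimizers h W_uvw (N_proj W_uvw ` C162 G) \<noteq> {}"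
    "polarization h W_uvw (N_proj W_uvw ` C162 G) = ereal (81 * (real_of_ereal (h (- \<sigma>)) + real_of_ereal (h \<sigma>)))"
proof -
  have "two_valued (hatB \<union> hatG) \<subseteq> two_valued hatB" by (auto simp: two_valued_def)
  then have "two_valued hatB \<noteq> {}" using two_valued_hatBG hats_nonempty(1) by auto
  then show "minimizers h W_uvw (N_proj W_uvw ` C162 G) \<noteq> {}"
    "polarization h W_uvw (N_proj W_uvw ` C162 G) = ereal (81 * (real_of_ereal (h (- \<sigma>)) + real_of_ereal (h \<sigma>)))"
    using polarization_two_valued [OF h finite_hat(2)] hat_sphere(2) moments_hatB
    by (simp_all add: N_C162 card_hat)
qed

lemma potential_at_node:
  assumes "potential h" "t \<in> {-1<..<1}"
  shows "h t = ereal (real_of_ereal (h t))"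
  using assms by (cases "h t") (auto simp: potential_def)

end

theorem theorem5p13:
  fixes G :: "(bit ^ 24) set"
  assumes "extended_golay_code G"
  shows
    "dim (orthogonal_comp W_uvw) = 21 \<and>
     C_hat G \<subseteq> perp_sphere W_uvw \<and> card (C_hat G) = 224 \<and>
     D_hat G \<subseteq> perp_sphere W_uvw \<and> card (D_hat G) = 648 \<and>
     (\<forall>h. potential h \<and> pos_nth_deriv 4 h \<longrightarrow>
        polarization h W_uvw (C_hat G) = 112 * h (- 1 / sqrt 21) + 112 * h (1 / sqrt 21) \<and>
        minimizers h W_uvw (C_hat G) \<noteq> {} \<and>
        polarization h W_uvw (D_hat G) = 324 * h (- 1 / sqrt 21) + 324 * h (1 / sqrt 21) \<and>
        minimizers h W_uvw (D_hat G) \<noteq> {} \<and>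
        minimizers h W_uvw (N_proj W_uvw ` C112 G) \<noteq> {} \<and>
        minimizers h W_uvw (N_proj W_uvw ` C162 G) \<noteq> {} \<and>
        polarization h W_uvw (C_hat G) / 224 = polarization h W_uvw (D_hat G) / 648 \<and>
        polarization h W_uvw (D_hat G) / 648
          = polarization h W_uvw (N_proj W_uvw ` C112 G) / 112 \<and>
        polarization h W_uvw (N_proj W_uvw ` C112 G) / 112
          = polarization h W_uvw (N_proj W_uvw ` C162 G) / 162) \<and>
     (\<forall>h. strictly_absolutely_monotone h \<longrightarrow>
        minimizers h W_uvw (C_hat G) = D_hat G \<and>
        minimizers h W_uvw (D_hat G) = C_hat G)"
proof -
  interpret golay_code G using assms by unfold_locales
  have neg: "- 1 / sqrt 21 = - (1 / sqrt 21)" by simp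
  have "polarization h W_uvw (C_hat G) = 112 * h (- 1 / sqrt 21) + 112 * h (1 / sqrt 21) \<and>
        minimizers h W_uvw (C_hat G) \<noteq> {} \<and>
        polarization h W_uvw (D_hat G) = 324 * h (- 1 / sqrt 21) + 324 * h (1 / sqrt 21) \<and>
        minimizers h W_uvw (D_hat G) \<noteq> {} \<and>
        minimizers h W_uvw (N_proj W_uvw ` C112 G) \<noteq> {} \<and>
        minimizers h W_uvw (N_proj W_uvw ` C162 G) \<noteq> {} \<and>
        polarization h W_uvw (C_hat G) / 224 = polarization h W_uvw (D_hat G) / 648 \<and>
        polarization h W_uvw (D_hat G) / 648
          = polarization h W_uvw (N_proj W_uvw ` C112 G) / 112 \<and>
        polarization h W_uvw (N_proj W_uvw ` C112 G) / 112
          = polarization h W_uvw (N_proj W_uvw ` C162 G) / 162"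
    if h: "potential h" "pos_nth_deriv 4 h" for h
  proof -
    have "- (1 / sqrt 21) \<in> {-1<..<1}" "1 / sqrt 21 \<in> {-1<..<(1::real)}"
      using \<sigma>_bounds(1,2) less_trans [of "-1" 0 "1 / sqrt 21"] by auto
    \<comment> \<open>Finite values at the nodes reduce the extended real equations, including the
      quotients, to real arithmetic.\<close>
    then obtain x y where node: "h (- (1 / sqrt 21)) = ereal x" "h (1 / sqrt 21) = ereal y"
      using potential_at_node [OF h(1)] by metis
    show ?thesis
      using polarization_C_hat [OF h] polarization_D_hat [OF h] polarization_C112 [OF h] polarization_C162 [OF h]
        hats_nonempty
      unfolding neg node by simp
  qed
  moreover have "pos_nth_deriv 4 h" "potential h" if "strictly_absolutely_monotone h" for h
    using that by (auto simp: strictly_absolutely_monotone_def)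
  moreover have "C_hat G \<subseteq> perp_sphere W_uvw" "D_hat G \<subseteq> perp_sphere W_uvw"
    using hat_sphere perp_sphere_uminus [OF hat_sphere(1)] perp_sphere_uminus [OF hat_sphere(2)]
    unfolding C_hat_eq D_hat_eq by auto
  ultimately show ?thesis
    using dim_W_perp card_C_hat card_D_hat polarization_C_hat(1) polarization_D_hat(1) by blast
qed

end
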